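(* Fix $c>0$ and $\eta\in[0,1)$ satisfying $c<\overline c(\eta)$. If $p=p(n)=(1+o(1))\,c/\sqrt n$ as $n\to\infty$, then $$\lim_{n\to\infty}\frac{1}{n^{3/2}}\log \mathbb P_p\big(X\le \eta\,\mathbb E_p X\big)=\frac12\left[\frac{W(2\zeta c^2)^{3/2}+3W(2\zeta c^2)^{1/2}}{3\sqrt{2\zeta}}-\frac{\log(1-\zeta)\,\eta c^3}{3}-c\right],$$ where $\zeta$ is the unique solution in $[0,1]$ to the equation $$(1-\zeta)\left(\frac{W(2\zeta c^2)}{2\zeta c^2}\right)^{3/2}=\eta .$$
   Context: $\mathbb P_p,\mathbb E_p$ denote probability and expectation for the Erdős–Rényi random graph $G(n,p)$ on $n$ labeled vertices (each of the $\binom n2$ edges present independently with probability $p$), and $X$ is the number of triangles of the random graph. $W$ is the Lambert-W function, the inverse of $x\mapsto xe^x$ on the nonnegative reals; $W(x)/x$ is taken to be $1$ at $x=0$. Define $$\eta^\ast=\left(\frac{W(2/e)}{2/e}\right)^{3/2}\approx 0.49928,\qquad \overline c(\eta)=\begin{cases}\dfrac{1}{\sqrt{e(1-\eta/\eta^\ast)}} & \text{if }\eta<\eta^\ast,\\ +\infty & \text{if }\eta\ge\eta^\ast.\end{cases}$$ When $\eta=0$ (so $\zeta=1$), the term $\log(1-\zeta)\,\eta c^3/3$ is interpreted as $0$. *)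

theory Defs
  imports "HOL-Probability.Probability" "HOL-Library.Landau_Symbols"
begin

definition all_edges :: "nat \<Rightarrow> nat set set" where
  "all_edges n = {e. e \<subseteq> {..<n} \<and> card e = 2}"

text \<open>A graph on the vertex set \<open>{..<n}\<close> is represented by its set of edges.\<close>

definition gnp :: "nat \<Rightarrow> real \<Rightarrow> nat set set pmf" where
  "gnp n p = map_pmf (\<lambda>f. {e \<in> all_edges n. f e})
     (Pi_pmf (all_edges n) False (\<lambda>_. bernoulli_pmf p))"

definition num_triangles :: "nat \<Rightarrow> nat set set \<Rightarrow> nat" where
  "num_triangles n G =
     card {T. T \<subseteq> {..<n} \<and> card T = 3 \<and> (\<forall>u\<in>T. \<forall>v\<in>T. u \<noteq> v \<longrightarrow> {u, v} \<in> G)}"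

definition expected_triangles :: "nat \<Rightarrow> real \<Rightarrow> real" where
  "expected_triangles n p =
     measure_pmf.expectation (gnp n p) (\<lambda>G. real (num_triangles n G))"

definition lower_tail_prob :: "real \<Rightarrow> nat \<Rightarrow> real \<Rightarrow> real" where
  "lower_tail_prob \<eta> n p =
     measure_pmf.prob (gnp n p)
       {G. real (num_triangles n G) \<le> \<eta> * expected_triangles n p}"

text \<open>The Lambert function; its value is unspecified for negative arguments.\<close>

definition lambert_W :: "real \<Rightarrow> real" where
  "lambert_W = inv_into {0..} (\<lambda>x. x * exp x)"

definition lambert_W_ratio :: "real \<Rightarrow> real" where
  "lambert_W_ratio x = (if x = 0 then 1 else lambert_W x / x)"

definition eta_star :: real where
  "eta_star = lambert_W_ratio (2 / exp 1) powr (3/2)"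

definition c_bar :: "real \<Rightarrow> ereal" where
  "c_bar \<eta> =
     (if \<eta> < eta_star then ereal (1 / sqrt (exp 1 * (1 - \<eta> / eta_star))) else \<infinity>)"

definition zeta_solution :: "real \<Rightarrow> real \<Rightarrow> real \<Rightarrow> bool" where
  "zeta_solution c \<eta> \<zeta> \<longleftrightarrow>
     \<zeta> \<in> {0..1} \<and> (1 - \<zeta>) * lambert_W_ratio (2 * \<zeta> * c\<^sup>2) powr (3/2) = \<eta>"

text \<open>For \<open>\<eta> = 0\<close> and \<open>\<zeta> = 1\<close> the logarithmic term vanishes because of the factor \<open>\<eta>\<close>,
  since \<^term>\<open>ln (0 :: real)\<close> is an ordinary real number.\<close>

definition rate :: "real \<Rightarrow> real \<Rightarrow> real \<Rightarrow> real" where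
  "rate c \<eta> \<zeta> =
     (1/2) * ((lambert_W (2 * \<zeta> * c\<^sup>2) powr (3/2) + 3 * lambert_W (2 * \<zeta> * c\<^sup>2) powr (1/2))
                / (3 * sqrt (2 * \<zeta>))
              - ln (1 - \<zeta>) * \<eta> * c ^ 3 / 3 - c)"

end

theory Submission
  imports Defs "HOL-Real_Asymp.Real_Asymp"
begin

text \<open>Write \<open>b = 1 - \<zeta>\<close> and tilt \<open>G(n,p)\<close> by \<open>b\<close> to the number of triangles. Given the rest
  \<open>H\<close> of the graph, the neighbourhood of a vertex is a random set \<open>S\<close> with weight
  \<open>\<rho> ^ card S * b ^ e\<close>, where \<open>e\<close> counts the edges of \<open>H\<close> inside \<open>S\<close>: an antiferromagnetic
  two-spin model. As \<open>H\<close> has few 4-cycles, the odds that a vertex lies in \<open>S\<close> obey a tree-like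
  recursion over its neighbours, so bounds \<open>[l, h]\<close> on all degrees and odds (in units of \<open>sqrt n\<close>
  and \<open>1 / sqrt n\<close>) improve to \<open>[F h, F l]\<close> with \<open>F x = c exp (- \<zeta> x\<^sup>2)\<close>, up to an error and
  outside an event of exponentially small probability. For \<open>2 \<zeta> c\<^sup>2 < e\<close> the map \<open>F\<close> is a
  contraction, hence all degrees concentrate at its fixed point times \<open>sqrt n\<close>. This determines the
  expected number of edges, which is the derivative of the log-partition function in \<open>ln \<rho>\<close>;
  integrating gives the limiting Laplace transform of the number of triangles. It is
  differentiable in \<open>ln b\<close>, so the lower tail follows by exponential tilting.\<close>

section \<open>Two-spin models on a finite graph\<close>

text \<open>If each of about n sites enters a neighbourhood with odds x / sqrt n, the degree is
  about x sqrt n, so degrees and odds share one scaled value x. A member of the random set pays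
  about exp (- \<zeta> q) for each neighbour of odds q; x sqrt n neighbours of odds x / sqrt n give
  the square in \<open>F\<close>. The squared slope of \<open>F\<close> is at most 2 \<zeta> c^2 /
  e, whence the threshold e. The obstacle is that removing a vertex and tilting its neighbours
  destroys the constant field. The damage lies in one closed neighbourhood, and small codegrees keep
  it sparse in all other neighbourhoods. Every round adds damage, but the number of rounds depends
  on the desired accuracy only, not on n, so a tolerance \<kappa> sqrt n with a small constant
  \<kappa> suffices. The integration runs over the field and not over b because degrees determine
  edge counts, the log-partition function vanishes at field 0, and every smaller field is again
  subcritical. For \<eta> = 0 the parameter is b = 0, where the Laplace transform is already the
  probability of having no triangle.\<close>

definition nb :: "'a set set \<Rightarrow> 'a \<Rightarrow> 'a set" where
  "nb H x = {y. {x, y} \<in> H}"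

definition inner_edges :: "'a set set \<Rightarrow> 'a set \<Rightarrow> 'a set set" where
  "inner_edges H S = {e \<in> H. e \<subseteq> S}"

definition tilt :: "real \<Rightarrow> 'a set \<Rightarrow> ('a \<Rightarrow> real) \<Rightarrow> 'a \<Rightarrow> real" where
  "tilt r X f = (\<lambda>y. if y \<in> X then r * f y else f y)"

text \<open>The partition function of the two-spin model with external field \<open>f\<close>. For
  \<open>b = 0\<close> only independent sets of \<open>H\<close> count, and it is the partition
  function of the hard-core model.\<close>

definition zpart :: "real \<Rightarrow> 'a set \<Rightarrow> 'a set set \<Rightarrow> ('a \<Rightarrow> real) \<Rightarrow> real" where
  "zpart b A H f = (\<Sum>S\<in>Pow A. (\<Prod>x\<in>S. f x) * b ^ card (inner_edges H S))"

text \<open>\<open>occ\<close> is the odds that \<open>w\<close> belongs to the random set: if it does, each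
  neighbour pays an extra factor \<open>b\<close>, which is a change of the external field.\<close>

definition occ :: "real \<Rightarrow> 'a set \<Rightarrow> 'a set set \<Rightarrow> ('a \<Rightarrow> real) \<Rightarrow> 'a \<Rightarrow> real" where
  "occ b A H f w =
     f w * zpart b A H (tilt b (nb H w) (f(w := 0))) / zpart b A H (f(w := 0))"

locale spin_model =
  fixes b :: real and A :: "'a set" and H :: "'a set set"
  assumes b0: "0 \<le> b" and b1: "b \<le> 1" and finA: "finite A"
    and edges: "H \<subseteq> {e. e \<subseteq> A \<and> card e = 2}"
begin

lemma finite_H: "finite H"
  using edges finA finite_subset[of H "Pow A"] by auto

lemma nb_subset: "nb H x \<subseteq> A"
  using edges by (auto simp: nb_def)

lemma nb_irrefl: "x \<notin> nb H x"
  using edges by (auto simp: nb_def)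

lemma finite_nb: "finite (nb H x)"
  using nb_subset finA finite_subset by blast

lemma card_inner_insert:
  assumes "w \<notin> S" "S \<subseteq> A"
  shows "card (inner_edges H (insert w S)) = card (inner_edges H S) + card (S \<inter> nb H w)"
proof -
  have eq: "inner_edges H (insert w S) = inner_edges H S \<union> (\<lambda>y. {w, y}) ` (S \<inter> nb H w)"
  proof (intro equalityI subsetI)
    fix e assume e: "e \<in> inner_edges H (insert w S)"
    then have eH: "e \<in> H" "e \<subseteq> insert w S" by (auto simp: inner_edges_def)
    show "e \<in> inner_edges H S \<union> (\<lambda>y. {w, y}) ` (S \<inter> nb H w)"
    proof (cases "w \<in> e")
      case True
      have "card e = 2" using eH edges by auto
      then obtain x y where "e = {x, y}" "x \<noteq> y" by (auto simp: card_2_iff)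
      then obtain z where "e = {w, z}" "z \<noteq> w" using True by auto
      then show ?thesis using eH by (auto simp: nb_def)
    qed (use eH in \<open>auto simp: inner_edges_def\<close>)
  qed (auto simp: inner_edges_def nb_def)
  have fS: "finite S" using assms finA finite_subset by blast
  have "card ((\<lambda>y. {w, y}) ` (S \<inter> nb H w)) = card (S \<inter> nb H w)"
    by (rule card_image) (auto simp: inj_on_def doubleton_eq_iff)
  moreover have "inner_edges H S \<inter> (\<lambda>y. {w, y}) ` (S \<inter> nb H w) = {}"
    using assms by (auto simp: inner_edges_def)
  moreover have "finite (inner_edges H S)" using finite_H by (auto simp: inner_edges_def)
  ultimately show ?thesis
    unfolding eq using fS by (subst card_Un_disjoint) auto
qed

lemma prod_tilt:
  assumes "finite S"
  shows "(\<Prod>x\<in>S. tilt r X f x) = r ^ card (S \<inter> X) * (\<Prod>x\<in>S. f x)"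
proof -
  have "(\<Prod>x\<in>S. tilt r X f x) = (\<Prod>x\<in>S. (if x \<in> X then r else 1) * f x)"
    by (intro prod.cong) (auto simp: tilt_def)
  also have "\<dots> = r ^ card (S \<inter> X) * (\<Prod>x\<in>S. f x)"
    using assms by (simp add: prod.distrib prod.If_cases Int_def)
  finally show ?thesis .
qed

lemma sum_Pow_insert_split:
  assumes "w \<in> A"
  shows "(\<Sum>S\<in>Pow A. g S) =
    (\<Sum>S\<in>Pow (A - {w}). g S) + (\<Sum>S\<in>Pow (A - {w}). (g (insert w S) :: real))"
proof -
  have A: "A = insert w (A - {w})" using assms by auto
  have "Pow A = Pow (A - {w}) \<union> insert w ` Pow (A - {w})"
    by (subst A, subst Pow_insert) simp
  moreover have "inj_on (insert w) (Pow (A - {w}))"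
    by (auto simp: inj_on_def)
  moreover have "Pow (A - {w}) \<inter> insert w ` Pow (A - {w}) = {}" by auto
  ultimately show ?thesis
    using finA by (simp add: sum.union_disjoint sum.reindex)
qed

text \<open>A vertex is deleted by giving it field 0. Thus \<open>A\<close> and \<open>H\<close>
  stay fixed during the whole recursion and only the field changes.\<close>

lemma zpart_zero:
  assumes "w \<in> A" "f w = 0"
  shows "zpart b A H f =
    (\<Sum>S\<in>Pow (A - {w}). (\<Prod>x\<in>S. f x) * b ^ card (inner_edges H S))"
proof -
  have "(\<Prod>x\<in>insert w S. f x) = 0" if "S \<in> Pow (A - {w})" for S
    using that assms finA finite_subset by (intro prod_zero) (auto intro: finite_subset)
  then show ?thesis
    unfolding zpart_def by (subst sum_Pow_insert_split[OF assms(1)]) simp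
qed

lemma zpart_split:
  assumes "w \<in> A"
  shows "zpart b A H f =
    zpart b A H (f(w := 0)) + f w * zpart b A H (tilt b (nb H w) (f(w := 0)))"
proof -
  let ?T = "tilt b (nb H w) (f(w := 0))"
  have t0: "?T w = 0" by (simp add: tilt_def)
  have 1: "zpart b A H (f(w := 0)) =
      (\<Sum>S\<in>Pow (A - {w}). (\<Prod>x\<in>S. f x) * b ^ card (inner_edges H S))"
    unfolding zpart_zero[OF assms, of "f(w := 0)", simplified]
    by (intro sum.cong refl arg_cong2[where f = times] prod.cong) auto
  have 2: "(\<Prod>x\<in>insert w S. f x) * b ^ card (inner_edges H (insert w S)) =
      f w * ((\<Prod>x\<in>S. ?T x) * b ^ card (inner_edges H S))" if S: "S \<in> Pow (A - {w})" for S
  proof -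
    have fS: "finite S" using S finA finite_subset by auto
    have wS: "w \<notin> S" using S by auto
    have "(\<Prod>x\<in>S. (f(w := 0)) x) = (\<Prod>x\<in>S. f x)"
      using wS by (intro prod.cong) auto
    then show ?thesis
      using card_inner_insert[of w S] S wS fS by (simp add: prod_tilt power_add subset_Diff_insert)
  qed
  show ?thesis
    unfolding 1 zpart_zero[of w ?T, OF assms t0] sum_distrib_left
    unfolding zpart_def sum_Pow_insert_split[OF assms]
    by (intro arg_cong2[where f="(+)"] refl sum.cong 2)
qed

lemma zpart_mono:
  assumes "\<And>x. x \<in> A \<Longrightarrow> 0 \<le> f x" "\<And>x. x \<in> A \<Longrightarrow> f x \<le> g x"
  shows "zpart b A H f \<le> zpart b A H g"
  unfolding zpart_def
  by (intro sum_mono mult_right_mono prod_mono) (use assms b0 in auto)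

lemma zpart_ge_1:
  assumes "\<And>x. x \<in> A \<Longrightarrow> 0 \<le> f x"
  shows "1 \<le> zpart b A H f"
proof -
  have "inner_edges H {} = {}" using edges by (auto simp: inner_edges_def)
  then have "1 = (\<Prod>x\<in>{}. f x) * b ^ card (inner_edges H {})" by simp
  also have "\<dots> \<le> zpart b A H f"
    unfolding zpart_def
    by (rule member_le_sum) (use assms b0 finA in \<open>auto intro!: mult_nonneg_nonneg prod_nonneg\<close>)
  finally show ?thesis .
qed

lemma tilt_nonneg: "0 \<le> r \<Longrightarrow> 0 \<le> f x \<Longrightarrow> 0 \<le> tilt r X f x"
  by (simp add: tilt_def)

lemma tilt_le: "r \<le> 1 \<Longrightarrow> 0 \<le> f x \<Longrightarrow> tilt r X f x \<le> f x"
  using mult_right_mono[of r 1 "f x"] by (simp add: tilt_def)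

lemma occ_nonneg:
  assumes "\<And>x. x \<in> A \<Longrightarrow> 0 \<le> f x" "w \<in> A"
  shows "0 \<le> occ b A H f w"
proof -
  have "1 \<le> zpart b A H (tilt b (nb H w) (f(w := 0)))"
    by (intro zpart_ge_1 tilt_nonneg b0) (use assms in auto)
  moreover have "1 \<le> zpart b A H (f(w := 0))"
    by (intro zpart_ge_1) (use assms in auto)
  ultimately show ?thesis using assms by (simp add: occ_def)
qed

lemma occ_le_field:
  assumes "\<And>x. x \<in> A \<Longrightarrow> 0 \<le> f x" "w \<in> A"
  shows "occ b A H f w \<le> f w"
proof -
  have "zpart b A H (tilt b (nb H w) (f(w := 0))) \<le> zpart b A H (f(w := 0))"
    by (intro zpart_mono tilt_nonneg tilt_le b0 b1) (use assms in auto)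
  moreover have "1 \<le> zpart b A H (f(w := 0))"
    by (intro zpart_ge_1) (use assms in auto)
  ultimately show ?thesis
    using assms unfolding occ_def times_divide_eq_right[symmetric]
    by (intro mult_left_le) auto
qed

text \<open>The partition function is affine in the field at \<open>w\<close>; \<open>occ\<close> is
  its linear part divided by its constant part.\<close>

lemma zpart_occ:
  assumes "\<And>x. x \<in> A \<Longrightarrow> 0 \<le> f x" "w \<in> A"
  shows "zpart b A H (f(w := r * f w)) = zpart b A H (f(w := 0)) * (1 + r * occ b A H f w)"
proof -
  have "1 \<le> zpart b A H (f(w := 0))"
    by (intro zpart_ge_1) (use assms in auto)
  then show ?thesis
    by (subst zpart_split[OF assms(2)]) (simp add: occ_def field_simps)
qed

lemma zpart_scale:
  assumes "\<And>x. x \<in> A \<Longrightarrow> 0 \<le> f x" "w \<in> A"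
  shows "zpart b A H (f(w := r * f w)) =
    zpart b A H f * ((1 + r * occ b A H f w) / (1 + occ b A H f w))"
  using zpart_occ[of f w r, OF assms] zpart_occ[of f w 1, OF assms] occ_nonneg[of f w, OF assms]
  by (simp add: field_simps)

lemma tilt_insert: "x \<notin> X \<Longrightarrow> tilt r (insert x X) f = (tilt r X f)(x := r * tilt r X f x)"
  by (auto simp: tilt_def)

text \<open>Telescoping: the fields on \<open>X\<close> are multiplied by \<open>r\<close> one
  vertex at a time, and \<open>zpart_scale\<close> gives the factor of each change. The fields met
  on the way are \<open>tilt r Y f\<close> with \<open>Y\<close> inside \<open>X\<close>, so the
  bound \<open>q\<close> must hold for all of these.\<close>

lemma zpart_tilt_le:
  assumes "\<And>x. x \<in> A \<Longrightarrow> 0 \<le> f x" "0 \<le> r" "finite X" "X \<subseteq> A"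
    and "\<And>Y x. Y \<subseteq> X \<Longrightarrow> x \<in> X - Y \<Longrightarrow>
      (1 + r * occ b A H (tilt r Y f) x) / (1 + occ b A H (tilt r Y f) x) \<le> q x"
  shows "zpart b A H (tilt r X f) \<le> zpart b A H f * (\<Prod>x\<in>X. q x)"
  using assms(3-5)
proof (induction X)
  case empty
  show ?case by (simp add: tilt_def)
next
  case (insert x X)
  let ?g = "tilt r X f"
  have g0: "0 \<le> ?g y" if "y \<in> A" for y using that assms by (simp add: tilt_nonneg)
  have q0: "0 \<le> q y" if "y \<in> insert x X" for y
  proof -
    have "0 \<le> occ b A H (tilt r {} f) y"
      using that insert.prems assms by (intro occ_nonneg) (auto simp: tilt_def)
    then have "0 \<le> (1 + r * occ b A H (tilt r {} f) y) / (1 + occ b A H (tilt r {} f) y)"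
      using assms by simp
    also have "\<dots> \<le> q y" using that by (intro insert.prems) auto
    finally show ?thesis .
  qed
  have "zpart b A H (tilt r (insert x X) f) =
      zpart b A H ?g * ((1 + r * occ b A H ?g x) / (1 + occ b A H ?g x))"
    unfolding tilt_insert[OF insert.hyps(2)]
    using zpart_scale[of ?g x r] g0 insert.prems by auto
  also have "\<dots> \<le> zpart b A H ?g * q x"
    using insert.hyps zpart_ge_1[of ?g] g0 by (intro mult_left_mono insert.prems) auto
  also have "\<dots> \<le> (zpart b A H f * (\<Prod>x\<in>X. q x)) * q x"
    using insert.prems q0 by (intro mult_right_mono insert.IH) blast+
  finally show ?case using insert.hyps by (simp add: mult_ac)
qed

lemma zpart_tilt_ge:
  assumes "\<And>x. x \<in> A \<Longrightarrow> 0 \<le> f x" "0 \<le> r" "finite X" "X \<subseteq> A" "\<And>x. 0 \<le> q x"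
    and "\<And>Y x. Y \<subseteq> X \<Longrightarrow> x \<in> X - Y \<Longrightarrow>
      q x \<le> (1 + r * occ b A H (tilt r Y f) x) / (1 + occ b A H (tilt r Y f) x)"
  shows "zpart b A H f * (\<Prod>x\<in>X. q x) \<le> zpart b A H (tilt r X f)"
  using assms(3,4,6)
proof (induction X)
  case empty
  show ?case by (simp add: tilt_def)
next
  case (insert x X)
  let ?g = "tilt r X f"
  have g0: "0 \<le> ?g y" if "y \<in> A" for y using that assms by (simp add: tilt_nonneg)
  have "zpart b A H f * (\<Prod>x\<in>insert x X. q x) = (zpart b A H f * (\<Prod>x\<in>X. q x)) * q x"
    using insert.hyps by (simp add: mult_ac)
  also have "\<dots> \<le> zpart b A H ?g * q x"
    using insert.prems assms(5) by (intro mult_right_mono insert.IH) blast+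
  also have "\<dots> \<le> zpart b A H ?g * ((1 + r * occ b A H ?g x) / (1 + occ b A H ?g x))"
    using insert.hyps zpart_ge_1[of ?g] g0 by (intro mult_left_mono insert.prems) auto
  also have "\<dots> = zpart b A H (tilt r (insert x X) f)"
    unfolding tilt_insert[OF insert.hyps(2)]
    using zpart_scale[of ?g x r] g0 insert.prems by auto
  finally show ?case .
qed

text \<open>The quotient in \<open>occ\<close> compares the field before and after all neighbours of
  \<open>w\<close> pay \<open>b\<close>, and \<open>zpart_tilt_le\<close> splits it over the
  neighbours. A neighbour of odds R contributes 1 - (1 - b) R / (1 + R), which decreases in R: lower
  bounds at the neighbours become an upper bound at \<open>w\<close>. This reversal is the
  antiferromagnetic effect.\<close>

lemma occ_le:
  assumes f: "\<And>x. x \<in> A \<Longrightarrow> 0 \<le> f x" and w: "w \<in> A" and lo: "\<And>x. 0 \<le> lo x"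
    and le: "\<And>Y x. Y \<subseteq> nb H w \<Longrightarrow> x \<in> nb H w - Y \<Longrightarrow>
      lo x \<le> occ b A H (tilt b Y (f(w := 0))) x"
  shows "occ b A H f w \<le> f w * exp (- (1 - b) * (\<Sum>x\<in>nb H w. lo x / (1 + lo x)))"
proof -
  let ?f = "f(w := 0)"
  have z1: "1 \<le> zpart b A H ?f" by (intro zpart_ge_1) (use f in auto)
  have "zpart b A H (tilt b (nb H w) ?f) \<le>
      zpart b A H ?f * (\<Prod>x\<in>nb H w. exp (- (1 - b) * (lo x / (1 + lo x))))"
  proof (rule zpart_tilt_le[OF _ b0 finite_nb nb_subset])
    fix Y x assume Yx: "Y \<subseteq> nb H w" "x \<in> nb H w - Y"
    let ?R = "occ b A H (tilt b Y ?f) x"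
    have R: "lo x \<le> ?R" "0 \<le> lo x" using le Yx lo by auto
    have "(1 + b * ?R) / (1 + ?R) = 1 + (- (1 - b) * (?R / (1 + ?R)))"
      using R by (simp add: field_simps)
    also have "\<dots> \<le> exp (- (1 - b) * (?R / (1 + ?R)))" by (rule exp_ge_add_one_self)
    also have "\<dots> \<le> exp (- (1 - b) * (lo x / (1 + lo x)))"
    proof -
      have "lo x / (1 + lo x) \<le> ?R / (1 + ?R)" using R by (simp add: field_simps)
      then show ?thesis
        using b1 by (simp only: exp_le_cancel_iff mult_minus_left neg_le_iff_le mult_left_mono
            diff_ge_0_iff_ge)
    qed
    finally show "(1 + b * ?R) / (1 + ?R) \<le> exp (- (1 - b) * (lo x / (1 + lo x)))" .
  qed (use f in auto)
  then have "zpart b A H (tilt b (nb H w) ?f) / zpart b A H ?f \<le>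
      exp (- (1 - b) * (\<Sum>x\<in>nb H w. lo x / (1 + lo x)))"
    using z1 by (simp add: field_simps sum_distrib_left sum_distrib_right sum_negf
        flip: exp_sum[OF finite_nb])
  then show ?thesis
    unfolding occ_def using f w by (simp add: mult_left_mono flip: times_divide_eq_right)
qed

text \<open>The counterpart of \<open>occ_le\<close>: upper bounds at the neighbours become a lower
  bound at \<open>w\<close>, since each factor is at least exp (- (1 - b) R).\<close>

lemma occ_ge:
  assumes f: "\<And>x. x \<in> A \<Longrightarrow> 0 \<le> f x" and w: "w \<in> A"
    and ge: "\<And>Y x. Y \<subseteq> nb H w \<Longrightarrow> x \<in> nb H w - Y \<Longrightarrow>
      occ b A H (tilt b Y (f(w := 0))) x \<le> hi x"
  shows "f w * exp (- (1 - b) * (\<Sum>x\<in>nb H w. hi x)) \<le> occ b A H f w"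
proof -
  let ?f = "f(w := 0)"
  have z1: "1 \<le> zpart b A H ?f" by (intro zpart_ge_1) (use f in auto)
  have "zpart b A H ?f * (\<Prod>x\<in>nb H w. exp (- (1 - b) * hi x)) \<le> zpart b A H (tilt b (nb H w) ?f)"
  proof (rule zpart_tilt_ge[OF _ b0 finite_nb nb_subset])
    fix Y x assume Yx: "Y \<subseteq> nb H w" "x \<in> nb H w - Y"
    let ?R = "occ b A H (tilt b Y ?f) x"
    have R0: "0 \<le> ?R"
      using Yx nb_subset f by (intro occ_nonneg tilt_nonneg b0) auto
    \<comment> \<open>The right side exceeds the left by b (1 - b) R^2.\<close>
    have "1 + ?R \<le> (1 + b * ?R) * (1 + (1 - b) * ?R)"
      using b0 b1 R0 by (simp add: algebra_simps mult_left_le_one_le)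
    also have "\<dots> \<le> (1 + b * ?R) * exp ((1 - b) * ?R)"
      using b0 R0 by (intro mult_left_mono exp_ge_add_one_self) auto
    finally have "exp (- (1 - b) * ?R) \<le> (1 + b * ?R) / (1 + ?R)"
      using R0 by (simp add: exp_minus field_simps exp_diff)
    moreover have "exp (- (1 - b) * hi x) \<le> exp (- (1 - b) * ?R)"
      using ge[OF Yx] b1
      by (simp only: exp_le_cancel_iff mult_minus_left neg_le_iff_le mult_left_mono diff_ge_0_iff_ge)
    ultimately show "exp (- (1 - b) * hi x) \<le> (1 + b * ?R) / (1 + ?R)" by linarith
  qed (use f in auto)
  then have "exp (- (1 - b) * (\<Sum>x\<in>nb H w. hi x)) \<le>
      zpart b A H (tilt b (nb H w) ?f) / zpart b A H ?f"
    using z1 by (simp add: field_simps sum_distrib_left sum_distrib_right sum_negf sum_subtractf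
        flip: exp_sum[OF finite_nb])
  then show ?thesis
    unfolding occ_def using f w by (simp add: mult_left_mono flip: times_divide_eq_right)
qed

end

section \<open>The recursion over neighbourhoods\<close>

context spin_model
begin

text \<open>\<open>C\<close> collects the undamaged vertices. The recursion only lowers fields, so
  the upper bound \<beta> survives everywhere, while the lower bound \<alpha> is kept on
  \<open>C\<close> alone. Damage is harmless as long as each vertex of \<open>C\<close> has few
  neighbours outside \<open>C\<close>.\<close>

definition admissible :: "real \<Rightarrow> real \<Rightarrow> real \<Rightarrow> 'a set \<Rightarrow> ('a \<Rightarrow> real) \<Rightarrow> bool" where
  "admissible \<alpha> \<beta> \<delta> C f \<longleftrightarrow>
     C \<subseteq> A \<and> (\<forall>y\<in>A. 0 \<le> f y \<and> f y \<le> \<beta>) \<and>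
     (\<forall>w\<in>C. \<alpha> \<le> f w \<and> real (card (nb H w - C)) \<le> \<delta>)"

text \<open>One step of the recursion damages \<open>w\<close> and a set \<open>Y\<close> of its
  neighbours. Another vertex sees at most \<open>K\<close> of these neighbours, by the codegree
  bound, and possibly \<open>w\<close> itself. This is where the scarcity of 4-cycles
  enters.\<close>

lemma admissible_tilt:
  assumes adm: "admissible \<alpha> \<beta> \<delta> C f" and w: "w \<in> A" and Y: "Y \<subseteq> nb H w"
    and codeg: "\<And>x y. x \<in> A \<Longrightarrow> y \<in> A \<Longrightarrow> x \<noteq> y \<Longrightarrow> real (card (nb H x \<inter> nb H y)) \<le> K"
  shows "admissible \<alpha> \<beta> (\<delta> + K + 1) (C - Y - {w}) (tilt b Y (f(w := 0)))"
  unfolding admissible_def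
proof (intro conjI ballI)
  show "C - Y - {w} \<subseteq> A" using adm by (auto simp: admissible_def)
next
  fix y assume y: "y \<in> A"
  have fy: "0 \<le> f y" "f y \<le> \<beta>" using adm y by (auto simp: admissible_def)
  then show "0 \<le> tilt b Y (f(w := 0)) y" using b0 by (simp add: tilt_def)
  have "tilt b Y (f(w := 0)) y \<le> (f(w := 0)) y"
    using fy by (intro tilt_le[OF b1]) auto
  then show "tilt b Y (f(w := 0)) y \<le> \<beta>"
    using fy by (auto split: if_splits)
next
  let ?g = "tilt b Y (f(w := 0))"
  fix y assume y: "y \<in> C - Y - {w}"
  then have yC: "y \<in> C" "y \<in> A" "y \<noteq> w" using adm by (auto simp: admissible_def)
  show "\<alpha> \<le> ?g y" using y adm by (auto simp: tilt_def admissible_def)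
  have "nb H y - (C - Y - {w}) \<subseteq> (nb H y - C) \<union> (nb H y \<inter> nb H w) \<union> {w}"
    using Y by auto
  then have "card (nb H y - (C - Y - {w})) \<le> card ((nb H y - C) \<union> (nb H y \<inter> nb H w) \<union> {w})"
    by (intro card_mono) (auto simp: finite_nb)
  also have "\<dots> \<le> card (nb H y - C) + card (nb H y \<inter> nb H w) + 1"
    by (intro order_trans[OF card_Un_le] add_mono) auto
  finally have "real (card (nb H y - (C - Y - {w}))) \<le>
      real (card (nb H y - C)) + real (card (nb H y \<inter> nb H w)) + 1"
    by linarith
  also have "\<dots> \<le> \<delta> + K + 1"
    using adm yC codeg[OF yC(2) w yC(3)] by (auto simp: admissible_def)
  finally show "real (card (nb H y - (C - Y - {w}))) \<le> \<delta> + K + 1" .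
qed

text \<open>Neighbours in \<open>C\<close> obey the inductive bounds \<open>L\<close> and
  \<open>U\<close>; the at most \<delta> others only satisfy the trivial bounds 0 and \<beta>. The
  two lists of bounds are fed into \<open>occ_le\<close> and \<open>occ_ge\<close>.\<close>

lemma occ_step:
  assumes adm: "admissible \<alpha> \<beta> \<delta> C f" and \<alpha>: "0 \<le> \<alpha>"
    and codeg: "\<And>x y. x \<in> A \<Longrightarrow> y \<in> A \<Longrightarrow> x \<noteq> y \<Longrightarrow> real (card (nb H x \<inter> nb H y)) \<le> K"
    and IH: "\<And>g C x. admissible \<alpha> \<beta> (\<delta> + K + 1) C g \<Longrightarrow> x \<in> C \<Longrightarrow>
      L \<le> occ b A H g x \<and> occ b A H g x \<le> U"
    and L: "0 \<le> L" and U: "0 \<le> U" and w: "w \<in> C"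
  shows "occ b A H f w \<le> \<beta> * exp (- (1 - b) * ((real (card (nb H w)) - \<delta>) * (L / (1 + L))))"
    and "\<alpha> * exp (- (1 - b) * (real (card (nb H w)) * U + \<delta> * \<beta>)) \<le> occ b A H f w"
proof -
  have f: "0 \<le> f x" "f x \<le> \<beta>" if "x \<in> A" for x using adm that by (auto simp: admissible_def)
  have wA: "w \<in> A" and clean: "\<alpha> \<le> f w" using adm w by (auto simp: admissible_def)
  let ?C = "nb H w \<inter> C" and ?D = "nb H w - C"
  have cardCD: "card (nb H w) = card ?C + card ?D"
    by (subst card_Un_disjoint[symmetric]) (auto simp: finite_nb Int_Diff_Un)
  have D: "real (card ?D) \<le> \<delta>" using adm w by (auto simp: admissible_def)
  have \<beta>: "0 \<le> \<beta>" using f[OF wA] by linarith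
  have bounds: "L \<le> occ b A H (tilt b Y (f(w := 0))) x \<and> occ b A H (tilt b Y (f(w := 0))) x \<le> U"
    if "Y \<subseteq> nb H w" "x \<in> ?C - Y" for Y x
    using that nb_irrefl by (intro IH[OF admissible_tilt[OF adm wA that(1) codeg]]) auto
  have all: "0 \<le> occ b A H (tilt b Y (f(w := 0))) x \<and> occ b A H (tilt b Y (f(w := 0))) x \<le> \<beta>"
    if "Y \<subseteq> nb H w" "x \<in> nb H w - Y" for Y x
  proof -
    have xA: "x \<in> A" using that nb_subset by auto
    have g0: "0 \<le> tilt b Y (f(w := 0)) y" if "y \<in> A" for y
      using that f by (intro tilt_nonneg b0) auto
    have "tilt b Y (f(w := 0)) x \<le> \<beta>" using that f[OF xA] \<beta> by (auto simp: tilt_def)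
    then show ?thesis
      using occ_nonneg[of "tilt b Y (f(w := 0))", OF g0 xA]
        occ_le_field[of "tilt b Y (f(w := 0))", OF g0 xA] by linarith
  qed
  have 1: "occ b A H f w \<le>
      f w * exp (- (1 - b) * (\<Sum>x\<in>nb H w. (if x \<in> C then L else 0) / (1 + (if x \<in> C then L else 0))))"
    using f wA L all bounds by (intro occ_le) auto
  have s1: "(\<Sum>x\<in>nb H w. (if x \<in> C then L else 0) / (1 + (if x \<in> C then L else 0))) =
      real (card ?C) * (L / (1 + L))"
  proof -
    have "(\<Sum>x\<in>nb H w. (if x \<in> C then L else 0) / (1 + (if x \<in> C then L else 0))) =
        (\<Sum>x\<in>?C. L / (1 + L))"
      by (rule sum.mono_neutral_cong_right) (auto simp: finite_nb)
    then show ?thesis by simp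
  qed
  have "(real (card (nb H w)) - \<delta>) * (L / (1 + L)) \<le> real (card ?C) * (L / (1 + L))"
    using cardCD D L by (intro mult_right_mono) auto
  then have "exp (- (1 - b) * (real (card ?C) * (L / (1 + L)))) \<le>
      exp (- (1 - b) * ((real (card (nb H w)) - \<delta>) * (L / (1 + L))))"
    using b1 by (simp only: exp_le_cancel_iff mult_minus_left neg_le_iff_le mult_left_mono
        diff_ge_0_iff_ge)
  then show "occ b A H f w \<le> \<beta> * exp (- (1 - b) * ((real (card (nb H w)) - \<delta>) * (L / (1 + L))))"
    using 1 f[OF wA] \<beta> unfolding s1
    by (elim order_trans) (intro mult_mono, auto)
  have 2: "f w * exp (- (1 - b) * (\<Sum>x\<in>nb H w. if x \<in> C then U else \<beta>)) \<le> occ b A H f w"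
    using f wA all bounds by (intro occ_ge) auto
  have s2: "(\<Sum>x\<in>nb H w. if x \<in> C then U else \<beta>) = real (card ?C) * U + real (card ?D) * \<beta>"
    by (simp add: sum.If_cases finite_nb Diff_eq)
  have "real (card ?C) * U + real (card ?D) * \<beta> \<le> real (card (nb H w)) * U + \<delta> * \<beta>"
    using cardCD D U \<beta> by (intro add_mono mult_right_mono) auto
  then have "exp (- (1 - b) * (real (card (nb H w)) * U + \<delta> * \<beta>)) \<le>
      exp (- (1 - b) * (real (card ?C) * U + real (card ?D) * \<beta>))"
    using b1 by (simp only: exp_le_cancel_iff mult_minus_left neg_le_iff_le mult_left_mono
        diff_ge_0_iff_ge)
  then have "\<alpha> * exp (- (1 - b) * (real (card (nb H w)) * U + \<delta> * \<beta>)) \<le>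
      f w * exp (- (1 - b) * (real (card ?C) * U + real (card ?D) * \<beta>))"
    using clean \<alpha> by (intro mult_mono) auto
  then show "\<alpha> * exp (- (1 - b) * (real (card (nb H w)) * U + \<delta> * \<beta>)) \<le> occ b A H f w"
    using 2 unfolding s2 by linarith
qed

end

text \<open>The slack \<kappa> in the lower degree bound pays for the vertex that is cut out of the
  graph, which may cost every other vertex one neighbour. Upper bounds are not hurt by a
  deletion.\<close>

definition regular_graph :: "nat \<Rightarrow> real \<Rightarrow> real \<Rightarrow> real \<Rightarrow> 'a set \<Rightarrow> 'a set set \<Rightarrow> bool" where
  "regular_graph n \<kappa> l h A H \<longleftrightarrow>
     (\<forall>x\<in>A. (l - \<kappa>) * sqrt n \<le> real (card (nb H x)) \<and> real (card (nb H x)) \<le> h * sqrt n) \<and>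
     (\<forall>x\<in>A. \<forall>y\<in>A. x \<noteq> y \<longrightarrow> real (card (nb H x \<inter> nb H y)) \<le> \<kappa> * sqrt n)"

definition occ_within :: "real \<Rightarrow> real \<Rightarrow> real \<Rightarrow> real \<Rightarrow> real \<Rightarrow> real \<Rightarrow> real \<Rightarrow> nat \<Rightarrow> bool" where
  "occ_within b c l h L U \<kappa> n \<longleftrightarrow>
     (\<forall>(A :: nat set) H C f.
        spin_model b A H \<and> regular_graph n \<kappa> l h A H \<and>
        spin_model.admissible A H ((c - \<kappa>) / sqrt n) ((c + \<kappa>) / sqrt n) (\<kappa> * sqrt n) C f \<longrightarrow>
        (\<forall>w\<in>C. L / sqrt n \<le> occ b A H f w \<and> occ b A H f w \<le> U / sqrt n))"

text \<open>The bounds of \<open>occ_within\<close> are uniform over graphs and over all fields that are close to \<open>c / sqrt n\<close> outside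
  a set which is sparse in each neighbourhood; only such a uniform statement survives the
  recursion over neighbours.\<close>

definition occ_window :: "real \<Rightarrow> real \<Rightarrow> real \<Rightarrow> real \<Rightarrow> real \<Rightarrow> real \<Rightarrow> bool" where
  "occ_window b c l h L U \<longleftrightarrow> (\<exists>\<kappa>>0. \<forall>\<^sub>F n in sequentially. occ_within b c l h L U \<kappa> n)"

lemma occ_within_mono:
  assumes "occ_within b c l h L U \<kappa> n"
    and "l \<le> l'" "h' \<le> h" "L' \<le> L" "U \<le> U'" "\<kappa>' \<le> \<kappa>"
  shows "occ_within b c l' h' L' U' \<kappa>' n"
  unfolding occ_within_def
proof (intro allI impI ballI)
  fix A :: "nat set" and H C f w
  assume *: "spin_model b A H \<and> regular_graph n \<kappa>' l' h' A H \<and>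
    spin_model.admissible A H ((c - \<kappa>') / sqrt n) ((c + \<kappa>') / sqrt n) (\<kappa>' * sqrt n) C f"
    and w: "w \<in> C"
  interpret spin_model b A H using * by simp
  have le: "(l - \<kappa>) * sqrt n \<le> (l' - \<kappa>') * sqrt n" "h' * sqrt n \<le> h * sqrt n"
    "\<kappa>' * sqrt n \<le> \<kappa> * sqrt n" "(c - \<kappa>) / sqrt n \<le> (c - \<kappa>') / sqrt n"
    "(c + \<kappa>') / sqrt n \<le> (c + \<kappa>) / sqrt n" "L' / sqrt n \<le> L / sqrt n" "U / sqrt n \<le> U' / sqrt n"
    using assms by (auto intro!: mult_right_mono divide_right_mono)
  have "regular_graph n \<kappa> l h A H"
    using * le(1-3) unfolding regular_graph_def by (meson order_trans)
  moreover have "admissible ((c - \<kappa>) / sqrt n) ((c + \<kappa>) / sqrt n) (\<kappa> * sqrt n) C f"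
    using * le(3-5) unfolding admissible_def by (meson order_trans)
  ultimately show "L' / sqrt n \<le> occ b A H f w \<and> occ b A H f w \<le> U' / sqrt n"
    using assms(1) w le(6,7) spin_model_axioms unfolding occ_within_def by (meson order_trans)
qed

lemma occ_window_mono:
  assumes "occ_window b c l h L U" "l \<le> l'" "h' \<le> h" "L' \<le> L" "U \<le> U'"
  shows "occ_window b c l' h' L' U'"
proof -
  obtain \<kappa> where "\<kappa> > 0" "\<forall>\<^sub>F n in sequentially. occ_within b c l h L U \<kappa> n"
    using assms(1) unfolding occ_window_def by blast
  moreover from this(2) have "\<forall>\<^sub>F n in sequentially. occ_within b c l' h' L' U' \<kappa> n"
    by eventually_elim (erule occ_within_mono, use assms in auto)
  ultimately show ?thesis unfolding occ_window_def by blast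
qed

lemma occ_window_conj:
  assumes "occ_window b c l h L U" "occ_window b c l h L' U'"
  shows "occ_window b c l h (max L L') (min U U')"
proof -
  obtain \<kappa> \<kappa>' where \<kappa>: "\<kappa> > 0" "\<kappa>' > 0" and ev: "\<forall>\<^sub>F n in sequentially. occ_within b c l h L U \<kappa> n"
    "\<forall>\<^sub>F n in sequentially. occ_within b c l h L' U' \<kappa>' n"
    using assms unfolding occ_window_def by blast
  from ev have "\<forall>\<^sub>F n in sequentially. occ_within b c l h (max L L') (min U U') (min \<kappa> \<kappa>') n"
  proof eventually_elim
    case (elim n)
    have "occ_within b c l h L U (min \<kappa> \<kappa>') n" "occ_within b c l h L' U' (min \<kappa> \<kappa>') n"
      using occ_within_mono[OF elim(1)] occ_within_mono[OF elim(2)] by auto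
    then show ?case unfolding occ_within_def by (auto simp: max_def min_def)
  qed
  then show ?thesis unfolding occ_window_def using \<kappa> by (intro exI[of _ "min \<kappa> \<kappa>'"]) auto
qed

lemma occ_window_trivial:
  assumes "0 < \<epsilon>"
  shows "occ_window b c l h 0 (c + \<epsilon>)"
  unfolding occ_window_def occ_within_def
proof (intro exI[of _ \<epsilon>] conjI always_eventually allI impI ballI)
  fix n :: nat and A :: "nat set" and H C f w
  assume *: "spin_model b A H \<and> regular_graph n \<epsilon> l h A H \<and>
    spin_model.admissible A H ((c - \<epsilon>) / sqrt n) ((c + \<epsilon>) / sqrt n) (\<epsilon> * sqrt n) C f" and w: "w \<in> C"
  interpret spin_model b A H using * by simp
  have f: "0 \<le> f x" "f x \<le> (c + \<epsilon>) / sqrt n" if "x \<in> A" for x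
    using * that by (auto simp: admissible_def)
  have wA: "w \<in> A" using * w by (auto simp: admissible_def)
  show "0 / sqrt n \<le> occ b A H f w" using occ_nonneg[of f w, OF f(1) wA] by simp
  show "occ b A H f w \<le> (c + \<epsilon>) / sqrt n"
    using occ_le_field[of f w, OF f(1) wA] f(2)[OF wA] by linarith
qed (use assms in auto)

text \<open>The perturbations vanish as \<open>\<kappa>\<close> and \<open>1 / sqrt n\<close> tend to \<open>0\<close>, so \<open>\<kappa>\<close> is chosen by continuity.\<close>

lemma occ_window_step:
  assumes win: "occ_window b c l h L U" and c: "0 < c" and L: "0 \<le> L" and U: "0 \<le> U"
    and b: "0 \<le> b" "b \<le> 1" and \<epsilon>: "0 < \<epsilon>"
  shows "occ_window b c l h (c * exp (- (1 - b) * (h * U)) - \<epsilon>) (c * exp (- (1 - b) * (l * L)) + \<epsilon>)"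
proof -
  obtain \<kappa> where \<kappa>: "\<kappa> > 0" and ev: "\<forall>\<^sub>F n in sequentially. occ_within b c l h L U \<kappa> n"
    using win unfolding occ_window_def by blast
  \<comment> \<open>Here \<open>s\<close> stands for 1 / sqrt n, and L / (1 + L s) comes from the
    denominator 1 + odds. Of the loss 2 k, one k is the slack of \<open>regular_graph\<close>, the
    other the damaged neighbours.\<close>
  let ?up = "\<lambda>k s. (c + k) * exp (- (1 - b) * ((l - 2 * k) * (L / (1 + L * s))))"
  let ?lo = "\<lambda>k. (c - k) * exp (- (1 - b) * (h * U + k * (c + k)))"
  have "((\<lambda>k. (c + k) * exp (- (1 - b) * ((l - 2 * k) * L))) \<longlongrightarrow>
      (c + 0) * exp (- (1 - b) * ((l - 2 * 0) * L))) (at_right 0)"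
    by (intro tendsto_intros)
  then have 1: "\<forall>\<^sub>F k in at_right 0.
      (c + k) * exp (- (1 - b) * ((l - 2 * k) * L)) < c * exp (- (1 - b) * (l * L)) + \<epsilon>"
    using \<epsilon> by (intro order_tendstoD) auto
  have "(?lo \<longlongrightarrow> (c - 0) * exp (- (1 - b) * (h * U + 0 * (c + 0)))) (at_right 0)"
    by (intro tendsto_intros)
  then have 2: "\<forall>\<^sub>F k in at_right 0. c * exp (- (1 - b) * (h * U)) - \<epsilon> < ?lo k"
    using \<epsilon> by (intro order_tendstoD) auto
  \<comment> \<open>The bound c / 2 keeps c - k positive. The third of \<kappa> is needed because
    the neighbours are treated with damage k sqrt n + k sqrt n + 1, at most 3 k sqrt n for large
    n.\<close>
  have 3: "\<forall>\<^sub>F k in at_right 0. k < min (c / 2) (\<kappa> / 3)"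
    using c \<kappa> by (intro order_tendstoD(2)[OF tendsto_ident_at]) auto
  obtain k where k: "0 < k" "k < c / 2" "k < \<kappa> / 3"
    "(c + k) * exp (- (1 - b) * ((l - 2 * k) * L)) < c * exp (- (1 - b) * (l * L)) + \<epsilon>"
    "c * exp (- (1 - b) * (h * U)) - \<epsilon> < ?lo k"
    using eventually_happens[OF eventually_conj[OF eventually_at_right_less[of 0]
          eventually_conj[OF 1 eventually_conj[OF 2 3]]]] by auto
  have "(\<lambda>n. ?up k (1 / sqrt (real n))) \<longlonglongrightarrow>
      (c + k) * exp (- (1 - b) * ((l - 2 * k) * (L / (1 + L * 0))))"
    by (intro tendsto_intros) (real_asymp, simp)
  then have 4: "\<forall>\<^sub>F n in sequentially. ?up k (1 / sqrt (real n)) < c * exp (- (1 - b) * (l * L)) + \<epsilon>"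
    using k by (intro order_tendstoD) auto
  have 5: "\<forall>\<^sub>F n in sequentially. 1 \<le> k * sqrt (real n)"
    using k by real_asymp
  have "\<forall>\<^sub>F n in sequentially. occ_within b c l h (c * exp (- (1 - b) * (h * U)) - \<epsilon>)
      (c * exp (- (1 - b) * (l * L)) + \<epsilon>) k n"
    using ev 4 5 eventually_gt_at_top[of 0]
  proof eventually_elim
    case (elim n)
    let ?s = "sqrt (real n)"
    have s: "0 < ?s" using elim by simp
    show ?case
      unfolding occ_within_def
    proof (intro allI impI ballI)
      fix A :: "nat set" and H C f w
      assume *: "spin_model b A H \<and> regular_graph n k l h A H \<and>
        spin_model.admissible A H ((c - k) / ?s) ((c + k) / ?s) (k * ?s) C f" and w: "w \<in> C"
      interpret spin_model b A H using * by simp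
      have adm: "admissible ((c - k) / ?s) ((c + k) / ?s) (k * ?s) C f" using * by simp
      have wA: "w \<in> A" using adm w by (auto simp: admissible_def)
      have reg: "(l - k) * ?s \<le> real (card (nb H w))" "real (card (nb H w)) \<le> h * ?s"
        using * wA by (auto simp: regular_graph_def)
      have IH: "L / ?s \<le> occ b A H g x \<and> occ b A H g x \<le> U / ?s"
        if g: "admissible ((c - k) / ?s) ((c + k) / ?s) (k * ?s + k * ?s + 1) C' g" and x: "x \<in> C'" for g C' x
      proof -
        have "(3 * k) * ?s \<le> \<kappa> * ?s" using k s by (intro mult_right_mono) auto
        then have le0: "k * ?s + k * ?s + 1 \<le> \<kappa> * ?s"
          using elim(3) by linarith
        have le1: "(c - \<kappa>) / ?s \<le> (c - k) / ?s"
          "(c + k) / ?s \<le> (c + \<kappa>) / ?s" "k * ?s \<le> \<kappa> * ?s" "(l - \<kappa>) * ?s \<le> (l - k) * ?s"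
          using k s by (auto intro!: divide_right_mono mult_right_mono)
        note le = le0 le1
        have "admissible ((c - \<kappa>) / ?s) ((c + \<kappa>) / ?s) (\<kappa> * ?s) C' g"
          using g le(1-3) unfolding admissible_def by (meson order_trans)
        moreover have "regular_graph n \<kappa> l h A H"
          using * le(4,5) unfolding regular_graph_def by (meson order_trans)
        ultimately show ?thesis
          using elim(1) x spin_model_axioms unfolding occ_within_def by blast
      qed
      show "(c * exp (- (1 - b) * (h * U)) - \<epsilon>) / ?s \<le> occ b A H f w \<and>
          occ b A H f w \<le> (c * exp (- (1 - b) * (l * L)) + \<epsilon>) / ?s"
      proof
        have codeg: "real (card (nb H x \<inter> nb H y)) \<le> k * ?s" if "x \<in> A" "y \<in> A" "x \<noteq> y" for x y
          using * that by (auto simp: regular_graph_def)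
        have ck: "0 \<le> (c - k) / ?s" "0 \<le> (c + k) / ?s" using k s c by auto
        have LU: "0 \<le> L / ?s" "0 \<le> U / ?s" using L U s by auto
        have "(c * exp (- (1 - b) * (h * U)) - \<epsilon>) / ?s \<le> ?lo k / ?s"
          using k s by (intro divide_right_mono) auto
        also have "?lo k / ?s = (c - k) / ?s * exp (- (1 - b) * (h * ?s * (U / ?s) + k * ?s * ((c + k) / ?s)))"
          using s by simp
        also have "\<dots> \<le> (c - k) / ?s * exp (- (1 - b) * (real (card (nb H w)) * (U / ?s) + k * ?s * ((c + k) / ?s)))"
          using reg LU ck b
          by (intro mult_left_mono iffD2[OF exp_le_cancel_iff] mult_left_mono_neg add_mono mult_right_mono) auto
        also have "\<dots> \<le> occ b A H f w"
          by (rule occ_step(2)[OF adm ck(1) codeg IH LU w])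
        finally show "(c * exp (- (1 - b) * (h * U)) - \<epsilon>) / ?s \<le> occ b A H f w" .
        have "occ b A H f w \<le> (c + k) / ?s *
            exp (- (1 - b) * ((real (card (nb H w)) - k * ?s) * (L / ?s / (1 + L / ?s))))"
          by (rule occ_step(1)[OF adm ck(1) codeg IH LU w])
        also have "\<dots> \<le> (c + k) / ?s * exp (- (1 - b) * (((l - 2 * k) * ?s) * (L / ?s / (1 + L / ?s))))"
        proof (rule mult_left_mono[OF iffD2[OF exp_le_cancel_iff, OF mult_left_mono_neg[OF mult_right_mono]]])
          show "(l - 2 * k) * ?s \<le> real (card (nb H w)) - k * ?s"
            using reg by (simp add: algebra_simps)
          show "0 \<le> L / ?s / (1 + L / ?s)" by (intro divide_nonneg_nonneg add_nonneg_nonneg LU) auto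
        qed (use ck b in auto)
        also have "\<dots> = ?up k (1 / ?s) / ?s"
          using s by simp
        also have "\<dots> \<le> (c * exp (- (1 - b) * (l * L)) + \<epsilon>) / ?s"
          using elim s by (intro divide_right_mono) auto
        finally show "occ b A H f w \<le> (c * exp (- (1 - b) * (l * L)) + \<epsilon>) / ?s" .
      qed
    qed
  qed
  then show ?thesis using k unfolding occ_window_def by blast
qed

section \<open>The Gibbs measure on graphs\<close>

text \<open>\<open>gsum\<close> is an unnormalised mass: for \<open>\<rho> = p / (1 - p)\<close>, \<open>gsum \<rho> b n P / gpart \<rho> b n\<close> is the
  probability of \<open>P\<close> under \<open>G(n,p)\<close> tilted by \<open>b\<close> to the number of triangles.\<close>

definition gweight :: "real \<Rightarrow> real \<Rightarrow> nat \<Rightarrow> nat set set \<Rightarrow> real" where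
  "gweight \<rho> b n G = \<rho> ^ card G * b ^ num_triangles n G"

definition gsum :: "real \<Rightarrow> real \<Rightarrow> nat \<Rightarrow> (nat set set \<Rightarrow> bool) \<Rightarrow> real" where
  "gsum \<rho> b n P = (\<Sum>G | G \<subseteq> all_edges n \<and> P G. gweight \<rho> b n G)"

abbreviation gpart :: "real \<Rightarrow> real \<Rightarrow> nat \<Rightarrow> real" where
  "gpart \<rho> b n \<equiv> gsum \<rho> b n (\<lambda>_. True)"

lemma finite_all_edges: "finite (all_edges n)"
  by (rule finite_subset[of _ "Pow {..<n}"]) (auto simp: all_edges_def)

lemma finite_graphs: "finite {G. G \<subseteq> all_edges n \<and> P G}"
  by (rule finite_subset[of _ "Pow (all_edges n)"]) (auto simp: finite_all_edges)

lemma gweight_nonneg: "0 \<le> \<rho> \<Longrightarrow> 0 \<le> b \<Longrightarrow> 0 \<le> gweight \<rho> b n G"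
  by (simp add: gweight_def)

lemma gsum_nonneg: "0 \<le> \<rho> \<Longrightarrow> 0 \<le> b \<Longrightarrow> 0 \<le> gsum \<rho> b n P"
  by (auto simp: gsum_def intro!: sum_nonneg gweight_nonneg)

lemma gsum_mono:
  assumes "0 \<le> \<rho>" "0 \<le> b" "\<And>G. G \<subseteq> all_edges n \<Longrightarrow> P G \<Longrightarrow> Q G"
  shows "gsum \<rho> b n P \<le> gsum \<rho> b n Q"
  unfolding gsum_def
  by (intro sum_mono2 finite_graphs gweight_nonneg) (use assms in auto)

lemma gsum_disj:
  assumes "0 \<le> \<rho>" "0 \<le> b"
  shows "gsum \<rho> b n (\<lambda>G. P G \<or> Q G) \<le> gsum \<rho> b n P + gsum \<rho> b n Q"
proof -
  have "{G. G \<subseteq> all_edges n \<and> (P G \<or> Q G)} =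
      {G. G \<subseteq> all_edges n \<and> P G} \<union> {G. G \<subseteq> all_edges n \<and> Q G}" by auto
  moreover have "0 \<le> sum (gweight \<rho> b n)
      ({G. G \<subseteq> all_edges n \<and> P G} \<inter> {G. G \<subseteq> all_edges n \<and> Q G})"
    by (intro sum_nonneg gweight_nonneg assms)
  ultimately show ?thesis
    unfolding gsum_def by (simp add: sum_Un[OF finite_graphs finite_graphs])
qed

lemma gsum_ex:
  assumes "0 \<le> \<rho>" "0 \<le> b" "finite I"
  shows "gsum \<rho> b n (\<lambda>G. \<exists>i\<in>I. P i G) \<le> (\<Sum>i\<in>I. gsum \<rho> b n (P i))"
  using assms(3)
proof (induction I)
  case empty
  show ?case by (simp add: gsum_def)
next
  case (insert i I)
  have "gsum \<rho> b n (\<lambda>G. \<exists>j\<in>insert i I. P j G) = gsum \<rho> b n (\<lambda>G. P i G \<or> (\<exists>j\<in>I. P j G))"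
    by simp
  also have "\<dots> \<le> gsum \<rho> b n (P i) + gsum \<rho> b n (\<lambda>G. \<exists>j\<in>I. P j G)"
    by (rule gsum_disj[OF assms(1,2)])
  also have "\<dots> \<le> (\<Sum>j\<in>insert i I. gsum \<rho> b n (P j))"
    using insert by simp
  finally show ?case .
qed

lemma num_triangles_mono:
  assumes "G \<subseteq> G'"
  shows "num_triangles n G \<le> num_triangles n G'"
  unfolding num_triangles_def
proof (rule card_mono)
  show "finite {T. T \<subseteq> {..<n} \<and> card T = 3 \<and> (\<forall>u\<in>T. \<forall>v\<in>T. u \<noteq> v \<longrightarrow> {u, v} \<in> G')}"
    by (rule finite_subset[of _ "Pow {..<n}"]) auto
qed (use assms in auto)

lemma num_triangles_empty: "num_triangles n {} = 0"
proof -
  have "T = {}" if "card T = 3" "\<forall>u\<in>T. \<forall>v\<in>T. u \<noteq> v \<longrightarrow> {u, v} \<in> ({} :: nat set set)" for T :: "nat set"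
  proof -
    obtain x y z where "T = {x, y, z}" "x \<noteq> y" using \<open>card T = 3\<close> by (auto simp: card_3_iff)
    then show ?thesis using that(2) by auto
  qed
  then have "{T. T \<subseteq> {..<n} \<and> card T = 3 \<and> (\<forall>u\<in>T. \<forall>v\<in>T. u \<noteq> v \<longrightarrow> {u, v} \<in> ({} :: nat set set))} = {}"
    by fastforce
  then show ?thesis by (simp add: num_triangles_def)
qed

lemma gpart_ge_1:
  assumes "0 \<le> \<rho>" "0 \<le> b"
  shows "1 \<le> gpart \<rho> b n"
proof -
  have "1 = gweight \<rho> b n {}" by (simp add: gweight_def num_triangles_empty)
  also have "\<dots> \<le> gpart \<rho> b n"
    unfolding gsum_def by (rule member_le_sum) (use assms finite_graphs[of n "\<lambda>_. True"] in \<open>auto intro: gweight_nonneg\<close>)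
  finally show ?thesis .
qed

text \<open>Deleting \<open>F\<close> is injective on the graphs that contain \<open>F\<close>, and
  it cannot create triangles, so apart from the factor \<rho> per edge the weight does not
  drop.\<close>

lemma gsum_superset_le:
  assumes "0 \<le> \<rho>" "0 \<le> b" "b \<le> 1" "F \<subseteq> all_edges n"
  shows "gsum \<rho> b n (\<lambda>G. F \<subseteq> G) \<le> \<rho> ^ card F * gpart \<rho> b n"
proof -
  let ?S = "{G. G \<subseteq> all_edges n \<and> F \<subseteq> G}"
  have fin: "finite G" if "G \<in> ?S" for G using that finite_all_edges finite_subset by auto
  have "gsum \<rho> b n (\<lambda>G. F \<subseteq> G) \<le> (\<Sum>G\<in>?S. \<rho> ^ card F * gweight \<rho> b n (G - F))"
    unfolding gsum_def
  proof (rule sum_mono)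
    fix G assume G: "G \<in> ?S"
    have "card G = card F + card (G - F)"
      using G fin[OF G] card_mono[of G F] by (subst card_Diff_subset) (auto intro: finite_subset)
    moreover have "b ^ num_triangles n G \<le> b ^ num_triangles n (G - F)"
      using assms by (intro power_decreasing num_triangles_mono) auto
    ultimately show "gweight \<rho> b n G \<le> \<rho> ^ card F * gweight \<rho> b n (G - F)"
      using assms by (simp add: gweight_def power_add mult.assoc mult_left_mono)
  qed
  also have "\<dots> = \<rho> ^ card F * (\<Sum>G\<in>(\<lambda>G. G - F) ` ?S. gweight \<rho> b n G)"
    by (subst sum.reindex) (auto simp: sum_distrib_left inj_on_def)
  also have "\<dots> \<le> \<rho> ^ card F * gpart \<rho> b n"
    unfolding gsum_def
    by (intro mult_left_mono sum_mono2 finite_graphs gweight_nonneg) (use assms in auto)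
  finally show ?thesis .
qed

section \<open>Splitting a graph into one vertex with its neighbourhood and the rest\<close>

definition edges_avoiding :: "nat \<Rightarrow> nat \<Rightarrow> nat set set" where
  "edges_avoiding n u = {e. e \<subseteq> {..<n} - {u} \<and> card e = 2}"

definition join_vertex :: "nat \<Rightarrow> nat set set \<Rightarrow> nat set \<Rightarrow> nat set set" where
  "join_vertex u H S = H \<union> (\<lambda>x. {u, x}) ` S"

lemma finite_edges_avoiding: "finite (edges_avoiding n u)"
  by (rule finite_subset[of _ "Pow {..<n}"]) (auto simp: edges_avoiding_def)

lemma join_vertex_simps:
  assumes "H \<subseteq> edges_avoiding n u" "S \<subseteq> {..<n} - {u}"
  shows "{e \<in> join_vertex u H S. u \<notin> e} = H" "nb (join_vertex u H S) u = S"
    "card (join_vertex u H S) = card H + card S"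
proof -
  show "{e \<in> join_vertex u H S. u \<notin> e} = H"
    using assms by (auto simp: join_vertex_def edges_avoiding_def)
  show "nb (join_vertex u H S) u = S"
    using assms by (auto simp: nb_def join_vertex_def edges_avoiding_def doubleton_eq_iff)
  have "H \<inter> (\<lambda>x. {u, x}) ` S = {}" using assms by (auto simp: edges_avoiding_def)
  moreover have "card ((\<lambda>x. {u, x}) ` S) = card S"
    by (rule card_image) (auto simp: inj_on_def doubleton_eq_iff)
  ultimately show "card (join_vertex u H S) = card H + card S"
    unfolding join_vertex_def using assms finite_edges_avoiding
    by (subst card_Un_disjoint) (auto intro: finite_subset)
qed

lemma bij_betw_join_vertex:
  assumes "u < n"
  shows "bij_betw (\<lambda>(H, S). join_vertex u H S)
    (Pow (edges_avoiding n u) \<times> Pow ({..<n} - {u})) (Pow (all_edges n))"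
proof (rule bij_betw_byWitness[where f' = "\<lambda>G. ({e \<in> G. u \<notin> e}, nb G u)"])
  show "\<forall>p\<in>Pow (edges_avoiding n u) \<times> Pow ({..<n} - {u}).
      ({e \<in> (case p of (H, S) \<Rightarrow> join_vertex u H S). u \<notin> e}, nb (case p of (H, S) \<Rightarrow> join_vertex u H S) u) = p"
    using join_vertex_simps(1,2) by auto
  show "(\<lambda>(H, S). join_vertex u H S) ` (Pow (edges_avoiding n u) \<times> Pow ({..<n} - {u})) \<subseteq> Pow (all_edges n)"
    using assms by (auto simp: join_vertex_def edges_avoiding_def all_edges_def card_insert_if subset_iff)
  show "(\<lambda>G. ({e \<in> G. u \<notin> e}, nb G u)) ` Pow (all_edges n) \<subseteq> Pow (edges_avoiding n u) \<times> Pow ({..<n} - {u})"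
    by (auto simp: edges_avoiding_def all_edges_def nb_def)
  show "\<forall>G\<in>Pow (all_edges n). (case ({e \<in> G. u \<notin> e}, nb G u) of (H, S) \<Rightarrow> join_vertex u H S) = G"
  proof
    fix G assume G: "G \<in> Pow (all_edges n)"
    have "e \<in> (\<lambda>x. {u, x}) ` nb G u" if "e \<in> G" "u \<in> e" for e
    proof -
      have "card e = 2" using that G by (auto simp: all_edges_def)
      then obtain x y where "e = {x, y}" by (auto simp: card_2_iff)
      then obtain z where "e = {u, z}" using \<open>u \<in> e\<close> by auto
      then show ?thesis using that by (auto simp: nb_def)
    qed
    then show "(case ({e \<in> G. u \<notin> e}, nb G u) of (H, S) \<Rightarrow> join_vertex u H S) = G"
      by (auto simp: join_vertex_def nb_def)
  qed
qed

text \<open>A triangle through \<open>u\<close> is \<open>u\<close> together with an edge of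
  \<open>H\<close> between two neighbours of \<open>u\<close>. This turns the triangle tilt into the
  pair interaction of the two-spin model.\<close>

lemma num_triangles_join_vertex:
  assumes u: "u < n" and H: "H \<subseteq> edges_avoiding n u" and S: "S \<subseteq> {..<n} - {u}"
  shows "num_triangles n (join_vertex u H S) = num_triangles n H + card (inner_edges H S)"
proof -
  let ?G = "join_vertex u H S"
  let ?P = "\<lambda>G T. T \<subseteq> {..<n} \<and> card T = 3 \<and> (\<forall>u\<in>T. \<forall>v\<in>T. u \<noteq> v \<longrightarrow> {u, v} \<in> G)"
  have GH: "{x, y} \<in> ?G \<longleftrightarrow> {x, y} \<in> H" if "x \<noteq> u" "y \<noteq> u" for x y
    using that by (auto simp: join_vertex_def doubleton_eq_iff)
  have Gu: "{u, y} \<in> ?G \<longleftrightarrow> y \<in> S" for y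
    using H S by (auto simp: join_vertex_def edges_avoiding_def doubleton_eq_iff)
  have Hu: "{u, y} \<notin> H" for y using H by (auto simp: edges_avoiding_def)
  have Tu: "u \<notin> T" if "?P H T" for T
  proof
    assume "u \<in> T"
    then have "\<forall>v\<in>T. v = u" using that Hu by auto
    then have "T \<subseteq> {u}" by auto
    then have "card T \<le> 1" using card_mono[of "{u}" T] by simp
    then show False using that by simp
  qed
  have "{T. ?P ?G T} = {T. ?P H T} \<union> insert u ` inner_edges H S"
  proof (intro equalityI subsetI)
    fix T assume "T \<in> {T. ?P ?G T}"
    then have T: "?P ?G T" by simp
    show "T \<in> {T. ?P H T} \<union> insert u ` inner_edges H S"
    proof (cases "u \<in> T")
      case False
      then have "?P H T" using T GH by metis
      then show ?thesis by simp
    next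
      case True
      have fT: "finite T" using T by (metis card.infinite zero_neq_numeral)
      have "card (T - {u}) = 2" using T True fT by simp
      then obtain x y where xy: "T - {u} = {x, y}" "x \<noteq> y" by (auto simp: card_2_iff)
      then have m: "x \<in> T" "y \<in> T" "x \<noteq> u" "y \<noteq> u" by auto
      have "{x, y} \<in> ?G" "{u, x} \<in> ?G" "{u, y} \<in> ?G" using T True m xy by metis+
      then have "{x, y} \<in> inner_edges H S" using GH Gu m by (auto simp: inner_edges_def)
      moreover have "T = insert u {x, y}" using xy True by auto
      ultimately show ?thesis by blast
    qed
  next
    fix T assume "T \<in> {T. ?P H T} \<union> insert u ` inner_edges H S"
    then show "T \<in> {T. ?P ?G T}"
    proof
      assume "T \<in> {T. ?P H T}"
      then show ?thesis by (auto simp: join_vertex_def)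
    next
      assume "T \<in> insert u ` inner_edges H S"
      then obtain e where e: "T = insert u e" "e \<in> H" "e \<subseteq> S" by (auto simp: inner_edges_def)
      then have e2: "e \<subseteq> {..<n}" "u \<notin> e" "card e = 2" using H by (auto simp: edges_avoiding_def)
      then obtain x y where xy: "e = {x, y}" "x \<noteq> y" by (auto simp: card_2_iff)
      have fe: "finite e" using xy by simp
      have "{x, y} \<in> ?G" using e xy by (auto simp: join_vertex_def)
      moreover have "{u, x} \<in> ?G" "{u, y} \<in> ?G" using e xy Gu by auto
      ultimately have "\<forall>v\<in>T. \<forall>w\<in>T. v \<noteq> w \<longrightarrow> {v, w} \<in> ?G"
        using e(1) xy by (auto simp: insert_commute)
      then show ?thesis using e e2 u fe by auto
    qed
  qed
  moreover have "{T. ?P H T} \<inter> insert u ` inner_edges H S = {}" using Tu by blast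
  moreover have "finite {T. ?P H T}"
    by (rule finite_subset[of _ "Pow {..<n}"]) auto
  moreover have "finite (inner_edges H S)"
    using H finite_edges_avoiding by (auto simp: inner_edges_def intro: finite_subset)
  moreover have "inj_on (insert u) (inner_edges H S)"
  proof (rule inj_onI)
    fix e e' assume e: "e \<in> inner_edges H S" "e' \<in> inner_edges H S" "insert u e = insert u e'"
    then have "u \<notin> e" "u \<notin> e'" using H by (auto simp: inner_edges_def edges_avoiding_def)
    then show "e = e'" using e(3) by (simp add: insert_ident)
  qed
  ultimately show ?thesis
    unfolding num_triangles_def by (simp add: card_Un_disjoint card_image)
qed

lemma gsum_split_vertex:
  assumes u: "u < n"
  shows "gsum \<rho> b n (\<lambda>G. Q {e \<in> G. u \<notin> e} (nb G u)) =
    (\<Sum>H\<in>Pow (edges_avoiding n u). gweight \<rho> b n H *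
       (\<Sum>S | S \<subseteq> {..<n} - {u} \<and> Q H S. \<rho> ^ card S * b ^ card (inner_edges H S)))"
proof -
  let ?E = "Pow (edges_avoiding n u)" and ?V = "Pow ({..<n} - {u})"
  have "gsum \<rho> b n (\<lambda>G. Q {e \<in> G. u \<notin> e} (nb G u)) =
      (\<Sum>G\<in>Pow (all_edges n). if Q {e \<in> G. u \<notin> e} (nb G u) then gweight \<rho> b n G else 0)"
    unfolding gsum_def using finite_all_edges
    by (simp add: sum.If_cases Int_def)
  also have "\<dots> = (\<Sum>(H, S)\<in>?E \<times> ?V. if Q H S then gweight \<rho> b n (join_vertex u H S) else 0)"
    unfolding sum.reindex_bij_betw[OF bij_betw_join_vertex[OF u], symmetric]
    by (intro sum.cong) (auto simp: join_vertex_simps)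
  also have "\<dots> = (\<Sum>H\<in>?E. \<Sum>S\<in>?V. if Q H S then gweight \<rho> b n (join_vertex u H S) else 0)"
    by (rule sum.cartesian_product[symmetric])
  also have "\<dots> = (\<Sum>H\<in>?E. \<Sum>S | S \<subseteq> {..<n} - {u} \<and> Q H S. gweight \<rho> b n (join_vertex u H S))"
    by (intro sum.cong[OF refl]) (simp add: sum.If_cases Int_def)
  also have "\<dots> = (\<Sum>H\<in>?E. gweight \<rho> b n H *
       (\<Sum>S | S \<subseteq> {..<n} - {u} \<and> Q H S. \<rho> ^ card S * b ^ card (inner_edges H S)))"
    unfolding sum_distrib_left
  proof (intro sum.cong refl)
    fix H S assume H: "H \<in> ?E" and S: "S \<in> {S. S \<subseteq> {..<n} - {u} \<and> Q H S}"
    then show "gweight \<rho> b n (join_vertex u H S) =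
        gweight \<rho> b n H * (\<rho> ^ card S * b ^ card (inner_edges H S))"
      using num_triangles_join_vertex[OF u, of H S]
      by (auto simp: gweight_def join_vertex_simps power_add)
  qed
  finally show ?thesis .
qed

text \<open>A tail bound for the two-spin model that is uniform over all \<open>H\<close> with
  property \<open>P\<close> becomes a bound for the Gibbs measure, since the weight of
  \<open>H\<close> is a common factor. The property \<open>P\<close> may look only at the graph
  without \<open>u\<close>.\<close>

lemma gsum_vertex_le:
  assumes u: "u < n" and nonneg: "0 \<le> \<rho>" "0 \<le> b" "0 \<le> \<delta>"
    and le: "\<And>H. H \<subseteq> edges_avoiding n u \<Longrightarrow> P H \<Longrightarrow>
      (\<Sum>S | S \<subseteq> {..<n} - {u} \<and> Q S. \<rho> ^ card S * b ^ card (inner_edges H S)) \<le>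
      \<delta> * zpart b ({..<n} - {u}) H (\<lambda>_. \<rho>)"
  shows "gsum \<rho> b n (\<lambda>G. P {e \<in> G. u \<notin> e} \<and> Q (nb G u)) \<le> \<delta> * gpart \<rho> b n"
proof -
  have z: "zpart b ({..<n} - {u}) H (\<lambda>_. \<rho>) =
      (\<Sum>S | S \<subseteq> {..<n} - {u} \<and> True. \<rho> ^ card S * b ^ card (inner_edges H S))" for H
    unfolding zpart_def by (intro sum.cong) auto
  have pos: "0 \<le> zpart b ({..<n} - {u}) H (\<lambda>_. \<rho>)" for H
    unfolding zpart_def using nonneg by (auto intro!: sum_nonneg)
  have "gsum \<rho> b n (\<lambda>G. P {e \<in> G. u \<notin> e} \<and> Q (nb G u)) \<le>
      (\<Sum>H\<in>Pow (edges_avoiding n u). gweight \<rho> b n H * (\<delta> * zpart b ({..<n} - {u}) H (\<lambda>_. \<rho>)))"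
    unfolding gsum_split_vertex[OF u, of \<rho> b "\<lambda>H S. P H \<and> Q S"]
  proof (intro sum_mono mult_left_mono gweight_nonneg nonneg)
    fix H assume H: "H \<in> Pow (edges_avoiding n u)"
    show "(\<Sum>S | S \<subseteq> {..<n} - {u} \<and> P H \<and> Q S. \<rho> ^ card S * b ^ card (inner_edges H S)) \<le>
        \<delta> * zpart b ({..<n} - {u}) H (\<lambda>_. \<rho>)"
      using le[of H] H pos nonneg by (cases "P H") auto
  qed
  also have "\<dots> = \<delta> * gpart \<rho> b n"
    using gsum_split_vertex[OF u, of \<rho> b "\<lambda>_ _. True"] unfolding z
    by (simp add: sum_distrib_left mult_ac)
  finally show ?thesis .
qed

section \<open>Concentration of degrees\<close>

context spin_model
begin

text \<open>A Chernoff bound. The expectation of r^card S is the quotient of the partition functions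
  with fields r \<rho> and \<rho>, which \<open>zpart_tilt_le\<close> bounds by factors 1 + (r - 1)
  U. The odds must be controlled at all intermediate fields, hence the quantified hypothesis on
  \<open>f\<close>.\<close>

lemma occ_uniform_upper_tail:
  assumes \<rho>: "0 \<le> \<rho>" and r: "1 \<le> r" and U: "0 \<le> U"
    and occ: "\<And>f x. (\<And>y. y \<in> A \<Longrightarrow> \<rho> \<le> f y \<and> f y \<le> r * \<rho>) \<Longrightarrow> x \<in> A \<Longrightarrow> occ b A H f x \<le> U"
    and m: "\<And>S. Q S \<Longrightarrow> m \<le> real (card S)"
  shows "(\<Sum>S | S \<subseteq> A \<and> Q S. \<rho> ^ card S * b ^ card (inner_edges H S)) \<le>
    exp ((r - 1) * U * card A - ln r * m) * zpart b A H (\<lambda>_. \<rho>)"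
proof -
  let ?f = "\<lambda>_. \<rho>"
  have "zpart b A H (tilt r A ?f) \<le> zpart b A H ?f * (\<Prod>x\<in>A. exp ((r - 1) * U))"
  proof (rule zpart_tilt_le)
    fix Y x assume Y: "Y \<subseteq> A" "x \<in> A - Y"
    let ?R = "occ b A H (tilt r Y ?f) x"
    have "\<rho> \<le> r * \<rho>" using mult_right_mono[OF r \<rho>] by simp
    then have R: "?R \<le> U" using Y r \<rho> by (intro occ) (auto simp: tilt_def)
    have R0: "0 \<le> ?R" using Y r \<rho> by (intro occ_nonneg tilt_nonneg) auto
    have "(1 + r * ?R) / (1 + ?R) = 1 + (r - 1) * (?R / (1 + ?R))"
      using R0 by (simp add: field_simps)
    also have "?R / (1 + ?R) \<le> ?R" using R0 by (simp add: field_simps)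
    then have "?R / (1 + ?R) \<le> U" using R by linarith
    then have "1 + (r - 1) * (?R / (1 + ?R)) \<le> 1 + (r - 1) * U"
      using r by (intro add_left_mono mult_left_mono) auto
    also have "\<dots> \<le> exp ((r - 1) * U)" by (rule exp_ge_add_one_self)
    finally show "(1 + r * ?R) / (1 + ?R) \<le> exp ((r - 1) * U)" .
  qed (use \<rho> r finA in auto)
  then have tilt: "zpart b A H (tilt r A ?f) \<le> exp ((r - 1) * U * card A) * zpart b A H ?f"
    by (simp add: mult_ac flip: exp_of_nat_mult)
  have "(\<Sum>S | S \<subseteq> A \<and> Q S. \<rho> ^ card S * b ^ card (inner_edges H S)) \<le>
      (\<Sum>S\<in>Pow A. exp (- (ln r * m)) * ((\<Prod>x\<in>S. tilt r A ?f x) * b ^ card (inner_edges H S)))"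
  proof (rule sum_le_included[where i = "\<lambda>S. S"])
    show "\<forall>S\<in>{S. S \<subseteq> A \<and> Q S}. \<exists>T\<in>Pow A. T = S \<and> \<rho> ^ card S * b ^ card (inner_edges H S) \<le>
        exp (- (ln r * m)) * ((\<Prod>x\<in>T. tilt r A ?f x) * b ^ card (inner_edges H T))"
    proof
      fix S assume S: "S \<in> {S. S \<subseteq> A \<and> Q S}"
      then have fS: "finite S" "S \<inter> A = S" using finA finite_subset by auto
      have "1 \<le> exp (ln r * (card S - m))" using r m S by simp
      also have "\<dots> = exp (- (ln r * m)) * r ^ card S"
        using r by (simp add: exp_diff right_diff_distrib exp_minus field_simps flip: powr_realpow)
          (simp add: powr_def mult.commute)
      finally have "1 * (\<rho> ^ card S * b ^ card (inner_edges H S)) \<le>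
          exp (- (ln r * m)) * r ^ card S * (\<rho> ^ card S * b ^ card (inner_edges H S))"
        using \<rho> b0 by (intro mult_right_mono) auto
      then show "\<exists>T\<in>Pow A. T = S \<and> \<rho> ^ card S * b ^ card (inner_edges H S) \<le>
          exp (- (ln r * m)) * ((\<Prod>x\<in>T. tilt r A ?f x) * b ^ card (inner_edges H T))"
        using S fS by (simp add: prod_tilt mult_ac)
    qed
  qed (use finA \<rho> r b0 in \<open>auto intro!: mult_nonneg_nonneg prod_nonneg tilt_nonneg\<close>)
  also have "\<dots> = exp (- (ln r * m)) * zpart b A H (tilt r A ?f)"
    by (simp add: zpart_def sum_distrib_left)
  also have "\<dots> \<le> exp (- (ln r * m)) * (exp ((r - 1) * U * card A) * zpart b A H ?f)"
    by (intro mult_left_mono tilt) auto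
  also have "\<dots> = exp ((r - 1) * U * card A - ln r * m) * zpart b A H ?f"
    by (simp only: mult.assoc[symmetric] exp_add[symmetric]) simp
  finally show ?thesis .
qed

text \<open>The Chernoff bound for small sets, with a tilt r at most 1 and factors 1 - (1 - r) L /
  (1 + L).\<close>

lemma occ_uniform_lower_tail:
  assumes \<rho>: "0 \<le> \<rho>" and r: "0 < r" "r \<le> 1" and L: "0 \<le> L"
    and occ: "\<And>f x. (\<And>y. y \<in> A \<Longrightarrow> r * \<rho> \<le> f y \<and> f y \<le> \<rho>) \<Longrightarrow> x \<in> A \<Longrightarrow> L \<le> occ b A H f x"
    and m: "\<And>S. Q S \<Longrightarrow> real (card S) \<le> m"
  shows "(\<Sum>S | S \<subseteq> A \<and> Q S. \<rho> ^ card S * b ^ card (inner_edges H S)) \<le>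
    exp (- (1 - r) * (L / (1 + L)) * card A - ln r * m) * zpart b A H (\<lambda>_. \<rho>)"
proof -
  let ?f = "\<lambda>_. \<rho>"
  have "zpart b A H (tilt r A ?f) \<le> zpart b A H ?f * (\<Prod>x\<in>A. exp (- (1 - r) * (L / (1 + L))))"
  proof (rule zpart_tilt_le)
    fix Y x assume Y: "Y \<subseteq> A" "x \<in> A - Y"
    let ?R = "occ b A H (tilt r Y ?f) x"
    have "r * \<rho> \<le> \<rho>" using mult_right_mono[OF r(2) \<rho>] by simp
    then have R: "L \<le> ?R" using Y r \<rho> by (intro occ) (auto simp: tilt_def)
    have "(1 + r * ?R) / (1 + ?R) = 1 - (1 - r) * (?R / (1 + ?R))"
      using R L by (simp add: field_simps)
    also have "L / (1 + L) \<le> ?R / (1 + ?R)" using R L by (simp add: field_simps)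
    then have "1 - (1 - r) * (?R / (1 + ?R)) \<le> 1 - (1 - r) * (L / (1 + L))"
      using r by (intro diff_left_mono mult_left_mono) auto
    also have "\<dots> \<le> exp (- (1 - r) * (L / (1 + L)))"
      using exp_ge_add_one_self[of "- (1 - r) * (L / (1 + L))"] by linarith
    finally show "(1 + r * ?R) / (1 + ?R) \<le> exp (- (1 - r) * (L / (1 + L)))" .
  qed (use \<rho> r finA in auto)
  then have tilt: "zpart b A H (tilt r A ?f) \<le>
      exp (- (1 - r) * (L / (1 + L)) * card A) * zpart b A H ?f"
    unfolding prod_constant exp_of_nat_mult[symmetric] by (simp add: mult_ac)
  have "(\<Sum>S | S \<subseteq> A \<and> Q S. \<rho> ^ card S * b ^ card (inner_edges H S)) \<le>
      (\<Sum>S\<in>Pow A. exp (- (ln r * m)) * ((\<Prod>x\<in>S. tilt r A ?f x) * b ^ card (inner_edges H S)))"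
  proof (rule sum_le_included[where i = "\<lambda>S. S"])
    show "\<forall>S\<in>{S. S \<subseteq> A \<and> Q S}. \<exists>T\<in>Pow A. T = S \<and> \<rho> ^ card S * b ^ card (inner_edges H S) \<le>
        exp (- (ln r * m)) * ((\<Prod>x\<in>T. tilt r A ?f x) * b ^ card (inner_edges H T))"
    proof
      fix S assume S: "S \<in> {S. S \<subseteq> A \<and> Q S}"
      then have fS: "finite S" "S \<inter> A = S" using finA finite_subset by auto
      have "1 \<le> exp (ln r * (card S - m))" using r m S by (simp add: mult_nonpos_nonpos)
      also have "\<dots> = exp (- (ln r * m)) * r ^ card S"
        using r by (simp add: exp_diff right_diff_distrib exp_minus field_simps flip: powr_realpow)
          (simp add: powr_def mult.commute)
      finally have "1 * (\<rho> ^ card S * b ^ card (inner_edges H S)) \<le>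
          exp (- (ln r * m)) * r ^ card S * (\<rho> ^ card S * b ^ card (inner_edges H S))"
        using \<rho> b0 by (intro mult_right_mono) auto
      then show "\<exists>T\<in>Pow A. T = S \<and> \<rho> ^ card S * b ^ card (inner_edges H S) \<le>
          exp (- (ln r * m)) * ((\<Prod>x\<in>T. tilt r A ?f x) * b ^ card (inner_edges H T))"
        using S fS by (simp add: prod_tilt mult_ac)
    qed
  qed (use finA \<rho> r b0 in \<open>auto intro!: mult_nonneg_nonneg prod_nonneg tilt_nonneg\<close>)
  also have "\<dots> = exp (- (ln r * m)) * zpart b A H (tilt r A ?f)"
    by (simp add: zpart_def sum_distrib_left)
  also have "\<dots> \<le> exp (- (ln r * m)) *
      (exp (- (1 - r) * (L / (1 + L)) * card A) * zpart b A H ?f)"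
    by (intro mult_left_mono tilt) auto
  also have "\<dots> = exp (- (1 - r) * (L / (1 + L)) * card A - ln r * m) * zpart b A H ?f"
    by (simp only: mult.assoc[symmetric] exp_add[symmetric]) simp
  finally show ?thesis .
qed

end

lemma spin_model_edges_avoiding:
  assumes "0 \<le> b" "b \<le> 1" "H \<subseteq> edges_avoiding n u"
  shows "spin_model b ({..<n} - {u}) H"
  using assms by unfold_locales (auto simp: edges_avoiding_def)

text \<open>Quantified over all fields close to c / sqrt n because the Chernoff bounds tilt the
  constant field. It is a property of the graph without \<open>u\<close> and so can serve as
  \<open>P\<close> in \<open>gsum_vertex_le\<close>.\<close>

definition occ_bounded :: "real \<Rightarrow> real \<Rightarrow> real \<Rightarrow> real \<Rightarrow> real \<Rightarrow> nat \<Rightarrow> nat \<Rightarrow> nat set set \<Rightarrow> bool" where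
  "occ_bounded b c \<kappa> L U n u H \<longleftrightarrow>
     (\<forall>f. (\<forall>x\<in>{..<n} - {u}. (c - \<kappa>) / sqrt n \<le> f x \<and> f x \<le> (c + \<kappa>) / sqrt n) \<longrightarrow>
       (\<forall>x\<in>{..<n} - {u}. L / sqrt n \<le> occ b ({..<n} - {u}) H f x \<and>
          occ b ({..<n} - {u}) H f x \<le> U / sqrt n))"

text \<open>The Chernoff bound with r = exp t. The number t is so small that the tilted field stays
  below (c + \<kappa>) / sqrt n and that (exp t - 1) U < t (U + \<epsilon>); the difference of these
  two sides is the rate \<theta>.\<close>

lemma degree_upper_tail:
  assumes b: "0 \<le> b" "b \<le> 1" and c: "0 < c" and \<kappa>: "0 < \<kappa>" and U: "0 \<le> U" and \<epsilon>: "0 < \<epsilon>"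
  shows "\<exists>\<theta>>0. \<forall>\<^sub>F n in sequentially. \<forall>u<n.
    gsum (c / sqrt n) b n (\<lambda>G. occ_bounded b c \<kappa> L U n u {e \<in> G. u \<notin> e} \<and>
      (U + \<epsilon>) * sqrt n \<le> real (card (nb G u))) \<le> exp (- \<theta> * sqrt n) * gpart (c / sqrt n) b n"
proof -
  have 1: "\<forall>\<^sub>F t in at_right 0. exp t * c < c + \<kappa>"
  proof (rule order_tendstoD(2))
    show "((\<lambda>t. exp t * c) \<longlongrightarrow> exp 0 * c) (at_right 0)" by (intro tendsto_intros)
  qed (use \<kappa> in simp)
  have "((\<lambda>t. (exp t - 1) / t * U - (U + \<epsilon>)) \<longlongrightarrow> 1 * U - (U + \<epsilon>)) (at_right (0::real))"
    by (intro tendsto_intros) real_asymp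
  then have 2: "\<forall>\<^sub>F t in at_right 0. (exp t - 1) / t * U - (U + \<epsilon>) < 0"
    using \<epsilon> by (intro order_tendstoD(2)) auto
  obtain t where t: "0 < t" "exp t * c < c + \<kappa>" "(exp t - 1) / t * U - (U + \<epsilon>) < 0"
    using eventually_happens[OF eventually_conj[OF eventually_at_right_less[of 0] eventually_conj[OF 1 2]]]
    by auto
  define \<theta> where "\<theta> = t * (U + \<epsilon>) - (exp t - 1) * U"
  have "\<theta> = t * (- ((exp t - 1) / t * U - (U + \<epsilon>)))" using t by (simp add: \<theta>_def field_simps)
  then have \<theta>: "0 < \<theta>" using t by (simp add: mult_pos_pos)
  have *: "\<forall>u<n. gsum (c / sqrt n) b n (\<lambda>G. occ_bounded b c \<kappa> L U n u {e \<in> G. u \<notin> e} \<and>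
      (U + \<epsilon>) * sqrt n \<le> real (card (nb G u))) \<le> exp (- \<theta> * sqrt n) * gpart (c / sqrt n) b n"
    if n: "0 < n" for n :: nat
  proof (intro allI impI)
    fix u assume u: "u < n"
    let ?A = "{..<n} - {u}" and ?\<rho> = "c / sqrt n"
    have s: "0 < sqrt n" using n by simp
    show "gsum ?\<rho> b n (\<lambda>G. occ_bounded b c \<kappa> L U n u {e \<in> G. u \<notin> e} \<and>
      (U + \<epsilon>) * sqrt n \<le> real (card (nb G u))) \<le> exp (- \<theta> * sqrt n) * gpart ?\<rho> b n"
    proof (rule gsum_vertex_le[OF u, where P = "occ_bounded b c \<kappa> L U n u" and
          Q = "\<lambda>S. (U + \<epsilon>) * sqrt n \<le> real (card S)"])
      fix H assume H: "H \<subseteq> edges_avoiding n u" and occ: "occ_bounded b c \<kappa> L U n u H"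
      interpret spin_model b ?A H by (rule spin_model_edges_avoiding[OF b H])
      have "(\<Sum>S | S \<subseteq> ?A \<and> (U + \<epsilon>) * sqrt n \<le> real (card S).
            ?\<rho> ^ card S * b ^ card (inner_edges H S)) \<le>
          exp ((exp t - 1) * (U / sqrt n) * card ?A - ln (exp t) * ((U + \<epsilon>) * sqrt n)) *
          zpart b ?A H (\<lambda>_. ?\<rho>)"
      proof (rule occ_uniform_upper_tail)
        fix f x assume f: "\<And>y. y \<in> ?A \<Longrightarrow> ?\<rho> \<le> f y \<and> f y \<le> exp t * ?\<rho>" and x: "x \<in> ?A"
        have "(c - \<kappa>) / sqrt n \<le> ?\<rho>" "exp t * ?\<rho> \<le> (c + \<kappa>) / sqrt n"
          using \<kappa> t s by (auto simp: divide_simps)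
        then have "\<forall>x\<in>?A. (c - \<kappa>) / sqrt n \<le> f x \<and> f x \<le> (c + \<kappa>) / sqrt n"
          using f by force
        then show "occ b ?A H f x \<le> U / sqrt n" using occ x unfolding occ_bounded_def by blast
      qed (use c U t s in auto)
      also have "\<dots> \<le> exp (- \<theta> * sqrt n) * zpart b ?A H (\<lambda>_. ?\<rho>)"
      proof (intro mult_right_mono)
        have "(exp t - 1) * (U / sqrt n) * card ?A \<le> (exp t - 1) * (U / sqrt n) * n"
          using t U s u by (intro mult_left_mono mult_nonneg_nonneg) auto
        also have "\<dots> = (exp t - 1) * U * sqrt n" using s by (simp add: field_simps)
        finally have "(exp t - 1) * (U / sqrt n) * card ?A - ln (exp t) * ((U + \<epsilon>) * sqrt n) \<le>
            - \<theta> * sqrt n"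
          by (simp add: \<theta>_def algebra_simps)
        then show "exp ((exp t - 1) * (U / sqrt n) * card ?A - ln (exp t) * ((U + \<epsilon>) * sqrt n)) \<le>
            exp (- \<theta> * sqrt n)" by simp
        show "0 \<le> zpart b ?A H (\<lambda>_. ?\<rho>)" using zpart_ge_1[of "\<lambda>_. ?\<rho>"] c s by simp
      qed
      finally show "(\<Sum>S | S \<subseteq> ?A \<and> (U + \<epsilon>) * sqrt n \<le> real (card S).
            ?\<rho> ^ card S * b ^ card (inner_edges H S)) \<le>
          exp (- \<theta> * sqrt n) * zpart b ?A H (\<lambda>_. ?\<rho>)" .
    qed (use c b in auto)
  qed
  have "\<forall>\<^sub>F n in sequentially. \<forall>u<n.
    gsum (c / sqrt n) b n (\<lambda>G. occ_bounded b c \<kappa> L U n u {e \<in> G. u \<notin> e} \<and>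
      (U + \<epsilon>) * sqrt n \<le> real (card (nb G u))) \<le> exp (- \<theta> * sqrt n) * gpart (c / sqrt n) b n"
    using eventually_gt_at_top[of 0] by eventually_elim (rule *)
  then show ?thesis using \<theta> by blast
qed

lemma degree_lower_tail:
  assumes b: "0 \<le> b" "b \<le> 1" and c: "0 < c" and \<kappa>: "0 < \<kappa>" and L: "0 \<le> L" and \<epsilon>: "0 < \<epsilon>"
  shows "\<exists>\<theta>>0. \<forall>\<^sub>F n in sequentially. \<forall>u<n.
    gsum (c / sqrt n) b n (\<lambda>G. occ_bounded b c \<kappa> L U n u {e \<in> G. u \<notin> e} \<and>
      real (card (nb G u)) \<le> (L - \<epsilon>) * sqrt n) \<le> exp (- \<theta> * sqrt n) * gpart (c / sqrt n) b n"
proof -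
  have 1: "\<forall>\<^sub>F t in at_right 0. c - \<kappa> < exp (- t) * c"
  proof (rule order_tendstoD(1))
    show "((\<lambda>t. exp (- t) * c) \<longlongrightarrow> exp (- 0) * c) (at_right 0)" by (intro tendsto_intros)
  qed (use \<kappa> in simp)
  have "((\<lambda>t. (1 - exp (- t)) / t * L - (L - \<epsilon>)) \<longlongrightarrow> 1 * L - (L - \<epsilon>)) (at_right (0::real))"
    by (intro tendsto_intros) real_asymp
  then have 2: "\<forall>\<^sub>F t in at_right 0. 0 < (1 - exp (- t)) / t * L - (L - \<epsilon>)"
    using \<epsilon> by (intro order_tendstoD(1)) auto
  obtain t where t: "0 < t" "c - \<kappa> < exp (- t) * c" "0 < (1 - exp (- t)) / t * L - (L - \<epsilon>)"
    using eventually_happens[OF eventually_conj[OF eventually_at_right_less[of 0] eventually_conj[OF 1 2]]]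
    by auto
  \<comment> \<open>Half of the limiting rate: the factors 1 + L / sqrt n and (n - 1) / n only tend
    to 1.\<close>
  define \<theta> where "\<theta> = ((1 - exp (- t)) * L - t * (L - \<epsilon>)) / 2"
  have "2 * \<theta> = t * ((1 - exp (- t)) / t * L - (L - \<epsilon>))" using t by (simp add: \<theta>_def field_simps)
  then have \<theta>: "0 < \<theta>" using t by (metis mult_pos_pos zero_less_mult_pos zero_less_numeral)
  have "(\<lambda>n. (1 - exp (- t)) * (L / (1 + L * (1 / sqrt (real n)))) * (real (n - 1) / real n) - t * (L - \<epsilon>))
      \<longlonglongrightarrow> (1 - exp (- t)) * (L / (1 + L * 0)) * 1 - t * (L - \<epsilon>)"
    by (intro tendsto_intros) (real_asymp, simp, real_asymp)
  then have 3: "\<forall>\<^sub>F n in sequentially.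
      \<theta> < (1 - exp (- t)) * (L / (1 + L * (1 / sqrt (real n)))) * (real (n - 1) / real n) - t * (L - \<epsilon>)"
    using \<theta> by (intro order_tendstoD(1)) (auto simp: \<theta>_def mult.commute[of L])
  have *: "\<forall>u<n. gsum (c / sqrt n) b n (\<lambda>G. occ_bounded b c \<kappa> L U n u {e \<in> G. u \<notin> e} \<and>
      real (card (nb G u)) \<le> (L - \<epsilon>) * sqrt n) \<le> exp (- \<theta> * sqrt n) * gpart (c / sqrt n) b n"
    if n: "0 < n" and large: "\<theta> < (1 - exp (- t)) * (L / (1 + L * (1 / sqrt (real n)))) *
      (real (n - 1) / real n) - t * (L - \<epsilon>)" for n :: nat
  proof (intro allI impI)
    fix u assume u: "u < n"
    let ?A = "{..<n} - {u}" and ?\<rho> = "c / sqrt n"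
    have s: "0 < sqrt n" using n by simp
    show "gsum ?\<rho> b n (\<lambda>G. occ_bounded b c \<kappa> L U n u {e \<in> G. u \<notin> e} \<and>
      real (card (nb G u)) \<le> (L - \<epsilon>) * sqrt n) \<le> exp (- \<theta> * sqrt n) * gpart ?\<rho> b n"
    proof (rule gsum_vertex_le[OF u, where P = "occ_bounded b c \<kappa> L U n u" and
          Q = "\<lambda>S. real (card S) \<le> (L - \<epsilon>) * sqrt n"])
      fix H assume H: "H \<subseteq> edges_avoiding n u" and occ: "occ_bounded b c \<kappa> L U n u H"
      interpret spin_model b ?A H by (rule spin_model_edges_avoiding[OF b H])
      have "(\<Sum>S | S \<subseteq> ?A \<and> real (card S) \<le> (L - \<epsilon>) * sqrt n.
            ?\<rho> ^ card S * b ^ card (inner_edges H S)) \<le>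
          exp (- (1 - exp (- t)) * (L / sqrt n / (1 + L / sqrt n)) * card ?A -
            ln (exp (- t)) * ((L - \<epsilon>) * sqrt n)) * zpart b ?A H (\<lambda>_. ?\<rho>)"
      proof (rule occ_uniform_lower_tail)
        fix f x assume f: "\<And>y. y \<in> ?A \<Longrightarrow> exp (- t) * ?\<rho> \<le> f y \<and> f y \<le> ?\<rho>" and x: "x \<in> ?A"
        have "(c - \<kappa>) / sqrt n \<le> exp (- t) * ?\<rho>" "?\<rho> \<le> (c + \<kappa>) / sqrt n"
          using \<kappa> t s by (auto simp: divide_simps)
        then have "\<forall>x\<in>?A. (c - \<kappa>) / sqrt n \<le> f x \<and> f x \<le> (c + \<kappa>) / sqrt n"
          using f by force
        then show "L / sqrt n \<le> occ b ?A H f x" using occ x unfolding occ_bounded_def by blast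
      qed (use c L t s in auto)
      also have "\<dots> \<le> exp (- \<theta> * sqrt n) * zpart b ?A H (\<lambda>_. ?\<rho>)"
      proof (intro mult_right_mono)
        have card: "card ?A = n - 1" using u by simp
        have n': "real n = sqrt n * sqrt n" using s by simp
        define B where "B = (1 - exp (- t)) * (L / (1 + L * (1 / sqrt (real n)))) * (real (n - 1) / real n)"
        have "(1 - exp (- t)) * (L / sqrt n / (1 + L / sqrt n)) * card ?A = B * sqrt n"
          unfolding card B_def using s by (subst (5) n') (simp add: divide_simps)
        moreover have "\<theta> * sqrt n \<le> (B - t * (L - \<epsilon>)) * sqrt n"
          using large s unfolding B_def by (intro mult_right_mono) auto
        then have "\<theta> * sqrt n \<le> B * sqrt n - t * ((L - \<epsilon>) * sqrt n)"
          by (simp add: left_diff_distrib mult.assoc)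
        ultimately have "- (1 - exp (- t)) * (L / sqrt n / (1 + L / sqrt n)) * card ?A -
            ln (exp (- t)) * ((L - \<epsilon>) * sqrt n) \<le> - \<theta> * sqrt n"
          unfolding ln_exp mult_minus_left by linarith
        then show "exp (- (1 - exp (- t)) * (L / sqrt n / (1 + L / sqrt n)) * card ?A -
            ln (exp (- t)) * ((L - \<epsilon>) * sqrt n)) \<le> exp (- \<theta> * sqrt n)" by simp
        show "0 \<le> zpart b ?A H (\<lambda>_. ?\<rho>)" using zpart_ge_1[of "\<lambda>_. ?\<rho>"] c s by simp
      qed
      finally show "(\<Sum>S | S \<subseteq> ?A \<and> real (card S) \<le> (L - \<epsilon>) * sqrt n.
            ?\<rho> ^ card S * b ^ card (inner_edges H S)) \<le>
          exp (- \<theta> * sqrt n) * zpart b ?A H (\<lambda>_. ?\<rho>)" .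
    qed (use c b in auto)
  qed
  have "\<forall>\<^sub>F n in sequentially. \<forall>u<n.
    gsum (c / sqrt n) b n (\<lambda>G. occ_bounded b c \<kappa> L U n u {e \<in> G. u \<notin> e} \<and>
      real (card (nb G u)) \<le> (L - \<epsilon>) * sqrt n) \<le> exp (- \<theta> * sqrt n) * gpart (c / sqrt n) b n"
    using 3 eventually_gt_at_top[of 0] by eventually_elim (rule *)
  then show ?thesis using \<theta> by blast
qed

text \<open>Degrees are of order sqrt n, so their Chernoff bounds decay exponentially in sqrt n.
  This rate absorbs union bounds over vertices and pairs of vertices.\<close>

definition unlikely :: "real \<Rightarrow> real \<Rightarrow> (nat \<Rightarrow> nat set set \<Rightarrow> bool) \<Rightarrow> bool" where
  "unlikely c b P \<longleftrightarrow> (\<exists>\<theta>>0. \<forall>\<^sub>F n in sequentially.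
     gsum (c / sqrt n) b n (P n) \<le> exp (- \<theta> * sqrt n) * gpart (c / sqrt n) b n)"

lemma unlikely_mono:
  assumes "unlikely c b Q" "0 \<le> c" "0 \<le> b"
    and "\<forall>\<^sub>F n in sequentially. \<forall>G. G \<subseteq> all_edges n \<longrightarrow> P n G \<longrightarrow> Q n G"
  shows "unlikely c b P"
proof -
  obtain \<theta> where "\<theta> > 0" and ev: "\<forall>\<^sub>F n in sequentially.
     gsum (c / sqrt n) b n (Q n) \<le> exp (- \<theta> * sqrt n) * gpart (c / sqrt n) b n"
    using assms(1) unfolding unlikely_def by blast
  have "\<forall>\<^sub>F n in sequentially.
     gsum (c / sqrt n) b n (P n) \<le> exp (- \<theta> * sqrt n) * gpart (c / sqrt n) b n"
    using ev assms(4)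
  proof eventually_elim
    case (elim n)
    have "gsum (c / sqrt n) b n (P n) \<le> gsum (c / sqrt n) b n (Q n)"
      using elim(2) assms by (intro gsum_mono) auto
    then show ?case using elim(1) by linarith
  qed
  then show ?thesis unfolding unlikely_def using \<open>\<theta> > 0\<close> by blast
qed

lemma unlikely_polynomial_factor:
  assumes \<theta>: "\<theta> > 0" and c: "0 \<le> c" and b: "0 \<le> b" and K: "0 \<le> K"
    and ev: "\<forall>\<^sub>F n in sequentially. gsum (c / sqrt n) b n (P n) \<le>
      (K * real n ^ 2) * exp (- \<theta> * sqrt n) * gpart (c / sqrt n) b n"
  shows "unlikely c b P"
proof -
  have "\<forall>\<^sub>F n in sequentially. (K + 1) * real n ^ 2 * exp (- \<theta> * sqrt (real n)) \<le> exp (- (\<theta> / 2) * sqrt (real n))"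
  proof -
    \<comment> \<open>\<open>K\<close> may be 0, while the asymptotic comparison needs a positive
      coefficient.\<close>
    have "0 < K + 1" using K by simp
    then show ?thesis using \<theta> by real_asymp
  qed
  with ev have "\<forall>\<^sub>F n in sequentially.
     gsum (c / sqrt n) b n (P n) \<le> exp (- (\<theta> / 2) * sqrt n) * gpart (c / sqrt n) b n"
  proof eventually_elim
    case (elim n)
    note elim(1)
    also have "(K * real n ^ 2) * exp (- \<theta> * sqrt n) * gpart (c / sqrt n) b n \<le>
        exp (- (\<theta> / 2) * sqrt n) * gpart (c / sqrt n) b n"
    proof (intro mult_right_mono)
      have "(K * real n ^ 2) * exp (- \<theta> * sqrt n) \<le> (K + 1) * real n ^ 2 * exp (- \<theta> * sqrt (real n))"
        by (intro mult_right_mono) auto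
      then show "(K * real n ^ 2) * exp (- \<theta> * sqrt n) \<le> exp (- (\<theta> / 2) * sqrt n)"
        using elim(2) by linarith
    qed (use c b in \<open>auto intro: gsum_nonneg\<close>)
    finally show ?case .
  qed
  then show ?thesis unfolding unlikely_def using \<theta> by (intro exI[of _ "\<theta> / 2"]) auto
qed

lemma unlikely_disj:
  assumes "unlikely c b P" "unlikely c b Q" "0 \<le> c" "0 \<le> b"
  shows "unlikely c b (\<lambda>n G. P n G \<or> Q n G)"
proof -
  obtain \<theta> \<theta>' where \<theta>: "\<theta> > 0" "\<theta>' > 0" and ev: "\<forall>\<^sub>F n in sequentially.
     gsum (c / sqrt n) b n (P n) \<le> exp (- \<theta> * sqrt n) * gpart (c / sqrt n) b n"
    "\<forall>\<^sub>F n in sequentially.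
     gsum (c / sqrt n) b n (Q n) \<le> exp (- \<theta>' * sqrt n) * gpart (c / sqrt n) b n"
    using assms(1,2) unfolding unlikely_def by blast
  have "\<forall>\<^sub>F n in sequentially. gsum (c / sqrt n) b n (\<lambda>G. P n G \<or> Q n G) \<le>
      (2 * real n ^ 2) * exp (- min \<theta> \<theta>' * sqrt n) * gpart (c / sqrt n) b n"
    using ev eventually_gt_at_top[of 0]
  proof eventually_elim
    case (elim n)
    have Z: "0 \<le> gpart (c / sqrt n) b n" using assms by (intro gsum_nonneg) auto
    have "exp (- \<theta> * sqrt n) \<le> exp (- min \<theta> \<theta>' * sqrt n)" "exp (- \<theta>' * sqrt n) \<le> exp (- min \<theta> \<theta>' * sqrt n)"
      by (auto intro!: mult_right_mono)
    then have "exp (- \<theta> * sqrt n) + exp (- \<theta>' * sqrt n) \<le> 2 * exp (- min \<theta> \<theta>' * sqrt n)"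
      by linarith
    from mult_right_mono[OF this Z]
    have "exp (- \<theta> * sqrt n) * gpart (c / sqrt n) b n + exp (- \<theta>' * sqrt n) * gpart (c / sqrt n) b n \<le>
        2 * exp (- min \<theta> \<theta>' * sqrt n) * gpart (c / sqrt n) b n"
      by (simp only: distrib_right)
    also have "\<dots> \<le> (2 * real n ^ 2) * exp (- min \<theta> \<theta>' * sqrt n) * gpart (c / sqrt n) b n"
      using Z elim(3) by (intro mult_right_mono) auto
    finally show ?case
      using gsum_disj[of "c / sqrt n" b n "P n" "Q n"] elim(1,2) assms by simp
  qed
  then show ?thesis using \<theta> assms by (intro unlikely_polynomial_factor[of "min \<theta> \<theta>'" c b 2]) auto
qed

lemma unlikely_vertex:
  assumes "\<exists>\<theta>>0. \<forall>\<^sub>F n in sequentially. \<forall>u<n.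
      gsum (c / sqrt n) b n (P n u) \<le> exp (- \<theta> * sqrt n) * gpart (c / sqrt n) b n"
    and c: "0 \<le> c" and b: "0 \<le> b"
  shows "unlikely c b (\<lambda>n G. \<exists>u<n. P n u G)"
proof -
  obtain \<theta> where \<theta>: "\<theta> > 0" and ev: "\<forall>\<^sub>F n in sequentially. \<forall>u<n.
      gsum (c / sqrt n) b n (P n u) \<le> exp (- \<theta> * sqrt n) * gpart (c / sqrt n) b n"
    using assms(1) by blast
  have "\<forall>\<^sub>F n in sequentially. gsum (c / sqrt n) b n (\<lambda>G. \<exists>u<n. P n u G) \<le>
      (1 * real n ^ 2) * exp (- \<theta> * sqrt n) * gpart (c / sqrt n) b n"
    using ev eventually_gt_at_top[of 0]
  proof eventually_elim
    case (elim n)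
    have Z: "0 \<le> gpart (c / sqrt n) b n" using assms by (intro gsum_nonneg) auto
    have "gsum (c / sqrt n) b n (\<lambda>G. \<exists>u<n. P n u G) = gsum (c / sqrt n) b n (\<lambda>G. \<exists>u\<in>{..<n}. P n u G)"
      by (simp add: Bex_def)
    also have "\<dots> \<le> (\<Sum>u<n. gsum (c / sqrt n) b n (P n u))"
      using c b by (intro gsum_ex) auto
    also have "\<dots> \<le> (\<Sum>u<n. exp (- \<theta> * sqrt n) * gpart (c / sqrt n) b n)"
      using elim by (intro sum_mono) auto
    also have "\<dots> = real n * exp (- \<theta> * sqrt n) * gpart (c / sqrt n) b n" by simp
    also have "\<dots> \<le> (1 * real n ^ 2) * exp (- \<theta> * sqrt n) * gpart (c / sqrt n) b n"
      using Z elim(2) by (intro mult_right_mono) (auto simp: power2_eq_square)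
    finally show ?case .
  qed
  then show ?thesis using \<theta> c b by (intro unlikely_polynomial_factor[of \<theta> c b 1]) auto
qed

section \<open>Codegrees under the Gibbs measure\<close>

lemma binomial_le_pow_div_fact: "real (n choose k) \<le> real n ^ k / fact k"
proof (cases "k \<le> n")
  case True
  have "real (n choose k) = (\<Prod>i = 0..<k. real n - real i) / fact k"
    by (simp add: binomial_gbinomial gbinomial_prod_rev)
  also have "(\<Prod>i = 0..<k. real n - real i) \<le> (\<Prod>i = 0..<k. real n)"
    using True by (intro prod_mono) auto
  finally show ?thesis by (simp add: divide_right_mono)
qed (simp add: not_le binomial_eq_0)

lemma power_div_fact_le_exp:
  assumes "0 \<le> (y :: real)"
  shows "y ^ k / fact k \<le> exp y"
proof -
  have s: "(\<lambda>n. y ^ n / fact n) sums exp y"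
    using exp_converges[of y] by (simp add: divide_inverse mult.commute)
  then have "(\<Sum>n\<in>{k}. y ^ n / fact n) \<le> (\<Sum>n. y ^ n / fact n)"
    using assms by (intro sum_le_suminf) (auto simp: sums_iff)
  then show ?thesis using s by (simp add: sums_iff)
qed

text \<open>Union bound over the sets of k = ceiling m common neighbours. Such a set forces 2 k
  edges, so \<open>gsum_superset_le\<close> gives at most (n^k / k!) \<rho>^(2k) = c^(2k) / k!.
  Writing this as e^(-k) (e c^2)^k / k! and bounding the last factor by exp (e c^2) leaves the decay
  exp (- m).\<close>

lemma gsum_codegree_le:
  assumes c: "0 \<le> c" and b: "0 \<le> b" "b \<le> 1" and xy: "x < n" "y < n" "x \<noteq> y"
  shows "gsum (c / sqrt n) b n (\<lambda>G. m \<le> real (card (nb G x \<inter> nb G y))) \<le>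
    exp (exp 1 * c\<^sup>2) * exp (- m) * gpart (c / sqrt n) b n"
proof -
  let ?\<rho> = "c / sqrt n" and ?Z = "gpart (c / sqrt n) b n"
  have \<rho>: "0 \<le> ?\<rho>" and Z: "0 \<le> ?Z" using c b by (auto intro: gsum_nonneg)
  define k where "k = nat \<lceil>m\<rceil>"
  let ?I = "{S. S \<subseteq> {..<n} - {x, y} \<and> card S = k}"
  have "gsum ?\<rho> b n (\<lambda>G. m \<le> real (card (nb G x \<inter> nb G y))) \<le>
      gsum ?\<rho> b n (\<lambda>G. \<exists>S\<in>?I. (\<lambda>z. {x, z}) ` S \<union> (\<lambda>z. {y, z}) ` S \<subseteq> G)"
  proof (intro gsum_mono \<rho> b)
    fix G assume G: "G \<subseteq> all_edges n" and m: "m \<le> real (card (nb G x \<inter> nb G y))"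
    have sub: "nb G x \<inter> nb G y \<subseteq> {..<n} - {x, y}"
      using G by (auto simp: nb_def all_edges_def)
    have "k \<le> card (nb G x \<inter> nb G y)" using m by (simp add: k_def nat_le_iff ceiling_le_iff)
    then obtain S where "S \<subseteq> nb G x \<inter> nb G y" "card S = k"
      by (meson obtain_subset_with_card_n)
    then show "\<exists>S\<in>?I. (\<lambda>z. {x, z}) ` S \<union> (\<lambda>z. {y, z}) ` S \<subseteq> G"
      using sub by (intro bexI[of _ S]) (auto simp: nb_def)
  qed
  also have "\<dots> \<le> (\<Sum>S\<in>?I. gsum ?\<rho> b n (\<lambda>G. (\<lambda>z. {x, z}) ` S \<union> (\<lambda>z. {y, z}) ` S \<subseteq> G))"
    using \<rho> b by (intro gsum_ex) auto
  also have "\<dots> \<le> (\<Sum>S\<in>?I. ?\<rho> ^ (2 * k) * ?Z)"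
  proof (rule sum_mono)
    fix S assume S: "S \<in> ?I"
    then have fS: "finite S" using finite_subset by auto
    have "card ((\<lambda>z. {x, z}) ` S \<union> (\<lambda>z. {y, z}) ` S) = card ((\<lambda>z. {x, z}) ` S) + card ((\<lambda>z. {y, z}) ` S)"
      using S fS xy by (intro card_Un_disjoint) (auto simp: doubleton_eq_iff)
    also have "\<dots> = 2 * k"
      using S by (subst (1 2) card_image) (auto simp: inj_on_def doubleton_eq_iff)
    finally have card: "card ((\<lambda>z. {x, z}) ` S \<union> (\<lambda>z. {y, z}) ` S) = 2 * k" .
    have "(\<lambda>z. {x, z}) ` S \<union> (\<lambda>z. {y, z}) ` S \<subseteq> all_edges n"
      using S xy by (auto simp: all_edges_def card_insert_if subset_iff)
    then show "gsum ?\<rho> b n (\<lambda>G. (\<lambda>z. {x, z}) ` S \<union> (\<lambda>z. {y, z}) ` S \<subseteq> G) \<le> ?\<rho> ^ (2 * k) * ?Z"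
      using gsum_superset_le[OF \<rho> b] card by metis
  qed
  also have "\<dots> = real (card ?I) * (?\<rho> ^ (2 * k) * ?Z)" by simp
  also have "card ?I = (n - 2) choose k"
    using xy by (subst n_subsets) (auto simp: numeral_2_eq_2)
  also have "real ((n - 2) choose k) * (?\<rho> ^ (2 * k) * ?Z) \<le> real n ^ k / fact k * (?\<rho> ^ (2 * k) * ?Z)"
  proof (intro mult_right_mono)
    have "(n - 2) choose k \<le> n choose k" by (rule binomial_right_mono) simp
    then have "real ((n - 2) choose k) \<le> real (n choose k)" by simp
    also have "\<dots> \<le> real n ^ k / fact k" by (rule binomial_le_pow_div_fact)
    finally show "real ((n - 2) choose k) \<le> real n ^ k / fact k" .
  qed (use \<rho> Z in auto)
  also have "\<dots> = (real n * ?\<rho>\<^sup>2) ^ k / fact k * ?Z"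
    by (simp add: power_mult power_mult_distrib)
  also have "real n * ?\<rho>\<^sup>2 = c\<^sup>2" using xy by (simp add: power_divide)
  also have "(c\<^sup>2) ^ k / fact k * ?Z \<le> exp (exp 1 * c\<^sup>2) * exp (- m) * ?Z"
  proof (intro mult_right_mono Z)
    have "(c\<^sup>2) ^ k / fact k = exp (- real k) * ((exp 1 * c\<^sup>2) ^ k / fact k)"
      by (simp add: power_mult_distrib exp_minus flip: exp_of_nat_mult)
    also have "(exp 1 * c\<^sup>2) ^ k / fact k \<le> exp (exp 1 * c\<^sup>2)"
      by (rule power_div_fact_le_exp) simp
    also have "exp (- real k) \<le> exp (- m)" unfolding k_def by simp linarith
    finally show "(c\<^sup>2) ^ k / fact k \<le> exp (exp 1 * c\<^sup>2) * exp (- m)" by (simp add: mult_ac)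
  qed
  finally show ?thesis .
qed

lemma unlikely_codegree:
  assumes c: "0 \<le> c" and b: "0 \<le> b" "b \<le> 1" and \<kappa>: "0 < \<kappa>"
  shows "unlikely c b (\<lambda>n G. \<exists>x<n. \<exists>y<n. x \<noteq> y \<and> \<kappa> * sqrt n < real (card (nb G x \<inter> nb G y)))"
proof (rule unlikely_polynomial_factor[OF \<kappa> c b(1), of "exp (exp 1 * c\<^sup>2)"])
  let ?K = "exp (exp 1 * c\<^sup>2)"
  have "gsum (c / sqrt n) b n (\<lambda>G. \<exists>x<n. \<exists>y<n. x \<noteq> y \<and> \<kappa> * sqrt n < real (card (nb G x \<inter> nb G y))) \<le>
      ?K * (real n)\<^sup>2 * exp (- \<kappa> * sqrt n) * gpart (c / sqrt n) b n" for n :: nat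
  proof -
    let ?Z = "gpart (c / sqrt n) b n" and ?I = "{p \<in> {..<n} \<times> {..<n}. fst p \<noteq> snd p}"
    have Z: "0 \<le> ?Z" using c b by (intro gsum_nonneg) auto
    have "gsum (c / sqrt n) b n (\<lambda>G. \<exists>x<n. \<exists>y<n. x \<noteq> y \<and> \<kappa> * sqrt n < real (card (nb G x \<inter> nb G y))) \<le>
        gsum (c / sqrt n) b n (\<lambda>G. \<exists>p\<in>?I. \<kappa> * sqrt n \<le> real (card (nb G (fst p) \<inter> nb G (snd p))))"
      using c b by (intro gsum_mono) (auto intro: less_imp_le)
    also have "\<dots> \<le> (\<Sum>p\<in>?I. gsum (c / sqrt n) b n (\<lambda>G. \<kappa> * sqrt n \<le> real (card (nb G (fst p) \<inter> nb G (snd p)))))"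
      using c b by (intro gsum_ex) auto
    also have "\<dots> \<le> (\<Sum>p\<in>?I. ?K * exp (- (\<kappa> * sqrt n)) * ?Z)"
      using c b by (intro sum_mono gsum_codegree_le) auto
    also have "\<dots> = real (card ?I) * (?K * exp (- (\<kappa> * sqrt n)) * ?Z)" by simp
    also have "\<dots> \<le> (real n)\<^sup>2 * (?K * exp (- (\<kappa> * sqrt n)) * ?Z)"
    proof (intro mult_right_mono)
      have "card ?I \<le> card ({..<n} \<times> {..<n})" by (intro card_mono) auto
      then have "real (card ?I) \<le> real (n * n)" by (simp only: of_nat_le_iff card_cartesian_product card_lessThan)
      then show "real (card ?I) \<le> (real n)\<^sup>2" by (simp add: power2_eq_square)
    qed (use Z in auto)
    finally show ?thesis by (simp add: mult_ac)
  qed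
  then show "\<forall>\<^sub>F n in sequentially. gsum (c / sqrt n) b n
      (\<lambda>G. \<exists>x<n. \<exists>y<n. x \<noteq> y \<and> \<kappa> * sqrt n < real (card (nb G x \<inter> nb G y))) \<le>
      ?K * (real n)\<^sup>2 * exp (- \<kappa> * sqrt n) * gpart (c / sqrt n) b n"
    by simp
qed simp

section \<open>Contraction of the degree windows\<close>

definition degree_window :: "real \<Rightarrow> real \<Rightarrow> real \<Rightarrow> real \<Rightarrow> bool" where
  "degree_window b c l h \<longleftrightarrow> unlikely c b (\<lambda>n G. \<exists>u<n.
     \<not> (l * sqrt n \<le> real (card (nb G u)) \<and> real (card (nb G u)) \<le> h * sqrt n))"

lemma degree_window_conj:
  assumes "degree_window b c l h" "degree_window b c l' h'" "0 \<le> c" "0 \<le> b"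
  shows "degree_window b c (max l l') (min h h')"
  unfolding degree_window_def
  by (rule unlikely_mono[OF unlikely_disj[OF assms(1,2)[unfolded degree_window_def] assms(3,4)]
        assms(3,4)]) (auto simp: max_def min_def intro!: always_eventually)

lemma unlikely_degree:
  assumes b: "0 \<le> b" "b \<le> 1" and c: "0 < c" and \<kappa>: "0 < \<kappa>" and L: "0 \<le> L" and U: "0 \<le> U"
    and \<epsilon>: "0 < \<epsilon>"
  shows "unlikely c b (\<lambda>n G. \<exists>u<n. occ_bounded b c \<kappa> L U n u {e \<in> G. u \<notin> e} \<and>
     \<not> ((L - \<epsilon>) * sqrt n \<le> real (card (nb G u)) \<and> real (card (nb G u)) \<le> (U + \<epsilon>) * sqrt n))"
  by (rule unlikely_mono[OF unlikely_disj[OF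
        unlikely_vertex[OF degree_lower_tail[OF b c \<kappa> L \<epsilon>]]
        unlikely_vertex[OF degree_upper_tail[OF b c \<kappa> U \<epsilon>]]]])
    (use b c in \<open>auto intro!: always_eventually intro: less_imp_le simp: not_le\<close>)

text \<open>Odds never exceed the field, so with \<open>L = 0\<close> and
  \<open>U = c + \<epsilon> / 2\<close> every graph satisfies \<open>occ_bounded\<close>, and the
  Chernoff bound applies without any knowledge of degrees or codegrees.\<close>

lemma degree_window_trivial:
  assumes b: "0 \<le> b" "b \<le> 1" and c: "0 < c" and \<epsilon>: "0 < \<epsilon>"
  shows "degree_window b c 0 (c + \<epsilon>)"
  unfolding degree_window_def
proof (rule unlikely_mono[OF unlikely_degree[OF b c, of "min c (\<epsilon> / 2)" 0 "c + \<epsilon> / 2" "\<epsilon> / 2"]])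
  \<comment> \<open>The entry c keeps the fields nonnegative, the entry \<epsilon> / 2 keeps them
    below (c + \<epsilon> / 2) / sqrt n.\<close>
  let ?\<kappa> = "min c (\<epsilon> / 2)"
  have occ: "occ_bounded b c ?\<kappa> 0 (c + \<epsilon> / 2) n u {e \<in> G. u \<notin> e}"
    if G: "G \<subseteq> all_edges n" for n u G
    unfolding occ_bounded_def
  proof (intro allI impI ballI)
    fix f x
    assume f: "\<forall>x\<in>{..<n} - {u}. (c - ?\<kappa>) / sqrt n \<le> f x \<and> f x \<le> (c + ?\<kappa>) / sqrt n"
      and x: "x \<in> {..<n} - {u}"
    interpret spin_model b "{..<n} - {u}" "{e \<in> G. u \<notin> e}"
      using G by (intro spin_model_edges_avoiding b) (auto simp: edges_avoiding_def all_edges_def)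
    have f0: "0 \<le> f y" if "y \<in> {..<n} - {u}" for y
    proof -
      have "0 \<le> (c - ?\<kappa>) / sqrt n" by auto
      then show ?thesis using f that by (meson order_trans)
    qed
    have "(c + ?\<kappa>) / sqrt n \<le> (c + \<epsilon> / 2) / sqrt n" by (intro divide_right_mono) auto
    then have "f x \<le> (c + \<epsilon> / 2) / sqrt n" using f x by (meson order_trans)
    then show "0 / sqrt n \<le> occ b ({..<n} - {u}) {e \<in> G. u \<notin> e} f x \<and>
        occ b ({..<n} - {u}) {e \<in> G. u \<notin> e} f x \<le> (c + \<epsilon> / 2) / sqrt n"
      using occ_nonneg[of f x] occ_le_field[of f x] f0 x by force
  qed
  show "\<forall>\<^sub>F n in sequentially. \<forall>G\<subseteq>all_edges n.
       (\<exists>u<n. \<not> (0 * sqrt n \<le> real (card (nb G u)) \<and> real (card (nb G u)) \<le> (c + \<epsilon>) * sqrt n)) \<longrightarrow>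
       (\<exists>u<n. occ_bounded b c ?\<kappa> 0 (c + \<epsilon> / 2) n u {e \<in> G. u \<notin> e} \<and>
         \<not> ((0 - \<epsilon> / 2) * sqrt n \<le> real (card (nb G u)) \<and>
            real (card (nb G u)) \<le> (c + \<epsilon> / 2 + \<epsilon> / 2) * sqrt n))"
  proof (intro always_eventually allI impI)
    fix n :: nat and G
    assume G: "G \<subseteq> all_edges n" and "\<exists>u<n. \<not> (0 * sqrt n \<le> real (card (nb G u)) \<and>
        real (card (nb G u)) \<le> (c + \<epsilon>) * sqrt n)"
    then obtain u where u: "u < n" "\<not> real (card (nb G u)) \<le> (c + \<epsilon>) * sqrt n" by auto
    then show "\<exists>u<n. occ_bounded b c ?\<kappa> 0 (c + \<epsilon> / 2) n u {e \<in> G. u \<notin> e} \<and>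
         \<not> ((0 - \<epsilon> / 2) * sqrt n \<le> real (card (nb G u)) \<and>
            real (card (nb G u)) \<le> (c + \<epsilon> / 2 + \<epsilon> / 2) * sqrt n)"
      using occ[OF G, of u] by (intro exI[of _ u]) (simp add: add.commute)
  qed
qed (use assms in auto)

lemma nb_avoiding: "x \<noteq> u \<Longrightarrow> nb {e \<in> G. u \<notin> e} x = nb G x - {u}"
  by (auto simp: nb_def)

lemma regular_graph_avoiding:
  assumes G: "G \<subseteq> all_edges n" and u: "u < n" and large: "1 \<le> \<kappa> * sqrt n"
    and deg: "\<And>x. x < n \<Longrightarrow> l * sqrt n \<le> real (card (nb G x)) \<and> real (card (nb G x)) \<le> h * sqrt n"
    and codeg: "\<And>x y. x < n \<Longrightarrow> y < n \<Longrightarrow> x \<noteq> y \<Longrightarrow> real (card (nb G x \<inter> nb G y)) \<le> \<kappa> * sqrt n"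
  shows "regular_graph n \<kappa> l h ({..<n} - {u}) {e \<in> G. u \<notin> e}"
proof -
  have fin: "finite (nb G x)" for x
    using G by (intro finite_subset[of "nb G x" "{..<n}"]) (auto simp: nb_def all_edges_def)
  have d1: "real (card (nb G x)) - 1 \<le> real (card (nb G x - {u}))" for x
    by (cases "u \<in> nb G x") (auto simp: fin of_nat_diff)
  have d2: "card (nb G x - {u}) \<le> card (nb G x)" for x by (intro card_mono fin) auto
  have d3: "card ((nb G x - {u}) \<inter> (nb G y - {u})) \<le> card (nb G x \<inter> nb G y)" for x y
    by (intro card_mono finite_Int) (auto simp: fin)
  have "(l - \<kappa>) * sqrt n \<le> real (card (nb G x - {u}))" "real (card (nb G x - {u})) \<le> h * sqrt n"
    if "x < n" for x
    using deg[OF that] d1[of x] d2[of x] large by (auto simp: left_diff_distrib)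
  moreover have "real (card ((nb G x - {u}) \<inter> (nb G y - {u}))) \<le> \<kappa> * sqrt n"
    if "x < n" "y < n" "x \<noteq> y" for x y
    using codeg[OF that] d3[of x y] by linarith
  ultimately show ?thesis unfolding regular_graph_def by (auto simp: nb_avoiding)
qed

text \<open>Unless some degree leaves the old window or some codegree is large, the graph without
  \<open>u\<close> is regular in the sense of \<open>regular_graph\<close>. All vertices are then
  undamaged, \<open>occ_within\<close> yields \<open>occ_bounded\<close>, and only the event of
  \<open>unlikely_degree\<close> remains.\<close>

lemma degree_window_step:
  assumes deg: "degree_window b c l h" and win: "occ_window b c l h L U"
    and b: "0 \<le> b" "b \<le> 1" and c: "0 < c" and L: "0 \<le> L" and U: "0 \<le> U" and \<epsilon>: "0 < \<epsilon>"
  shows "degree_window b c (L - \<epsilon>) (U + \<epsilon>)"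
proof -
  obtain \<kappa>' where "\<kappa>' > 0" and ev': "\<forall>\<^sub>F n in sequentially. occ_within b c l h L U \<kappa>' n"
    using win unfolding occ_window_def by blast
  define \<kappa> where "\<kappa> = min c \<kappa>'"
  have \<kappa>: "0 < \<kappa>" "\<kappa> \<le> c" using c \<open>\<kappa>' > 0\<close> by (auto simp: \<kappa>_def)
  have ev: "\<forall>\<^sub>F n in sequentially. occ_within b c l h L U \<kappa> n"
    using ev' by eventually_elim (erule occ_within_mono, auto simp: \<kappa>_def)
  have large: "\<forall>\<^sub>F n in sequentially. 1 \<le> \<kappa> * sqrt (real n)" using \<kappa> by real_asymp
  show ?thesis
    unfolding degree_window_def
  proof (rule unlikely_mono[OF unlikely_disj[OF unlikely_disj[OF deg[unfolded degree_window_def]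
            unlikely_codegree[OF _ b \<kappa>(1)]] unlikely_degree[OF b c \<kappa>(1) L U \<epsilon>]]])
    show "\<forall>\<^sub>F n in sequentially. \<forall>G\<subseteq>all_edges n.
       (\<exists>u<n. \<not> ((L - \<epsilon>) * sqrt n \<le> real (card (nb G u)) \<and> real (card (nb G u)) \<le> (U + \<epsilon>) * sqrt n)) \<longrightarrow>
       ((\<exists>u<n. \<not> (l * sqrt n \<le> real (card (nb G u)) \<and> real (card (nb G u)) \<le> h * sqrt n)) \<or>
        (\<exists>x<n. \<exists>y<n. x \<noteq> y \<and> \<kappa> * sqrt n < real (card (nb G x \<inter> nb G y)))) \<or>
       (\<exists>u<n. occ_bounded b c \<kappa> L U n u {e \<in> G. u \<notin> e} \<and>
         \<not> ((L - \<epsilon>) * sqrt n \<le> real (card (nb G u)) \<and> real (card (nb G u)) \<le> (U + \<epsilon>) * sqrt n))"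
      using ev large
    proof eventually_elim
      case (elim n)
      have "occ_bounded b c \<kappa> L U n u {e \<in> G. u \<notin> e}"
        if G: "G \<subseteq> all_edges n" and u: "u < n"
          and d: "\<And>x. x < n \<Longrightarrow> l * sqrt n \<le> real (card (nb G x)) \<and> real (card (nb G x)) \<le> h * sqrt n"
          and cd: "\<And>x y. x < n \<Longrightarrow> y < n \<Longrightarrow> x \<noteq> y \<Longrightarrow> real (card (nb G x \<inter> nb G y)) \<le> \<kappa> * sqrt n"
        for G u
        unfolding occ_bounded_def
      proof (intro allI impI)
        fix f
        assume f: "\<forall>x\<in>{..<n} - {u}. (c - \<kappa>) / sqrt n \<le> f x \<and> f x \<le> (c + \<kappa>) / sqrt n"
        interpret spin_model b "{..<n} - {u}" "{e \<in> G. u \<notin> e}"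
          using G by (intro spin_model_edges_avoiding b) (auto simp: edges_avoiding_def all_edges_def)
        have "0 \<le> (c - \<kappa>) / sqrt n" using \<kappa> by auto
        then have "0 \<le> f y" if "y \<in> {..<n} - {u}" for y using f that by (meson order_trans)
        moreover have "real (card (nb {e \<in> G. u \<notin> e} w - ({..<n} - {u}))) \<le> \<kappa> * sqrt n" for w
        proof -
          have "nb {e \<in> G. u \<notin> e} w - ({..<n} - {u}) = {}" using nb_subset by blast
          then show ?thesis using \<kappa> by (simp only:) simp
        qed
        ultimately have "admissible ((c - \<kappa>) / sqrt n) ((c + \<kappa>) / sqrt n) (\<kappa> * sqrt n) ({..<n} - {u}) f"
          unfolding admissible_def using f \<kappa> by auto
        then show "\<forall>x\<in>{..<n} - {u}. L / sqrt n \<le> occ b ({..<n} - {u}) {e \<in> G. u \<notin> e} f x \<and>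
            occ b ({..<n} - {u}) {e \<in> G. u \<notin> e} f x \<le> U / sqrt n"
          using elim(1) regular_graph_avoiding[OF G u elim(2) d cd] spin_model_axioms
          unfolding occ_within_def by blast
      qed
      then show ?case by (meson not_le)
    qed
  qed (use c b in auto)
qed

text \<open>A window that bounds both the degrees and the occupation odds maps to such a window again:
  the neighbourhood of a new vertex is a sample of the two-spin model on the rest of the graph, so
  the bounds on the odds turn into bounds on the degrees.\<close>

definition closed_window :: "real \<Rightarrow> real \<Rightarrow> real \<Rightarrow> real \<Rightarrow> bool" where
  "closed_window b c l h \<longleftrightarrow> degree_window b c l h \<and> occ_window b c l h l h"

text \<open>The map \<open>F\<close> of the overview, with \<open>1 - b\<close> in place of
  \<zeta>.\<close>

definition mean_field :: "real \<Rightarrow> real \<Rightarrow> real \<Rightarrow> real" where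
  "mean_field b c x = c * exp (- (1 - b) * x\<^sup>2)"

text \<open>First the odds improve for graphs with degrees in the old window, then the degrees
  follow the improved odds; each half costs \<epsilon> / 2. Intersecting with the old window keeps
  the windows nested.\<close>

lemma closed_window_step:
  assumes "closed_window b c l h" and b: "0 \<le> b" "b \<le> 1" and c: "0 < c"
    and lh: "0 \<le> l" "0 \<le> h" and \<epsilon>: "0 < \<epsilon>"
  shows "closed_window b c (max l (mean_field b c h - \<epsilon>)) (min h (mean_field b c l + \<epsilon>))"
proof -
  have deg: "degree_window b c l h" and win: "occ_window b c l h l h"
    using assms(1) by (auto simp: closed_window_def)
  let ?L = "max l (mean_field b c h - \<epsilon> / 2)" and ?U = "min h (mean_field b c l + \<epsilon> / 2)"
  have "occ_window b c l h (c * exp (- (1 - b) * (h * h)) - \<epsilon> / 2) (c * exp (- (1 - b) * (l * l)) + \<epsilon> / 2)"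
    using \<epsilon> by (intro occ_window_step[OF win c lh b]) auto
  then have "occ_window b c l h (mean_field b c h - \<epsilon> / 2) (mean_field b c l + \<epsilon> / 2)"
    by (simp add: mean_field_def power2_eq_square)
  from occ_window_conj[OF win this] have win': "occ_window b c l h ?L ?U" .
  have U: "0 \<le> ?U" using lh c \<epsilon> by (auto simp: mean_field_def)
  have "degree_window b c (?L - \<epsilon> / 2) (?U + \<epsilon> / 2)"
    using \<epsilon> lh by (intro degree_window_step[OF deg win' b c _ U]) auto
  from degree_window_conj[OF deg this] c b
  have "degree_window b c (max l (?L - \<epsilon> / 2)) (min h (?U + \<epsilon> / 2))" by simp
  moreover have "max l (?L - \<epsilon> / 2) = max l (mean_field b c h - \<epsilon>)"
    "min h (?U + \<epsilon> / 2) = min h (mean_field b c l + \<epsilon>)"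
    using \<epsilon> by (auto simp: max_def min_def)
  moreover have "occ_window b c (max l (mean_field b c h - \<epsilon>)) (min h (mean_field b c l + \<epsilon>))
      (max l (mean_field b c h - \<epsilon>)) (min h (mean_field b c l + \<epsilon>))"
    by (rule occ_window_mono[OF win']) (use \<epsilon> in auto)
  ultimately show ?thesis by (simp add: closed_window_def)
qed

lemma closed_window_start:
  assumes "0 \<le> b" "b \<le> 1" "0 < c"
  shows "closed_window b c 0 (c + 1)"
  using degree_window_trivial[OF assms, of 1] occ_window_trivial[of 1 b c 0 "c + 1"]
  by (simp add: closed_window_def)

text \<open>With v = 2 (1 - b) z^2 the squared derivative is 2 (1 - b) c^2 times v exp (- v), and v
  exp (- v) is at most 1 / e.\<close>

lemma mean_field_lipschitz:
  assumes b: "b \<le> 1" and c: "0 < c"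
  shows "\<bar>mean_field b c x - mean_field b c y\<bar> \<le> sqrt (2 * (1 - b) * c\<^sup>2 / exp 1) * \<bar>x - y\<bar>"
proof -
  let ?d = "\<lambda>z. c * (exp (- (1 - b) * z\<^sup>2) * (- (1 - b) * (2 * z)))"
  have "norm (mean_field b c x - mean_field b c y) \<le> sqrt (2 * (1 - b) * c\<^sup>2 / exp 1) * norm (x - y)"
  proof (rule field_differentiable_bound[of UNIV _ ?d])
    fix z :: real
    show "(mean_field b c has_field_derivative ?d z) (at z within UNIV)"
      unfolding mean_field_def by (auto intro!: derivative_eq_intros)
    let ?v = "2 * (1 - b) * z\<^sup>2"
    have "?v \<le> exp (?v - 1)" using exp_ge_add_one_self[of "?v - 1"] by simp
    then have "?v * exp (- ?v) \<le> exp (?v - 1) * exp (- ?v)" by (rule mult_right_mono) simp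
    also have "\<dots> = exp (- 1)" by (simp only: exp_add[symmetric]) simp
    finally have v: "?v * exp (- ?v) \<le> 1 / exp 1" by (simp only: exp_minus inverse_eq_divide)
    have "(?d z)\<^sup>2 = (2 * (1 - b) * c\<^sup>2) * (?v * exp (- ?v))"
      by (simp add: power2_eq_square exp_add[symmetric] algebra_simps)
    also have "\<dots> \<le> (2 * (1 - b) * c\<^sup>2) * (1 / exp 1)"
      using b by (intro mult_left_mono v) auto
    finally have "\<bar>?d z\<bar> \<le> sqrt (2 * (1 - b) * c\<^sup>2 / exp 1)"
      by (intro real_le_rsqrt) simp
    then show "norm (?d z) \<le> sqrt (2 * (1 - b) * c\<^sup>2 / exp 1)" by simp
  qed auto
  then show ?thesis by simp
qed

text \<open>The mean field map decreases, so the image of a window around the fixed point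
  \<open>a\<close> is again a window around \<open>a\<close>, shorter by the factor \<open>q\<close>
  up to the error 2 \<epsilon>. A number of rounds that depends on \<delta> only brings the length
  below \<delta>.\<close>

lemma degree_window_converges:
  assumes b: "0 \<le> b" "b \<le> 1" and c: "0 < c" and sub: "2 * (1 - b) * c\<^sup>2 < exp 1"
    and a: "mean_field b c a = a" and \<delta>: "0 < \<delta>"
  shows "degree_window b c (a - \<delta>) (a + \<delta>)"
proof -
  define q where "q = sqrt (2 * (1 - b) * c\<^sup>2 / exp 1)"
  have q: "0 \<le> q" "q < 1" using sub b by (auto simp: q_def real_sqrt_lt_1_iff divide_simps)
  have a0: "0 \<le> a" using a c by (metis mean_field_def exp_ge_zero less_imp_le mult_nonneg_nonneg)
  have ac: "a \<le> c"
  proof -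
    have "mean_field b c a \<le> c * 1"
      unfolding mean_field_def using c b by (intro mult_left_mono) (auto intro!: mult_nonpos_nonneg)
    then show ?thesis using a by simp
  qed
  have anti: "mean_field b c y \<le> mean_field b c x" if "0 \<le> x" "x \<le> y" for x y
  proof -
    have "(1 - b) * x\<^sup>2 \<le> (1 - b) * y\<^sup>2" using that b by (intro mult_left_mono power_mono) auto
    then show ?thesis unfolding mean_field_def using c
      by (intro mult_left_mono) (simp_all only: exp_le_cancel_iff mult_minus_left neg_le_iff_le less_imp_le)
  qed
  \<comment> \<open>Chosen so that \<delta> / 2 is the fixed point of y |-> q y + 2 \<epsilon>: the
    accumulated errors never exceed \<delta> / 2.\<close>
  define \<epsilon> where "\<epsilon> = \<delta> * (1 - q) / 4"
  have \<epsilon>: "0 < \<epsilon>" using q \<delta> by (simp add: \<epsilon>_def)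
  have iter: "\<exists>l h. closed_window b c l h \<and> 0 \<le> l \<and> l \<le> a \<and> a \<le> h \<and> h - l \<le> q ^ k * (c + 1) + \<delta> / 2" for k
  proof (induction k)
    case 0
    show ?case
      using closed_window_start[OF b c] a0 ac \<delta> by (intro exI[of _ 0] exI[of _ "c + 1"]) auto
  next
    case (Suc k)
    then obtain l h where lh: "closed_window b c l h" "0 \<le> l" "l \<le> a" "a \<le> h"
      "h - l \<le> q ^ k * (c + 1) + \<delta> / 2" by blast
    let ?l = "max l (mean_field b c h - \<epsilon>)" and ?h = "min h (mean_field b c l + \<epsilon>)"
    have "closed_window b c ?l ?h" using closed_window_step[OF lh(1) b c _ _ \<epsilon>] lh a0 by simp
    moreover have "0 \<le> ?l" using lh by simp
    moreover have "?l \<le> a" using anti[of a h] a0 a lh \<epsilon> by simp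
    moreover have "a \<le> ?h" using anti[of l a] a0 a lh \<epsilon> by simp
    moreover have "?h - ?l \<le> q ^ Suc k * (c + 1) + \<delta> / 2"
    proof -
      have "?h - ?l \<le> (mean_field b c l - mean_field b c h) + 2 * \<epsilon>" by auto
      also have "mean_field b c l - mean_field b c h \<le> q * (h - l)"
        using mean_field_lipschitz[OF b(2) c, of l h] lh unfolding q_def by auto
      also have "q * (h - l) \<le> q * (q ^ k * (c + 1) + \<delta> / 2)" using q lh by (intro mult_left_mono) auto
      also have "q * (q ^ k * (c + 1) + \<delta> / 2) + 2 * \<epsilon> = q ^ Suc k * (c + 1) + \<delta> / 2"
        by (simp add: \<epsilon>_def field_simps)
      finally show ?thesis by simp
    qed
    ultimately show ?case by blast
  qed
  have "(\<lambda>k. q ^ k * (c + 1)) \<longlonglongrightarrow> 0 * (c + 1)" using q by (intro tendsto_intros LIMSEQ_realpow_zero)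
  then have "\<forall>\<^sub>F k in sequentially. q ^ k * (c + 1) < \<delta> / 2"
    using \<delta> by (intro order_tendstoD(2)) auto
  then obtain k where "q ^ k * (c + 1) < \<delta> / 2" using eventually_happens by fastforce
  then obtain l h where "closed_window b c l h" "a - \<delta> \<le> l" "h \<le> a + \<delta>"
    using iter[of k] by force
  then have "unlikely c b (\<lambda>n G. \<exists>u<n. \<not> (l * sqrt n \<le> real (card (nb G u)) \<and> real (card (nb G u)) \<le> h * sqrt n))"
    by (simp add: closed_window_def degree_window_def)
  then show ?thesis
    unfolding degree_window_def
  proof (rule unlikely_mono)
    have "(a - \<delta>) * sqrt n \<le> l * sqrt n" "h * sqrt n \<le> (a + \<delta>) * sqrt n" for n :: nat
      using \<open>a - \<delta> \<le> l\<close> \<open>h \<le> a + \<delta>\<close> by (auto intro!: mult_right_mono)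
    then show "\<forall>\<^sub>F n in sequentially. \<forall>G\<subseteq>all_edges n.
       (\<exists>u<n. \<not> ((a - \<delta>) * sqrt n \<le> real (card (nb G u)) \<and> real (card (nb G u)) \<le> (a + \<delta>) * sqrt n)) \<longrightarrow>
       (\<exists>u<n. \<not> (l * sqrt n \<le> real (card (nb G u)) \<and> real (card (nb G u)) \<le> h * sqrt n))"
      by (intro always_eventually) (meson order_trans)
  qed (use c b in auto)
qed

section \<open>The limiting free energy\<close>

lemma lambert_W_in_image:
  assumes "0 \<le> y"
  shows "y \<in> (\<lambda>x :: real. x * exp x) ` {0..}"
proof -
  have "\<exists>x\<ge>0. x \<le> y \<and> x * exp x = y"
  proof (rule IVT)
    show "0 * exp 0 \<le> y" using assms by simp
    have "y * 1 \<le> y * exp y" using assms by (intro mult_left_mono) auto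
    then show "y \<le> y * exp y" by simp
  qed (use assms in auto)
  then show ?thesis by (auto simp: image_iff)
qed

lemma lambert_W_nonneg: "0 \<le> y \<Longrightarrow> 0 \<le> lambert_W y"
  using inv_into_into[OF lambert_W_in_image, of y] by (simp add: lambert_W_def)

lemma lambert_W_eq: "0 \<le> y \<Longrightarrow> lambert_W y * exp (lambert_W y) = y"
  using f_inv_into_f[OF lambert_W_in_image, of y] by (simp add: lambert_W_def)

text \<open>The map x exp x does not shrink distances on the nonnegative reals. Uniqueness,
  monotonicity and the Lipschitz constant 1 of its inverse all follow from this.\<close>

lemma mult_exp_diff_ge:
  assumes "0 \<le> v" "v \<le> (u :: real)"
  shows "u - v \<le> u * exp u - v * exp v"
proof -
  have "(u - v) * 1 \<le> (u - v) * exp u" using assms by (intro mult_left_mono) auto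
  moreover have "v * exp v \<le> v * exp u" using assms by (intro mult_left_mono) auto
  ultimately show ?thesis by (simp add: left_diff_distrib)
qed

lemma lambert_W_unique:
  assumes "0 \<le> w" "w * exp w = y"
  shows "lambert_W y = w"
proof -
  have y: "0 \<le> y" using assms by auto
  show ?thesis
    using mult_exp_diff_ge[of w "lambert_W y"] mult_exp_diff_ge[of "lambert_W y" w]
      lambert_W_nonneg[OF y] lambert_W_eq[OF y] assms by (cases "w \<le> lambert_W y") auto
qed

lemma lambert_W_0: "lambert_W 0 = 0"
  by (rule lambert_W_unique) auto

lemma lambert_W_mono:
  assumes "0 \<le> x" "x \<le> y"
  shows "lambert_W x \<le> lambert_W y"
  using mult_exp_diff_ge[of "lambert_W y" "lambert_W x"]
    lambert_W_nonneg[of x] lambert_W_nonneg[of y] lambert_W_eq[of x] lambert_W_eq[of y] assms by force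

lemma lambert_W_lipschitz:
  assumes "0 \<le> x" "0 \<le> y"
  shows "\<bar>lambert_W x - lambert_W y\<bar> \<le> \<bar>x - y\<bar>"
  using mult_exp_diff_ge[of "lambert_W y" "lambert_W x"] mult_exp_diff_ge[of "lambert_W x" "lambert_W y"]
    lambert_W_nonneg[of x] lambert_W_nonneg[of y] lambert_W_eq[of x] lambert_W_eq[of y] assms by force

lemma continuous_on_lambert_W: "continuous_on {0..} lambert_W"
proof (rule lipschitz_on_continuous_on)
  show "1-lipschitz_on {0..} lambert_W"
    using lambert_W_lipschitz by (intro lipschitz_onI) (auto simp: dist_real_def)
qed

lemma DERIV_lambert_W:
  assumes "0 < y"
  shows "DERIV lambert_W y :> inverse (exp (lambert_W y) * (1 + lambert_W y))"
proof (rule DERIV_inverse_function[where f = "\<lambda>x. x * exp x" and a = 0 and b = "y + 1"])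
  have W: "0 \<le> lambert_W y" using lambert_W_nonneg assms by simp
  show "DERIV (\<lambda>x. x * exp x) (lambert_W y) :> exp (lambert_W y) * (1 + lambert_W y)"
    by (auto intro!: derivative_eq_intros simp: algebra_simps)
  show "exp (lambert_W y) * (1 + lambert_W y) \<noteq> 0" using W by simp
  show "isCont lambert_W y"
    using continuous_on_interior[OF continuous_on_lambert_W, of y] assms by simp
qed (use assms lambert_W_eq in auto)

text \<open>\<open>edge_density b x\<close> is the fixed point \<open>a = x exp (-(1-b) a\<^sup>2)\<close>, the limiting edge density in units
  of \<open>1 / sqrt n\<close>, and \<open>free_energy b x\<close> its integral against \<open>dx / (2x)\<close>.\<close>

definition edge_density :: "real \<Rightarrow> real \<Rightarrow> real" where
  "edge_density b x = x * exp (- lambert_W (2 * (1 - b) * x\<^sup>2) / 2)"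

definition free_energy :: "real \<Rightarrow> real \<Rightarrow> real" where
  "free_energy b x = edge_density b x * (1 + lambert_W (2 * (1 - b) * x\<^sup>2) / 3) / 2"

text \<open>Squaring the fixed point equation a = x exp (- (1 - b) a^2) gives u exp u = 2 (1 - b)
  x^2 for u = 2 (1 - b) a^2; this is how the Lambert function enters.\<close>

lemma edge_density_square:
  assumes "b \<le> 1"
  shows "2 * (1 - b) * (edge_density b x)\<^sup>2 = lambert_W (2 * (1 - b) * x\<^sup>2)"
proof -
  let ?w = "lambert_W (2 * (1 - b) * x\<^sup>2)"
  have "2 * (1 - b) * (edge_density b x)\<^sup>2 = 2 * (1 - b) * x\<^sup>2 * exp (- ?w)"
    by (simp add: edge_density_def power_mult_distrib flip: exp_of_nat_mult)
  also have "\<dots> = (?w * exp ?w) * exp (- ?w)"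
    using lambert_W_eq[of "2 * (1 - b) * x\<^sup>2"] assms by simp
  also have "\<dots> = ?w" by (simp only: mult.assoc exp_add[symmetric]) simp
  finally show ?thesis .
qed

lemma mean_field_edge_density:
  assumes "b \<le> 1"
  shows "mean_field b x (edge_density b x) = edge_density b x"
proof -
  have "- (1 - b) * (edge_density b x)\<^sup>2 = - lambert_W (2 * (1 - b) * x\<^sup>2) / 2"
    using edge_density_square[OF assms, of x] by linarith
  then show ?thesis by (simp add: mean_field_def edge_density_def)
qed

lemma edge_density_pos: "0 < x \<Longrightarrow> 0 < edge_density b x"
  by (simp add: edge_density_def)

text \<open>Implicit differentiation of the Lambert equation gives x w' (1 + w) = 2 w. With the
  coefficient 1/3 in \<open>free_energy\<close>, the terms containing w' cancel exactly the term in
  w, and exp (- w / 2) / 2 is left.\<close>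

lemma DERIV_free_energy:
  assumes b: "b < 1" and x: "0 < x"
  shows "DERIV (free_energy b) x :> edge_density b x / (2 * x)"
proof -
  let ?y = "2 * (1 - b) * x\<^sup>2"
  let ?w = "lambert_W ?y"
  have y: "0 < ?y" using assms by simp
  have w: "0 \<le> ?w" using lambert_W_nonneg y by simp
  have eq: "?w * exp ?w = ?y" using lambert_W_eq y by simp
  have "((\<lambda>x. lambert_W (2 * (1 - b) * x\<^sup>2)) has_field_derivative
      inverse (exp ?w * (1 + ?w)) * (2 * (1 - b) * (2 * x))) (at x)"
    by (rule DERIV_chain2[where f = lambert_W and g = "\<lambda>x. 2 * (1 - b) * x\<^sup>2", OF DERIV_lambert_W[OF y]])
      (auto intro!: derivative_eq_intros)
  moreover have "inverse (exp ?w * (1 + ?w)) * (2 * (1 - b) * (2 * x)) = 2 * ?w / (x * (1 + ?w))"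
  proof -
    have "2 * (1 - b) * (2 * x) = 2 * (?w * exp ?w) / x"
      unfolding eq using x by (simp add: power2_eq_square)
    moreover have "inverse (E * (1 + v)) * (2 * (v * E) / x) = 2 * v / (x * (1 + v))"
      if "0 < E" "0 \<le> v" for E v :: real
      using that x by (simp add: divide_simps)
    ultimately show ?thesis using w by (simp only: exp_gt_zero)
  qed
  ultimately have dw: "((\<lambda>x. lambert_W (2 * (1 - b) * x\<^sup>2)) has_field_derivative 2 * ?w / (x * (1 + ?w))) (at x)"
    by simp
  have d1: "((\<lambda>x. x * exp (- lambert_W (2 * (1 - b) * x\<^sup>2) / 2) * (1 + lambert_W (2 * (1 - b) * x\<^sup>2) / 3) / 2)
      has_field_derivative
      (x * (exp (- ?w / 2) * (- (2 * ?w / (x * (1 + ?w))) / 2)) + exp (- ?w / 2)) * (1 + ?w / 3) / 2 +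
      x * exp (- ?w / 2) * (2 * ?w / (x * (1 + ?w)) / 3) / 2) (at x)"
    by (rule derivative_eq_intros dw refl | simp)+ (simp add: field_simps)
  have d2: "(x * (exp (- ?w / 2) * (- (2 * ?w / (x * (1 + ?w))) / 2)) + exp (- ?w / 2)) * (1 + ?w / 3) / 2 +
      x * exp (- ?w / 2) * (2 * ?w / (x * (1 + ?w)) / 3) / 2 = exp (- ?w / 2) / 2"
  proof -
    have "(x * (E * (- D / 2)) + E) * (1 + v / 3) / 2 + x * E * (D / 3) / 2 = E / 2"
      if "x * D * (1 + v) = 2 * v" for D E v :: real
    proof -
      have "(x * (E * (- D / 2)) + E) * (1 + v / 3) / 2 + x * E * (D / 3) / 2 =
          E / 2 + E * (2 * v - x * D * (1 + v)) / 12"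
        by (simp add: field_simps)
      then show ?thesis using that by simp
    qed
    moreover have "x * (2 * ?w / (x * (1 + ?w))) * (1 + ?w) = 2 * ?w"
      using x w by simp
    ultimately show ?thesis by blast
  qed
  show ?thesis
    using d1[unfolded d2] x unfolding free_energy_def[abs_def] edge_density_def by simp
qed

lemma continuous_on_free_energy:
  assumes "b \<le> 1"
  shows "continuous_on {0..} (free_energy b)"
proof -
  have "continuous_on {0..} (\<lambda>x. lambert_W (2 * (1 - b) * x\<^sup>2))"
    by (rule continuous_on_compose2[OF continuous_on_lambert_W]) (use assms in \<open>auto intro!: continuous_intros\<close>)
  then show ?thesis
    unfolding free_energy_def[abs_def] edge_density_def by (intro continuous_intros) auto
qed

lemma free_energy_0: "free_energy b 0 = 0"
  by (simp add: free_energy_def edge_density_def)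

section \<open>Expected number of edges under the Gibbs measure\<close>

definition edge_sum :: "real \<Rightarrow> real \<Rightarrow> nat \<Rightarrow> real" where
  "edge_sum \<rho> b n = (\<Sum>G | G \<subseteq> all_edges n. real (card G) * gweight \<rho> b n G)"

lemma card_all_edges: "real (card (all_edges n)) \<le> (real n)\<^sup>2 / 2"
proof -
  have "card (all_edges n) = n choose 2"
    unfolding all_edges_def by (subst n_subsets) auto
  also have "real (n choose 2) \<le> real n ^ 2 / fact 2" by (rule binomial_le_pow_div_fact)
  finally show ?thesis by simp
qed

lemma handshake:
  assumes G: "G \<subseteq> all_edges n"
  shows "(\<Sum>u<n. card (nb G u)) = 2 * card G"
proof -
  have fin: "finite G" using G finite_all_edges finite_subset by blast
  have "card (nb G u) = card {e \<in> G. u \<in> e}" for u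
  proof (rule bij_betw_same_card)
    show "bij_betw (\<lambda>x. {u, x}) (nb G u) {e \<in> G. u \<in> e}"
    proof (rule bij_betw_imageI)
      show "inj_on (\<lambda>x. {u, x}) (nb G u)" by (auto simp: inj_on_def doubleton_eq_iff)
      show "(\<lambda>x. {u, x}) ` nb G u = {e \<in> G. u \<in> e}"
      proof (intro equalityI subsetI)
        fix e assume e: "e \<in> {e \<in> G. u \<in> e}"
        then have "card e = 2" using G by (auto simp: all_edges_def)
        then obtain x y where "e = {x, y}" by (auto simp: card_2_iff)
        then obtain z where "e = {u, z}" using e by auto
        then show "e \<in> (\<lambda>x. {u, x}) ` nb G u" using e by (auto simp: nb_def)
      qed (auto simp: nb_def)
    qed
  qed
  then have "(\<Sum>u<n. card (nb G u)) = (\<Sum>u<n. \<Sum>e\<in>G. if u \<in> e then 1 else 0)"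
    using fin by (simp add: sum.If_cases Int_def)
  also have "\<dots> = (\<Sum>e\<in>G. \<Sum>u<n. if u \<in> e then 1 else 0)" by (rule sum.swap)
  also have "\<dots> = (\<Sum>e\<in>G. 2)"
  proof (rule sum.cong[OF refl])
    fix e assume "e \<in> G"
    then have "e \<subseteq> {..<n}" "card e = 2" using G by (auto simp: all_edges_def)
    then show "(\<Sum>u<n. if u \<in> e then 1 else 0) = (2 :: nat)"
      by (simp add: sum.If_cases Int_absorb1 Int_def[symmetric] Collect_mem_eq)
  qed
  finally show ?thesis by simp
qed

lemma edge_sum_nonneg: "0 \<le> \<rho> \<Longrightarrow> 0 \<le> b \<Longrightarrow> 0 \<le> edge_sum \<rho> b n"
  unfolding edge_sum_def by (auto intro!: sum_nonneg mult_nonneg_nonneg gweight_nonneg)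

text \<open>Each single edge is present with probability at most \<rho>. The resulting bound,
  uniform in n, is both the dominating function for the integration over the field and the Lipschitz
  constant of \<open>log_gpart\<close>.\<close>

lemma edge_sum_le:
  assumes \<rho>: "0 \<le> \<rho>" and b: "0 \<le> b" "b \<le> 1"
  shows "edge_sum \<rho> b n \<le> (real n)\<^sup>2 / 2 * \<rho> * gpart \<rho> b n"
proof -
  have Z: "0 \<le> gpart \<rho> b n" using \<rho> b by (intro gsum_nonneg)
  have "edge_sum \<rho> b n = (\<Sum>G | G \<subseteq> all_edges n. \<Sum>e\<in>all_edges n. if e \<in> G then gweight \<rho> b n G else 0)"
    unfolding edge_sum_def
  proof (intro sum.cong[OF refl])
    fix G assume "G \<in> {G. G \<subseteq> all_edges n}"
    then show "real (card G) * gweight \<rho> b n G = (\<Sum>e\<in>all_edges n. if e \<in> G then gweight \<rho> b n G else 0)"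
      by (simp add: sum.If_cases finite_all_edges Int_absorb1)
  qed
  also have "\<dots> = (\<Sum>e\<in>all_edges n. \<Sum>G | G \<subseteq> all_edges n. if e \<in> G then gweight \<rho> b n G else 0)"
    by (rule sum.swap)
  also have "\<dots> = (\<Sum>e\<in>all_edges n. gsum \<rho> b n (\<lambda>G. {e} \<subseteq> G))"
    unfolding gsum_def using finite_graphs[of n "\<lambda>_. True"]
    by (intro sum.cong[OF refl]) (simp add: sum.If_cases Int_def)
  also have "\<dots> \<le> (\<Sum>e\<in>all_edges n. \<rho> ^ card {e} * gpart \<rho> b n)"
    by (intro sum_mono gsum_superset_le \<rho> b) auto
  also have "\<dots> = real (card (all_edges n)) * (\<rho> * gpart \<rho> b n)" by simp
  also have "\<dots> \<le> (real n)\<^sup>2 / 2 * (\<rho> * gpart \<rho> b n)"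
    using card_all_edges Z \<rho> by (intro mult_right_mono) auto
  finally show ?thesis by (simp add: mult_ac)
qed

text \<open>Outside an unlikely event all degrees are (a +- \<delta>) sqrt n, and the handshake
  identity gives (a +- \<delta>) / 2 times n sqrt n edges. On the exceptional event the crude bound
  n^2 costs sqrt n exp (- \<theta> sqrt n) in these units, which vanishes.\<close>

lemma edge_sum_limit:
  assumes b: "0 \<le> b" "b \<le> 1" and c: "0 < c" and sub: "2 * (1 - b) * c\<^sup>2 < exp 1"
  shows "(\<lambda>n. edge_sum (c / sqrt n) b n / (gpart (c / sqrt n) b n * (n * sqrt n))) \<longlonglongrightarrow> edge_density b c / 2"
proof -
  define a where "a = edge_density b c"
  have a: "0 < a" using edge_density_pos[OF c] by (simp add: a_def)
  have main: "\<exists>\<theta>>0. \<forall>\<^sub>F n in sequentially.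
      (a - \<delta>) / 2 * (1 - exp (- \<theta> * sqrt n)) \<le> edge_sum (c / sqrt n) b n / (gpart (c / sqrt n) b n * (n * sqrt n)) \<and>
      edge_sum (c / sqrt n) b n / (gpart (c / sqrt n) b n * (n * sqrt n)) \<le> (a + \<delta>) / 2 + sqrt n * exp (- \<theta> * sqrt n)"
    if \<delta>: "0 < \<delta>" "\<delta> < a" for \<delta>
  proof -
    define bad where "bad n G \<longleftrightarrow> (\<exists>u<n. \<not> ((a - \<delta>) * sqrt (real n) \<le> real (card (nb G u)) \<and>
        real (card (nb G u)) \<le> (a + \<delta>) * sqrt (real n)))" for n and G :: "nat set set"
    have "degree_window b c (a - \<delta>) (a + \<delta>)"
      using mean_field_edge_density[OF b(2)] by (intro degree_window_converges[OF b c sub _ \<delta>(1)]) (simp add: a_def)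
    then obtain \<theta> where \<theta>: "0 < \<theta>" and ev: "\<forall>\<^sub>F n in sequentially.
        gsum (c / sqrt n) b n (bad n) \<le> exp (- \<theta> * sqrt n) * gpart (c / sqrt n) b n"
      unfolding degree_window_def unlikely_def bad_def by blast
    have "\<forall>\<^sub>F n in sequentially.
      (a - \<delta>) / 2 * (1 - exp (- \<theta> * sqrt n)) \<le> edge_sum (c / sqrt n) b n / (gpart (c / sqrt n) b n * (n * sqrt n)) \<and>
      edge_sum (c / sqrt n) b n / (gpart (c / sqrt n) b n * (n * sqrt n)) \<le> (a + \<delta>) / 2 + sqrt n * exp (- \<theta> * sqrt n)"
      using ev eventually_gt_at_top[of 0]
    proof eventually_elim
      case (elim n)
      let ?\<rho> = "c / sqrt n" and ?s = "real n * sqrt n"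
      let ?Z = "gpart ?\<rho> b n" and ?B = "gsum ?\<rho> b n (bad n)"
      have s: "0 < ?s" using elim by simp
      have \<rho>: "0 \<le> ?\<rho>" using c by simp
      have Z: "1 \<le> ?Z" by (rule gpart_ge_1[OF \<rho> b(1)])
      have B0: "0 \<le> ?B" by (rule gsum_nonneg[OF \<rho> b(1)])
      let ?good = "{G. G \<subseteq> all_edges n \<and> \<not> bad n G}" and ?badset = "{G. G \<subseteq> all_edges n \<and> bad n G}"
      have part: "{G. G \<subseteq> all_edges n} = ?good \<union> ?badset" "?good \<inter> ?badset = {}" by auto
      have fin: "finite ?good" "finite ?badset" by (rule finite_graphs)+
      have split: "edge_sum ?\<rho> b n = (\<Sum>G\<in>?good. real (card G) * gweight ?\<rho> b n G) +
          (\<Sum>G\<in>?badset. real (card G) * gweight ?\<rho> b n G)"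
        unfolding edge_sum_def part(1) by (rule sum.union_disjoint[OF fin part(2)])
      have Zsplit: "?Z = (\<Sum>G\<in>?good. gweight ?\<rho> b n G) + ?B"
      proof -
        have "{G. G \<subseteq> all_edges n \<and> True} = ?good \<union> ?badset" by auto
        then show ?thesis unfolding gsum_def by (simp only: sum.union_disjoint[OF fin part(2)])
      qed
      have good: "(a - \<delta>) / 2 * ?s \<le> real (card G)" "real (card G) \<le> (a + \<delta>) / 2 * ?s" if "G \<in> ?good" for G
      proof -
        have d: "(a - \<delta>) * sqrt n \<le> real (card (nb G u))" "real (card (nb G u)) \<le> (a + \<delta>) * sqrt n"
          if "u < n" for u using \<open>G \<in> ?good\<close> that by (auto simp: bad_def)
        have h: "(\<Sum>u<n. real (card (nb G u))) = 2 * real (card G)"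
          using handshake[of G n] that by (simp flip: of_nat_sum)
        have "(\<Sum>u<n. (a - \<delta>) * sqrt n) \<le> (\<Sum>u<n. real (card (nb G u)))"
          by (intro sum_mono d) simp
        moreover have "(\<Sum>u<n. real (card (nb G u))) \<le> (\<Sum>u<n. (a + \<delta>) * sqrt n)"
          by (intro sum_mono d) simp
        ultimately show "(a - \<delta>) / 2 * ?s \<le> real (card G)" "real (card G) \<le> (a + \<delta>) / 2 * ?s"
          unfolding h by (simp_all add: field_simps)
      qed
      have "(a - \<delta>) / 2 * ?s * (?Z - ?B) = (\<Sum>G\<in>?good. (a - \<delta>) / 2 * ?s * gweight ?\<rho> b n G)"
        unfolding Zsplit by (simp add: sum_distrib_left)
      also have "\<dots> \<le> (\<Sum>G\<in>?good. real (card G) * gweight ?\<rho> b n G)"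
        by (intro sum_mono mult_right_mono good gweight_nonneg \<rho> b)
      also have "\<dots> \<le> edge_sum ?\<rho> b n"
        unfolding split using \<rho> b by (auto intro!: sum_nonneg mult_nonneg_nonneg gweight_nonneg)
      finally have low: "(a - \<delta>) / 2 * ?s * (?Z - ?B) \<le> edge_sum ?\<rho> b n" .
      have "(\<Sum>G\<in>?good. real (card G) * gweight ?\<rho> b n G) \<le> (\<Sum>G\<in>?good. (a + \<delta>) / 2 * ?s * gweight ?\<rho> b n G)"
        by (intro sum_mono mult_right_mono good gweight_nonneg \<rho> b)
      also have "\<dots> = (a + \<delta>) / 2 * ?s * (?Z - ?B)"
        unfolding Zsplit by (simp add: sum_distrib_left)
      also have "\<dots> \<le> (a + \<delta>) / 2 * ?s * ?Z"
        using B0 s a \<delta> by (intro mult_left_mono) auto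
      finally have up1: "(\<Sum>G\<in>?good. real (card G) * gweight ?\<rho> b n G) \<le> (a + \<delta>) / 2 * ?s * ?Z" .
      have "(\<Sum>G\<in>?badset. real (card G) * gweight ?\<rho> b n G) \<le> (\<Sum>G\<in>?badset. (real n)\<^sup>2 * gweight ?\<rho> b n G)"
      proof (intro sum_mono mult_right_mono gweight_nonneg \<rho> b)
        fix G assume "G \<in> ?badset"
        then have "card G \<le> card (all_edges n)" by (intro card_mono finite_all_edges) auto
        then have "real (card G) \<le> real (card (all_edges n))" by simp
        also have "\<dots> \<le> (real n)\<^sup>2 / 2" by (rule card_all_edges)
        finally show "real (card G) \<le> (real n)\<^sup>2" using zero_le_power2[of "real n"] by linarith
      qed
      also have "\<dots> = (real n)\<^sup>2 * ?B" by (simp add: gsum_def sum_distrib_left)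
      also have "\<dots> \<le> (real n)\<^sup>2 * (exp (- \<theta> * sqrt n) * ?Z)" by (intro mult_left_mono elim) auto
      finally have up: "edge_sum ?\<rho> b n \<le> (a + \<delta>) / 2 * ?s * ?Z + (real n)\<^sup>2 * (exp (- \<theta> * sqrt n) * ?Z)"
        unfolding split using up1 by linarith
      have "(a - \<delta>) / 2 * ?s * (?Z - exp (- \<theta> * sqrt n) * ?Z) \<le> (a - \<delta>) / 2 * ?s * (?Z - ?B)"
        using elim s \<delta> by (intro mult_left_mono) auto
      also have "?Z - exp (- \<theta> * sqrt n) * ?Z = (1 - exp (- \<theta> * sqrt n)) * ?Z"
        by (simp add: left_diff_distrib)
      finally have "(a - \<delta>) / 2 * (1 - exp (- \<theta> * sqrt n)) * (?Z * ?s) \<le> edge_sum ?\<rho> b n"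
        using low by (simp only: mult_ac order_trans)
      then have 1: "(a - \<delta>) / 2 * (1 - exp (- \<theta> * sqrt n)) \<le> edge_sum ?\<rho> b n / (?Z * ?s)"
        using Z s by (subst pos_le_divide_eq) auto
      have "(real n)\<^sup>2 = ?s * sqrt n" by (simp add: power2_eq_square)
      moreover have "((a + \<delta>) / 2 + sqrt n * exp (- \<theta> * sqrt n)) * (?Z * ?s) =
          (a + \<delta>) / 2 * ?s * ?Z + ?s * sqrt n * (exp (- \<theta> * sqrt n) * ?Z)"
        unfolding distrib_right by (simp only: mult_ac)
      ultimately have "edge_sum ?\<rho> b n \<le> ((a + \<delta>) / 2 + sqrt n * exp (- \<theta> * sqrt n)) * (?Z * ?s)"
        using up by simp
      then have 2: "edge_sum ?\<rho> b n / (?Z * ?s) \<le> (a + \<delta>) / 2 + sqrt n * exp (- \<theta> * sqrt n)"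
        using Z s by (subst pos_divide_le_eq) auto
      show ?case using 1 2 by simp
    qed
    then show ?thesis using \<theta> by blast
  qed
  show ?thesis
    unfolding a_def[symmetric]
  proof (rule tendstoI)
    fix \<epsilon> :: real assume \<epsilon>: "0 < \<epsilon>"
    define \<delta> where "\<delta> = min \<epsilon> (a / 2)"
    have \<delta>: "0 < \<delta>" "\<delta> < a" "\<delta> \<le> \<epsilon>" using \<epsilon> a by (auto simp: \<delta>_def)
    obtain \<theta> where \<theta>: "0 < \<theta>" and ev: "\<forall>\<^sub>F n in sequentially.
      (a - \<delta>) / 2 * (1 - exp (- \<theta> * sqrt n)) \<le> edge_sum (c / sqrt n) b n / (gpart (c / sqrt n) b n * (n * sqrt n)) \<and>
      edge_sum (c / sqrt n) b n / (gpart (c / sqrt n) b n * (n * sqrt n)) \<le> (a + \<delta>) / 2 + sqrt n * exp (- \<theta> * sqrt n)"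
      using main[OF \<delta>(1,2)] by blast
    have "(\<lambda>n. exp (- \<theta> * sqrt (real n))) \<longlonglongrightarrow> 0" using \<theta> by real_asymp
    then have "(\<lambda>n. (a - \<delta>) / 2 * (1 - exp (- \<theta> * sqrt (real n)))) \<longlonglongrightarrow> (a - \<delta>) / 2 * (1 - 0)"
      by (intro tendsto_intros)
    then have e1: "\<forall>\<^sub>F n in sequentially. a / 2 - \<epsilon> < (a - \<delta>) / 2 * (1 - exp (- \<theta> * sqrt (real n)))"
      using \<delta> \<epsilon> by (intro order_tendstoD(1)) (auto simp: field_simps)
    have "(\<lambda>n. sqrt (real n) * exp (- \<theta> * sqrt (real n))) \<longlonglongrightarrow> 0" using \<theta> by real_asymp
    then have "(\<lambda>n. (a + \<delta>) / 2 + sqrt (real n) * exp (- \<theta> * sqrt (real n))) \<longlonglongrightarrow> (a + \<delta>) / 2 + 0"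
      by (intro tendsto_intros)
    then have e2: "\<forall>\<^sub>F n in sequentially. (a + \<delta>) / 2 + sqrt (real n) * exp (- \<theta> * sqrt (real n)) < a / 2 + \<epsilon>"
      using \<delta> \<epsilon> by (intro order_tendstoD(2)) (auto simp: field_simps)
    from ev e1 e2 show "\<forall>\<^sub>F n in sequentially.
        dist (edge_sum (c / sqrt n) b n / (gpart (c / sqrt n) b n * (n * sqrt n))) (a / 2) < \<epsilon>"
      by eventually_elim (auto simp: dist_real_def abs_less_iff)
  qed
qed

section \<open>The log-partition function by integration over the field\<close>

definition log_gpart :: "real \<Rightarrow> nat \<Rightarrow> real \<Rightarrow> real" where
  "log_gpart b n x = ln (gpart (x / sqrt n) b n) / (n * sqrt n)"

definition log_gpart_deriv :: "real \<Rightarrow> nat \<Rightarrow> real \<Rightarrow> real" where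
  "log_gpart_deriv b n x = edge_sum (x / sqrt n) b n / (gpart (x / sqrt n) b n * (n * sqrt n)) / x"

lemma DERIV_gpart: "((\<lambda>\<rho>. gpart \<rho> b n) has_field_derivative edge_sum \<rho> b n / \<rho>) (at \<rho>)"
  if "\<rho> \<noteq> 0"
proof -
  have "((\<lambda>\<rho>. \<Sum>G | G \<subseteq> all_edges n. \<rho> ^ card G * b ^ num_triangles n G) has_field_derivative
      (\<Sum>G | G \<subseteq> all_edges n. real (card G) * \<rho> ^ (card G - 1) * b ^ num_triangles n G)) (at \<rho>)"
    by (rule DERIV_sum) (auto intro!: derivative_eq_intros)
  moreover have "real (card G) * \<rho> ^ (card G - 1) * b ^ num_triangles n G =
      real (card G) * gweight \<rho> b n G / \<rho>" for G
    using that by (cases "card G") (auto simp: gweight_def)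
  ultimately show ?thesis
    by (simp add: gsum_def gweight_def edge_sum_def sum_divide_distrib)
qed

lemma DERIV_log_gpart:
  assumes "0 \<le> b" "0 < x" "0 < n"
  shows "(log_gpart b n has_field_derivative log_gpart_deriv b n x) (at x)"
proof -
  have s: "0 < sqrt n" using assms by simp
  have Z: "0 < gpart (x / sqrt n) b n" using gpart_ge_1[of "x / sqrt n" b n] assms by simp
  have "((\<lambda>x. gpart (x / sqrt n) b n) has_field_derivative
      edge_sum (x / sqrt n) b n / (x / sqrt n) * (1 / sqrt n)) (at x)"
    by (rule DERIV_chain2[where f = "\<lambda>\<rho>. gpart \<rho> b n" and g = "\<lambda>x. x / sqrt n", OF DERIV_gpart])
      (use assms DERIV_cdivide[OF DERIV_ident, of "sqrt n"] in auto)
  then have "((\<lambda>x. ln (gpart (x / sqrt n) b n) / (n * sqrt n)) has_field_derivative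
      1 / gpart (x / sqrt n) b n * (edge_sum (x / sqrt n) b n / (x / sqrt n) * (1 / sqrt n)) / (n * sqrt n)) (at x)"
    using DERIV_ln_divide[OF Z] by (intro DERIV_cdivide) (rule DERIV_chain2[where f = ln])
  moreover have "1 / gpart (x / sqrt n) b n * (edge_sum (x / sqrt n) b n / (x / sqrt n) * (1 / sqrt n)) / (n * sqrt n) =
      log_gpart_deriv b n x"
    using assms s by (simp add: log_gpart_deriv_def)
  ultimately show ?thesis by (simp add: log_gpart_def[abs_def])
qed

lemma log_gpart_deriv_bounds:
  assumes b: "0 \<le> b" "b \<le> 1" and x: "0 \<le> x"
  shows "0 \<le> log_gpart_deriv b n x" "log_gpart_deriv b n x \<le> 1 / 2"
proof -
  have Z: "1 \<le> gpart (x / sqrt n) b n" using x by (intro gpart_ge_1 b) auto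
  have "0 \<le> edge_sum (x / sqrt n) b n" using x b by (intro edge_sum_nonneg) auto
  then show "0 \<le> log_gpart_deriv b n x" using Z x by (simp add: log_gpart_deriv_def)
  show "log_gpart_deriv b n x \<le> 1 / 2"
  proof (cases "x = 0 \<or> n = 0")
    case False
    then have pos: "0 < x" "0 < sqrt n" using x by auto
    have "edge_sum (x / sqrt n) b n \<le> (real n)\<^sup>2 / 2 * (x / sqrt n) * gpart (x / sqrt n) b n"
      using x b by (intro edge_sum_le) auto
    also have "\<dots> = (1 / 2 * x) * (gpart (x / sqrt n) b n * (n * sqrt n))"
      using pos by (simp add: power2_eq_square field_simps)
    finally have "edge_sum (x / sqrt n) b n / (gpart (x / sqrt n) b n * (n * sqrt n)) \<le> 1 / 2 * x"
      using Z pos by (subst pos_divide_le_eq) auto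
    then show ?thesis unfolding log_gpart_deriv_def using pos by (subst pos_divide_le_eq) auto
  qed (auto simp: log_gpart_deriv_def)
qed

lemma log_gpart_lipschitz:
  assumes b: "0 \<le> b" "b \<le> 1" and xy: "0 < x" "0 < y" and n: "0 < n"
  shows "\<bar>log_gpart b n x - log_gpart b n y\<bar> \<le> \<bar>x - y\<bar> / 2"
proof -
  have "norm (log_gpart b n x - log_gpart b n y) \<le> 1 / 2 * norm (x - y)"
  proof (rule field_differentiable_bound[of "{0<..}" _ "log_gpart_deriv b n"])
    fix z :: real assume z: "z \<in> {0<..}"
    then show "(log_gpart b n has_field_derivative log_gpart_deriv b n z) (at z within {0<..})"
      using DERIV_log_gpart[OF b(1) _ n] by (auto intro: has_field_derivative_at_within)
    show "norm (log_gpart_deriv b n z) \<le> 1 / 2"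
      using log_gpart_deriv_bounds[OF b, of z n] z by auto
  qed (use xy in auto)
  then show ?thesis by simp
qed

lemma gpart_0: "gpart 0 b n = 1"
proof -
  have "gpart 0 b n = (\<Sum>G\<in>{{}}. gweight 0 b n G)"
    unfolding gsum_def
  proof (rule sum.mono_neutral_right)
    show "finite {G. G \<subseteq> all_edges n \<and> True}" by (rule finite_graphs)
    show "\<forall>G\<in>{G. G \<subseteq> all_edges n \<and> True} - {{}}. gweight 0 b n G = 0"
    proof
      fix G assume G: "G \<in> {G. G \<subseteq> all_edges n \<and> True} - {{}}"
      then have "finite G" using finite_all_edges finite_subset by auto
      then show "gweight 0 b n G = 0" using G by (auto simp: gweight_def card_gt_0_iff)
    qed
  qed auto
  then show ?thesis by (simp add: gweight_def num_triangles_empty)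
qed

lemma continuous_on_log_gpart:
  assumes "0 \<le> b"
  shows "continuous_on {0..} (log_gpart b n)"
proof -
  have "continuous_on {0..} (\<lambda>x. gpart (x / sqrt n) b n)"
    unfolding gsum_def gweight_def divide_inverse by (intro continuous_intros)
  moreover have "gpart (x / sqrt n) b n \<noteq> 0" if "x \<in> {0..}" for x
    using gpart_ge_1[of "x / sqrt n" b n] assms that by auto
  ultimately show ?thesis
    unfolding log_gpart_def[abs_def] divide_inverse[of "ln _"]
    by (intro continuous_on_mult continuous_on_ln continuous_on_const) auto
qed

text \<open>At field 0 only the empty graph has weight, so the log-partition function is the
  integral of its derivative from 0. Subcriticality at \<open>c\<close> passes to every smaller x,
  hence the derivative converges on the whole interval, and it is bounded by 1/2.\<close>

lemma log_gpart_limit: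
  assumes b: "0 \<le> b" "b < 1" and c: "0 < c" and sub: "2 * (1 - b) * c\<^sup>2 < exp 1"
  shows "(\<lambda>n. log_gpart b n c) \<longlonglongrightarrow> free_energy b c"
proof -
  have 1: "(log_gpart_deriv b n has_integral log_gpart b n c) {0..c}" for n
  proof (cases "n = 0")
    case False
    have "(log_gpart_deriv b n has_integral log_gpart b n c - log_gpart b n 0) {0..c}"
    proof (rule fundamental_theorem_of_calculus_interior)
      show "continuous_on {0..c} (log_gpart b n)"
        by (rule continuous_on_subset[OF continuous_on_log_gpart[OF b(1)]]) auto
      show "(log_gpart b n has_vector_derivative log_gpart_deriv b n x) (at x)" if "x \<in> {0<..<c}" for x
        using DERIV_log_gpart[OF b(1), of x n] that False
        by (auto simp: has_real_derivative_iff_has_vector_derivative)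
    qed (use c in auto)
    then show ?thesis by (simp add: log_gpart_def gpart_0)
  qed (auto simp: log_gpart_def log_gpart_deriv_def[abs_def])
  have 2: "((\<lambda>x. edge_density b x / (2 * x)) has_integral free_energy b c) {0..c}"
  proof -
    have "((\<lambda>x. edge_density b x / (2 * x)) has_integral free_energy b c - free_energy b 0) {0..c}"
    proof (rule fundamental_theorem_of_calculus_interior)
      show "continuous_on {0..c} (free_energy b)"
        by (rule continuous_on_subset[OF continuous_on_free_energy]) (use b in auto)
      show "(free_energy b has_vector_derivative edge_density b x / (2 * x)) (at x)" if "x \<in> {0<..<c}" for x
        using DERIV_free_energy[OF b(2), of x] that
        by (auto simp: has_real_derivative_iff_has_vector_derivative)
    qed (use c in auto)
    then show ?thesis by (simp add: free_energy_0)
  qed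
  have "(\<lambda>n. integral {0..c} (log_gpart_deriv b n)) \<longlonglongrightarrow> integral {0..c} (\<lambda>x. edge_density b x / (2 * x))"
  proof (rule dominated_convergence(2))
    show "log_gpart_deriv b n integrable_on {0..c}" for n using 1 by blast
    show "(\<lambda>x :: real. 1 / 2 :: real) integrable_on {0..c}" by (rule integrable_const_ivl)
    show "norm (log_gpart_deriv b n x) \<le> 1 / 2" if "x \<in> {0..c}" for n x
      using log_gpart_deriv_bounds[of b x n] b that by auto
    \<comment> \<open>At x = 0 both sides contain a division by zero and equal 0, so the endpoint
      needs no limit argument.\<close>
    show "(\<lambda>n. log_gpart_deriv b n x) \<longlonglongrightarrow> edge_density b x / (2 * x)" if x: "x \<in> {0..c}" for x
    proof (cases "x = 0")
      case False
      have "2 * (1 - b) * x\<^sup>2 \<le> 2 * (1 - b) * c\<^sup>2"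
        using x b by (intro mult_left_mono power_mono) auto
      then have "2 * (1 - b) * x\<^sup>2 < exp 1" using sub by linarith
      then have "(\<lambda>n. edge_sum (x / sqrt n) b n / (gpart (x / sqrt n) b n * (n * sqrt n)) / x) \<longlonglongrightarrow>
          edge_density b x / 2 / x"
        using x False b sub by (intro tendsto_divide[OF edge_sum_limit tendsto_const]) auto
      then show ?thesis by (simp add: log_gpart_deriv_def)
    qed (simp add: log_gpart_deriv_def)
  qed
  then show ?thesis unfolding integral_unique[OF 1] integral_unique[OF 2] .
qed

text \<open>The field p / (1 - p) equals c / sqrt n only asymptotically. The Lipschitz bound of
  \<open>log_gpart\<close>, uniform in n, allows the parameter to vary with n.\<close>

lemma log_gpart_limit_seq:
  assumes b: "0 \<le> b" "b < 1" and c: "0 < c" and sub: "2 * (1 - b) * c\<^sup>2 < exp 1"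
    and x: "x \<longlonglongrightarrow> c"
  shows "(\<lambda>n. log_gpart b n (x n)) \<longlonglongrightarrow> free_energy b c"
proof -
  have "(\<lambda>n. log_gpart b n (x n) - log_gpart b n c) \<longlonglongrightarrow> 0"
  proof (rule Lim_null_comparison)
    have "\<forall>\<^sub>F n in sequentially. 0 < x n" using x c by (rule order_tendstoD(1))
    then show "\<forall>\<^sub>F n in sequentially. norm (log_gpart b n (x n) - log_gpart b n c) \<le> \<bar>x n - c\<bar> / 2"
      using eventually_gt_at_top[of 0]
      by eventually_elim (use log_gpart_lipschitz b c in auto)
    have "(\<lambda>n. \<bar>x n - c\<bar> / 2) \<longlonglongrightarrow> \<bar>c - c\<bar> / 2" by (intro tendsto_intros x) simp
    then show "(\<lambda>n. \<bar>x n - c\<bar> / 2) \<longlonglongrightarrow> 0" by simp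
  qed
  from tendsto_add[OF this log_gpart_limit[OF b c sub]] show ?thesis by simp
qed

section \<open>Laplace transform and mean of the triangle count in G(n,p)\<close>

lemma pmf_gnp:
  assumes p: "0 \<le> p" "p \<le> 1" and G: "G \<subseteq> all_edges n"
  shows "pmf (gnp n p) G = p ^ card G * (1 - p) ^ (card (all_edges n) - card G)"
proof -
  let ?E = "all_edges n"
  let ?M = "Pi_pmf ?E False (\<lambda>_. bernoulli_pmf p)"
  have fin: "finite ?E" by (rule finite_all_edges)
  have "pmf (gnp n p) G = measure_pmf.prob ?M ((\<lambda>f. {e \<in> ?E. f e}) -` {G})"
    by (simp add: gnp_def pmf_map)
  also have "\<dots> = measure_pmf.prob ?M {\<lambda>e. e \<in> G}"
  \<comment> \<open>A graph does not fix the values of \<open>f\<close> outside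
    \<open>all_edges n\<close>, but almost surely they are the default \<open>False\<close>.\<close>
  proof (rule measure_eq_AE)
    show "AE f in measure_pmf ?M. f \<in> (\<lambda>f. {e \<in> ?E. f e}) -` {G} \<longleftrightarrow> f \<in> {\<lambda>e. e \<in> G}"
    proof (rule AE_pmfI)
      fix f assume "f \<in> set_pmf ?M"
      then have "\<And>e. e \<notin> ?E \<Longrightarrow> \<not> f e"
        using set_Pi_pmf_subset[OF fin, of False "\<lambda>_. bernoulli_pmf p"] by auto
      then show "f \<in> (\<lambda>f. {e \<in> ?E. f e}) -` {G} \<longleftrightarrow> f \<in> {\<lambda>e. e \<in> G}"
        using G by (auto simp: fun_eq_iff)
    qed
  qed auto
  also have "\<dots> = pmf ?M (\<lambda>e. e \<in> G)" by (simp add: pmf.rep_eq)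
  also have "\<dots> = (\<Prod>e\<in>?E. pmf (bernoulli_pmf p) (e \<in> G))"
    using G by (intro pmf_Pi' fin) auto
  also have "\<dots> = (\<Prod>e\<in>?E. if e \<in> G then p else 1 - p)"
    using p by (intro prod.cong) auto
  also have "\<dots> = p ^ card G * (1 - p) ^ (card ?E - card G)"
  proof -
    have "?E \<inter> {e. e \<in> G} = G" "?E \<inter> - {e. e \<in> G} = ?E - G" using G by auto
    then show ?thesis using fin G by (simp add: prod.If_cases card_Diff_subset finite_subset)
  qed
  finally show ?thesis .
qed

lemma set_pmf_gnp: "set_pmf (gnp n p) \<subseteq> {G. G \<subseteq> all_edges n}"
  by (auto simp: gnp_def)

lemma expectation_gnp:
  "measure_pmf.expectation (gnp n p) (f :: _ \<Rightarrow> real) = (\<Sum>G | G \<subseteq> all_edges n. pmf (gnp n p) G * f G)"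
  using finite_graphs[of n "\<lambda>_. True"] set_pmf_gnp
  by (subst integral_measure_pmf_real[of "{G. G \<subseteq> all_edges n}"]) (auto simp: mult.commute)

lemma expectation_power_triangles:
  assumes "0 \<le> p" "p < 1"
  shows "measure_pmf.expectation (gnp n p) (\<lambda>G. b ^ num_triangles n G) =
    (1 - p) ^ card (all_edges n) * gpart (p / (1 - p)) b n"
proof -
  have "pmf (gnp n p) G * b ^ num_triangles n G = (1 - p) ^ card (all_edges n) * gweight (p / (1 - p)) b n G"
    if G: "G \<in> {G. G \<subseteq> all_edges n}" for G
  proof -
    have "card G \<le> card (all_edges n)" using G by (intro card_mono finite_all_edges) auto
    then have "(1 - p) ^ card (all_edges n) = (1 - p) ^ card G * (1 - p) ^ (card (all_edges n) - card G)"
      by (simp flip: power_add)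
    then show ?thesis
      using assms G by (simp add: pmf_gnp gweight_def power_divide)
  qed
  then show ?thesis
    unfolding expectation_gnp by (simp add: gsum_def sum_distrib_left)
qed

lemma prob_edges_gnp:
  assumes p: "0 \<le> p" "p \<le> 1" and F: "F \<subseteq> all_edges n"
  shows "measure_pmf.prob (gnp n p) {G. F \<subseteq> G} = p ^ card F"
proof -
  let ?E = "all_edges n"
  have fin: "finite ?E" by (rule finite_all_edges)
  have "measure_pmf.prob (gnp n p) {G. F \<subseteq> G} =
      measure_pmf.prob (Pi_pmf ?E False (\<lambda>_. bernoulli_pmf p)) {f. \<forall>e\<in>F. f e}"
    unfolding gnp_def measure_map_pmf using F by (intro arg_cong2[where f = measure] refl) auto
  also have "{f. \<forall>e\<in>F. f e} = Pi F (\<lambda>_. {True})" by auto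
  also have "measure_pmf.prob (Pi_pmf ?E False (\<lambda>_. bernoulli_pmf p)) (Pi F (\<lambda>_. {True})) =
      measure_pmf.prob (Pi_pmf ?E False (\<lambda>_. bernoulli_pmf p)) (Pi ?E (\<lambda>e. if e \<in> F then {True} else UNIV))"
    using F by (intro arg_cong2[where f = measure] refl) (auto simp: Pi_def split: if_splits)
  also have "\<dots> = (\<Prod>e\<in>?E. measure_pmf.prob (bernoulli_pmf p) (if e \<in> F then {True} else UNIV))"
    by (rule measure_Pi_pmf_Pi[OF fin])
  also have "\<dots> = (\<Prod>e\<in>?E. if e \<in> F then p else 1)"
    using p by (intro prod.cong) (auto simp: measure_pmf_single)
  also have "\<dots> = p ^ card F" using fin F by (simp add: prod.If_cases Int_absorb1)
  finally show ?thesis .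
qed

lemma expected_triangles_eq:
  assumes p: "0 \<le> p" "p \<le> 1"
  shows "expected_triangles n p = real (n choose 3) * p ^ 3"
proof -
  let ?T = "{T. T \<subseteq> {..<n} \<and> card T = 3}"
  define F where "F T = {{u, v} | u v. u \<in> T \<and> v \<in> T \<and> u \<noteq> v}" for T :: "nat set"
  have finT: "finite ?T" by (rule finite_subset[of _ "Pow {..<n}"]) auto
  have F: "F T \<subseteq> all_edges n" "card (F T) = 3" if T: "T \<in> ?T" for T
  proof -
    show "F T \<subseteq> all_edges n" using T by (auto simp: F_def all_edges_def)
    obtain x y z where xyz: "T = {x, y, z}" "x \<noteq> y" "x \<noteq> z" "y \<noteq> z"
      using T by (auto simp: card_3_iff)
    then have "F T = {{x, y}, {x, z}, {y, z}}" by (auto simp: F_def insert_commute)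
    then show "card (F T) = 3" using xyz by (auto simp: card_insert_if doubleton_eq_iff)
  qed
  have num: "real (num_triangles n G) = (\<Sum>T\<in>?T. indicator {G. F T \<subseteq> G} G)" for G
  proof -
    have "{T. T \<subseteq> {..<n} \<and> card T = 3 \<and> (\<forall>u\<in>T. \<forall>v\<in>T. u \<noteq> v \<longrightarrow> {u, v} \<in> G)} = {T \<in> ?T. F T \<subseteq> G}"
      by (auto simp: F_def)
    then show ?thesis
      unfolding num_triangles_def using finT by (simp add: indicator_def sum.If_cases Int_def)
  qed
  have "expected_triangles n p = (\<Sum>T\<in>?T. measure_pmf.prob (gnp n p) {G. F T \<subseteq> G})"
    unfolding expected_triangles_def num
    by (subst Bochner_Integration.integral_sum) (auto intro!: measure_pmf.integrable_const_bound[where B = 1])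
  also have "\<dots> = (\<Sum>T\<in>?T. p ^ 3)" using F p by (intro sum.cong refl) (simp add: prob_edges_gnp)
  also have "\<dots> = real (n choose 3) * p ^ 3"
    using n_subsets[of "{..<n}" 3] by simp
  finally show ?thesis .
qed

section \<open>Lower tails\<close>

text \<open>The lower bound tilts by a parameter slightly beyond \<open>\<beta>\<close>, so that the tilted measure
  concentrates strictly below the threshold.\<close>

lemma lower_tail_from_laplace_limit:
  fixes M :: "nat \<Rightarrow> 'a pmf" and X :: "nat \<Rightarrow> 'a \<Rightarrow> real" and m t :: "nat \<Rightarrow> real" and g x :: "real \<Rightarrow> real"
  assumes m: "filterlim m at_top sequentially" and X: "\<And>n \<omega>. 0 \<le> X n \<omega>"
    and S: "open S" "S \<subseteq> {0..}" "\<beta> \<in> S"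
    and lim: "\<And>s. s \<in> S \<Longrightarrow> (\<lambda>n. ln (measure_pmf.expectation (M n) (\<lambda>\<omega>. exp (- s * X n \<omega>))) / m n) \<longlonglongrightarrow> g s"
    and der: "\<And>s. s \<in> S \<Longrightarrow> (g has_field_derivative - x s) (at s)"
    and cont: "isCont x \<beta>" and decr: "\<And>s. s \<in> S \<Longrightarrow> \<beta> < s \<Longrightarrow> x s < x \<beta>"
    and t: "(\<lambda>n. t n / m n) \<longlonglongrightarrow> x \<beta>"
  shows "(\<lambda>n. ln (measure_pmf.prob (M n) {\<omega>. X n \<omega> \<le> t n}) / m n) \<longlonglongrightarrow> g \<beta> + \<beta> * x \<beta>"
proof -
  define Z where "Z n s = measure_pmf.expectation (M n) (\<lambda>\<omega>. exp (- s * X n \<omega>))" for n s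
  define P where "P n = measure_pmf.prob (M n) {\<omega>. X n \<omega> \<le> t n}" for n
  have Zlim: "(\<lambda>n. ln (Z n s) / m n) \<longlonglongrightarrow> g s" if "s \<in> S" for s
    using lim[OF that] by (simp add: Z_def)
  have int: "integrable (measure_pmf (M n)) (\<lambda>\<omega>. exp (- s * X n \<omega>))" if "0 \<le> s" for n s
    using that X by (intro measure_pmf.integrable_const_bound[where B = 1]) (auto intro!: mult_nonneg_nonneg)
  have Zpos: "0 < Z n s" if "0 \<le> s" for n s
  proof -
    have "Z n s \<noteq> 0"
      unfolding Z_def using integral_nonneg_eq_0_iff_AE[OF int[OF that, of n]]
      by (auto simp: AE_measure_pmf_iff set_pmf_not_empty)
    moreover have "0 \<le> Z n s" unfolding Z_def by (intro integral_nonneg_AE) auto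
    ultimately show ?thesis by simp
  qed
  have mpos: "\<forall>\<^sub>F n in sequentially. 0 < m n" using m by (simp add: filterlim_at_top_dense)
  have \<beta>0: "0 \<le> \<beta>" using S by auto
  \<comment> \<open>Under the measure tilted by \<open>s\<close>, the values of X n / m n outside x
    s +- \<rho> carry at most half of the mass. The other half lies below the threshold, and there
    the tilt factor is at most exp (- s (x s - \<rho>) m n).\<close>
  have lower: "\<forall>\<^sub>F n in sequentially. 0 < P n \<and>
      - ln 2 / m n + ln (Z n s) / m n + s * (x s - \<rho>) \<le> ln (P n) / m n"
    if s: "s \<in> S" and \<rho>: "0 < \<rho>" "x s + \<rho> < x \<beta>" for s \<rho>
  proof -
    have s0: "0 \<le> s" using s S by auto
    have der0: "((\<lambda>h. (g (s + h) - g s) / h) \<longlongrightarrow> - x s) (at 0)"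
      using der[OF s] by (simp add: DERIV_def)
    have Snear: "\<forall>\<^sub>F h in at 0. s + h \<in> S"
    proof -
      have "((\<lambda>h. s + h) \<longlongrightarrow> s + 0) (at 0)" by (intro tendsto_intros)
      then show ?thesis using S(1) s by (intro topological_tendstoD) auto
    qed
    have "\<forall>\<^sub>F h in at 0. \<bar>(g (s + h) - g s) / h + x s\<bar> < \<rho>"
      using tendstoD[OF der0 \<rho>(1)] by (simp add: dist_real_def)
    then have "\<forall>\<^sub>F h in at 0. s + h \<in> S \<and> \<bar>(g (s + h) - g s) / h + x s\<bar> < \<rho>"
      using Snear by eventually_elim simp
    then obtain d where d: "0 < d" and near: "\<And>h. h \<noteq> 0 \<Longrightarrow> \<bar>h\<bar> < d \<Longrightarrow>
        s + h \<in> S \<and> \<bar>(g (s + h) - g s) / h + x s\<bar> < \<rho>"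
      by (auto simp: eventually_at dist_real_def)
    \<comment> \<open>A shift for which the difference quotients of \<open>g\<close> at s + h and s
      - h miss the derivative by less than \<rho>; this makes both exponents in the Markov bounds
      negative.\<close>
    define h where "h = d / 2"
    have h: "0 < h" using d by (simp add: h_def)
    have up: "s + h \<in> S" "g (s + h) - g s + h * (x s - \<rho>) < 0"
      using near[of h] h d by (auto simp: h_def abs_less_iff field_simps)
    have dn: "s - h \<in> S" "g (s - h) - g s - h * (x s + \<rho>) < 0"
      using near[of "- h"] h d by (auto simp: h_def abs_less_iff field_simps)
    have small: "\<forall>\<^sub>F n in sequentially. exp (k * m n) * Z n r \<le> Z n s / 4"
      if r: "r \<in> S" and neg: "g r - g s + k < 0" for r k
    proof -
      have r0: "0 \<le> r" using r S by auto
      have "(\<lambda>n. ln (Z n r) / m n - ln (Z n s) / m n + k) \<longlonglongrightarrow> g r - g s + k"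
        by (intro tendsto_intros Zlim r s)
      then have "\<forall>\<^sub>F n in sequentially. ln (Z n r) / m n - ln (Z n s) / m n + k < (g r - g s + k) / 2"
        using neg by (intro order_tendstoD(2)) auto
      moreover have "\<forall>\<^sub>F n in sequentially. ln 4 / (- ((g r - g s + k) / 2)) \<le> m n"
        using m by (simp add: filterlim_at_top)
      ultimately show ?thesis
        using mpos
      proof eventually_elim
        case (elim n)
        have "(ln (Z n r) / m n - ln (Z n s) / m n + k) * m n \<le> (g r - g s + k) / 2 * m n"
          using elim by (intro mult_right_mono) auto
        moreover have "(ln (Z n r) / m n - ln (Z n s) / m n + k) * m n = ln (Z n r) - ln (Z n s) + k * m n"
          using elim(3) by (simp add: left_diff_distrib distrib_right)
        moreover have "ln 4 \<le> m n * (- ((g r - g s + k) / 2))"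
          using elim(2) neg by (subst (asm) pos_divide_le_eq) auto
        ultimately have "ln (Z n r) + k * m n \<le> ln (Z n s) - ln 4" by (simp add: mult.commute)
        then have "exp (k * m n + ln (Z n r)) \<le> exp (ln (Z n s) - ln 4)" by (simp only: exp_le_cancel_iff add.commute)
        then show ?case
          unfolding exp_add exp_diff using Zpos[OF r0, of n] Zpos[OF s0, of n] by simp
      qed
    qed
    have tn: "\<forall>\<^sub>F n in sequentially. x s + \<rho> < t n / m n" using t \<rho>(2) by (rule order_tendstoD(1))
    have a1: "\<forall>\<^sub>F n in sequentially. exp (- h * (x s + \<rho>) * m n) * Z n (s - h) \<le> Z n s / 4"
      using dn by (intro small) auto
    have a2: "\<forall>\<^sub>F n in sequentially. exp (h * (x s - \<rho>) * m n) * Z n (s + h) \<le> Z n s / 4"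
      using up by (intro small) auto
    from tn a1 a2 mpos show ?thesis
    proof eventually_elim
      case (elim n)
      let ?lo = "(x s - \<rho>) * m n" and ?hi = "(x s + \<rho>) * m n"
      have hit: "?hi < t n" using elim by (simp add: pos_less_divide_eq)
      have h0: "0 \<le> s - h" "0 \<le> s + h" using dn(1) up(1) S by auto
      \<comment> \<open>Three terms for three cases: the window itself, then values above it (Markov
        with s - h), then values below it (Markov with s + h).\<close>
      have pw: "exp (- s * X n \<omega>) \<le> exp (- s * ?lo) * indicator {\<omega>. X n \<omega> \<le> t n} \<omega> +
          exp (- h * (x s + \<rho>) * m n) * exp (- (s - h) * X n \<omega>) +
          exp (h * (x s - \<rho>) * m n) * exp (- (s + h) * X n \<omega>)" for \<omega>
      proof -
        have nn: "0 \<le> exp (- s * ?lo) * indicator {\<omega>. X n \<omega> \<le> t n} \<omega>"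
          "0 \<le> exp (- h * (x s + \<rho>) * m n) * exp (- (s - h) * X n \<omega>)"
          "0 \<le> exp (h * (x s - \<rho>) * m n) * exp (- (s + h) * X n \<omega>)" by auto
        consider "X n \<omega> < ?lo" | "?hi < X n \<omega>" | "?lo \<le> X n \<omega>" "X n \<omega> \<le> ?hi" by linarith
        then show ?thesis
        proof cases
          case 1
          have "h * X n \<omega> \<le> h * ?lo" using 1 h by (intro mult_left_mono) auto
          then have "exp (- s * X n \<omega>) \<le> exp (h * (x s - \<rho>) * m n + - (s + h) * X n \<omega>)"
            by (simp add: algebra_simps)
          then show ?thesis unfolding exp_add using nn by linarith
        next
          case 2
          have "h * ?hi \<le> h * X n \<omega>" using 2 h by (intro mult_left_mono) auto
          then have "exp (- s * X n \<omega>) \<le> exp (- h * (x s + \<rho>) * m n + - (s - h) * X n \<omega>)"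
            by (simp add: algebra_simps)
          then show ?thesis unfolding exp_add using nn by linarith
        next
          case 3
          have "s * ?lo \<le> s * X n \<omega>" using 3 s0 by (intro mult_left_mono) auto
          then have "exp (- s * X n \<omega>) \<le> exp (- s * ?lo)" by simp
          moreover have "X n \<omega> \<le> t n" using 3 hit by linarith
          then have "indicator {\<omega>. X n \<omega> \<le> t n} \<omega> = (1 :: real)" by simp
          ultimately show ?thesis using nn(2,3) by (simp only: mult_1_right)
        qed
      qed
      have intP: "integrable (measure_pmf (M n)) (indicator {\<omega>. X n \<omega> \<le> t n} :: _ \<Rightarrow> real)"
        by (intro measure_pmf.integrable_const_bound[where B = 1]) auto
      have intP_eq: "measure_pmf.expectation (M n) (indicator {\<omega>. X n \<omega> \<le> t n}) = P n"
        by (simp add: P_def)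
      have ints: "integrable (measure_pmf (M n)) (\<lambda>\<omega>. exp (- s * ?lo) * indicator {\<omega>. X n \<omega> \<le> t n} \<omega>)"
        "integrable (measure_pmf (M n)) (\<lambda>\<omega>. exp (- h * (x s + \<rho>) * m n) * exp (- (s - h) * X n \<omega>))"
        "integrable (measure_pmf (M n)) (\<lambda>\<omega>. exp (h * (x s - \<rho>) * m n) * exp (- (s + h) * X n \<omega>))"
        by (rule integrable_mult_right, rule intP, (rule integrable_mult_right, rule int, rule h0)+)
      have "Z n s \<le> measure_pmf.expectation (M n) (\<lambda>\<omega>. exp (- s * ?lo) * indicator {\<omega>. X n \<omega> \<le> t n} \<omega> +
          exp (- h * (x s + \<rho>) * m n) * exp (- (s - h) * X n \<omega>) +
          exp (h * (x s - \<rho>) * m n) * exp (- (s + h) * X n \<omega>))"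
        unfolding Z_def
        by (rule integral_mono[OF int[OF s0] Bochner_Integration.integrable_add[OF
                Bochner_Integration.integrable_add[OF ints(1,2)] ints(3)] pw])
      also have "\<dots> = measure_pmf.expectation (M n) (\<lambda>\<omega>. exp (- s * ?lo) * indicator {\<omega>. X n \<omega> \<le> t n} \<omega>) +
          measure_pmf.expectation (M n) (\<lambda>\<omega>. exp (- h * (x s + \<rho>) * m n) * exp (- (s - h) * X n \<omega>)) +
          measure_pmf.expectation (M n) (\<lambda>\<omega>. exp (h * (x s - \<rho>) * m n) * exp (- (s + h) * X n \<omega>))"
        unfolding Bochner_Integration.integral_add[OF Bochner_Integration.integrable_add[OF ints(1,2)] ints(3)]
          Bochner_Integration.integral_add[OF ints(1,2)] ..
      also have "\<dots> = exp (- s * ?lo) * P n + exp (- h * (x s + \<rho>) * m n) * Z n (s - h) +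
          exp (h * (x s - \<rho>) * m n) * Z n (s + h)"
        unfolding Z_def integral_mult_right_zero intP_eq ..
      finally have "Z n s / 2 \<le> exp (- s * ?lo) * P n" using elim by linarith
      then have "Z n s / 2 * exp (s * ?lo) \<le> exp (- s * ?lo) * P n * exp (s * ?lo)"
        by (rule mult_right_mono) simp
      also have "\<dots> = P n * (exp (- s * ?lo) * exp (s * ?lo))" by (simp only: mult_ac)
      also have "exp (- s * ?lo) * exp (s * ?lo) = 1" by (simp flip: exp_add)
      finally have le: "Z n s / 2 * exp (s * ?lo) \<le> P n" by simp
      have pos: "0 < Z n s / 2 * exp (s * ?lo)" using Zpos[OF s0] by simp
      then have Pp: "0 < P n" using le by linarith
      have "ln (Z n s / 2 * exp (s * ?lo)) \<le> ln (P n)" using pos Pp le by (simp only: ln_le_cancel_iff)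
      then have "ln (Z n s) - ln 2 + s * (x s - \<rho>) * m n \<le> ln (P n)"
        using Zpos[OF s0, of n] by (simp add: ln_mult ln_div mult.assoc)
      then have "(ln (Z n s) - ln 2 + s * (x s - \<rho>) * m n) / m n \<le> ln (P n) / m n"
        using elim by (intro divide_right_mono) auto
      then show ?case using Pp elim by (simp add: add_divide_distrib diff_divide_distrib)
    qed
  qed
  have right: "\<forall>\<^sub>F s in at_right \<beta>. s \<in> S"
    using eventually_at_in_open'[OF S(1,3)] by (rule filter_leD[OF at_within_le_at])
  have gx: "((\<lambda>s. g s + s * x s) \<longlongrightarrow> g \<beta> + \<beta> * x \<beta>) (at_right \<beta>)"
  proof (intro tendsto_intros)
    show "(g \<longlongrightarrow> g \<beta>) (at_right \<beta>)"
      using DERIV_isCont[OF der[OF S(3)]] by (auto simp: isCont_def intro: filterlim_mono at_within_le_at)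
    show "(x \<longlongrightarrow> x \<beta>) (at_right \<beta>)"
      using cont by (auto simp: isCont_def intro: filterlim_mono at_within_le_at)
  qed
  \<comment> \<open>Needed before logarithms are compared in the upper bound; any tilt beyond
    \<beta> supplies it.\<close>
  have P_pos: "\<forall>\<^sub>F n in sequentially. 0 < P n"
  proof -
    obtain s where "s \<in> S" "\<beta> < s"
      using eventually_happens[OF eventually_conj[OF right eventually_at_right_less]] by auto
    with lower[of s "(x \<beta> - x s) / 2"] decr[of s] show ?thesis
      by (auto elim!: eventually_mono simp: field_simps)
  qed
  show ?thesis
    unfolding P_def[symmetric]
  proof (rule order_tendstoI)
    fix y assume y: "y < g \<beta> + \<beta> * x \<beta>"
    have "\<forall>\<^sub>F s in at_right \<beta>. y < g s + s * x s" using gx y by (rule order_tendstoD(1))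
    then obtain s where s: "s \<in> S" "\<beta> < s" "y < g s + s * x s"
      using eventually_happens[OF eventually_conj[OF right eventually_conj[OF eventually_at_right_less]]] by auto
    \<comment> \<open>The first entry keeps the window around x s below x \<beta>; the second makes
      s \<rho> smaller than the room left above y.\<close>
    define \<rho> where "\<rho> = min ((x \<beta> - x s) / 2) ((g s + s * x s - y) / (2 * s))"
    have s0: "0 < s" using s \<beta>0 by simp
    have \<rho>: "0 < \<rho>" "x s + \<rho> < x \<beta>" using decr[OF s(1,2)] s s0 by (auto simp: \<rho>_def min_def field_simps)
    have "s * \<rho> \<le> s * ((g s + s * x s - y) / (2 * s))" using s0 by (intro mult_left_mono) (auto simp: \<rho>_def)
    also have "\<dots> < g s + s * x s - y" using s s0 by simp
    finally have y': "y < - ln 2 * 0 + g s + s * (x s - \<rho>)" by (simp add: right_diff_distrib)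
    have "(\<lambda>n. inverse (m n)) \<longlonglongrightarrow> 0" using m by (rule tendsto_inverse_0_at_top)
    then have "(\<lambda>n. - ln 2 * inverse (m n) + ln (Z n s) / m n + s * (x s - \<rho>)) \<longlonglongrightarrow>
        - ln 2 * 0 + g s + s * (x s - \<rho>)"
      by (intro tendsto_intros Zlim s)
    then have "\<forall>\<^sub>F n in sequentially. y < - ln 2 * inverse (m n) + ln (Z n s) / m n + s * (x s - \<rho>)"
      using y' by (rule order_tendstoD(1))
    with lower[OF s(1) \<rho>] show "\<forall>\<^sub>F n in sequentially. y < ln (P n) / m n"
      by eventually_elim (simp add: divide_inverse)
  next
    fix y assume y: "g \<beta> + \<beta> * x \<beta> < y"
    \<comment> \<open>The upper bound is the exponential Markov inequality at \<beta>
      itself.\<close>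
    have "(\<lambda>n. ln (Z n \<beta>) / m n + \<beta> * (t n / m n)) \<longlonglongrightarrow> g \<beta> + \<beta> * x \<beta>"
      by (intro tendsto_intros Zlim S t)
    then have "\<forall>\<^sub>F n in sequentially. ln (Z n \<beta>) / m n + \<beta> * (t n / m n) < y"
      using y by (rule order_tendstoD(2))
    with P_pos mpos show "\<forall>\<^sub>F n in sequentially. ln (P n) / m n < y"
    proof eventually_elim
      case (elim n)
      have "P n = measure_pmf.expectation (M n) (indicator {\<omega>. X n \<omega> \<le> t n})"
        by (simp add: P_def)
      also have "\<dots> \<le> measure_pmf.expectation (M n) (\<lambda>\<omega>. exp (\<beta> * t n) * exp (- \<beta> * X n \<omega>))"
      proof (intro integral_mono integrable_mult_right int \<beta>0)
        show "indicator {\<omega>. X n \<omega> \<le> t n} \<omega> \<le> exp (\<beta> * t n) * exp (- \<beta> * X n \<omega>)" for \<omega>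
          using \<beta>0 by (auto simp: indicator_def mult_left_mono simp flip: exp_add)
      qed (auto intro!: measure_pmf.integrable_const_bound[where B = 1])
      also have "\<dots> = exp (\<beta> * t n) * Z n \<beta>" by (simp add: Z_def)
      finally have "ln (P n) \<le> ln (exp (\<beta> * t n) * Z n \<beta>)"
        using elim(1) Zpos[OF \<beta>0, of n] by (subst ln_le_cancel_iff) auto
      also have "\<dots> = \<beta> * t n + ln (Z n \<beta>)" using Zpos[OF \<beta>0, of n] by (simp add: ln_mult)
      finally have "ln (P n) / m n \<le> (\<beta> * t n + ln (Z n \<beta>)) / m n"
        using elim by (intro divide_right_mono) auto
      then show ?case using elim by (simp add: add_divide_distrib)
    qed
  qed
qed

text \<open>Passing from the Gibbs weights to probabilities costs the factor (1 - p)^(n choose 2),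
  whose logarithm is about - (n^2 / 2) c / sqrt n; this is the term - c / 2.\<close>

lemma log_laplace_triangles_limit:
  assumes b: "0 \<le> b" "b < 1" and c: "0 < c" and sub: "2 * (1 - b) * c\<^sup>2 < exp 1"
    and p: "\<And>n. 0 \<le> p n \<and> p n \<le> 1" and lim: "(\<lambda>n. p n * sqrt n) \<longlonglongrightarrow> c"
  shows "(\<lambda>n. ln (measure_pmf.expectation (gnp n (p n)) (\<lambda>G. b ^ num_triangles n G)) / (n * sqrt n))
    \<longlonglongrightarrow> free_energy b c - c / 2"
proof -
  have "(\<lambda>n. p n * sqrt n * (1 / sqrt (real n))) \<longlonglongrightarrow> c * 0"
    by (intro tendsto_mult lim) real_asymp
  moreover have "\<forall>\<^sub>F n in sequentially. p n * sqrt n * (1 / sqrt (real n)) = p n"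
    using eventually_gt_at_top[of 0] by eventually_elim simp
  ultimately have p0: "p \<longlonglongrightarrow> 0" by (simp add: tendsto_cong)
  have psmall: "\<forall>\<^sub>F n in sequentially. p n < 1" using p0 by (rule order_tendstoD(2)) simp
  have "\<forall>\<^sub>F n in sequentially. 0 < p n * sqrt n" using lim c by (rule order_tendstoD(1))
  then have ppos: "\<forall>\<^sub>F n in sequentially. 0 < p n"
    by eventually_elim (auto simp: zero_less_mult_iff)
  define x where "x n = p n * sqrt n / (1 - p n)" for n
  have "x \<longlonglongrightarrow> c / (1 - 0)" unfolding x_def[abs_def] by (intro tendsto_intros lim p0) simp
  then have L1: "(\<lambda>n. log_gpart b n (x n)) \<longlonglongrightarrow> free_energy b c"
    by (intro log_gpart_limit_seq b c sub) simp
  have lnp: "(\<lambda>n. ln (1 - p n) / p n) \<longlonglongrightarrow> - 1"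
  proof -
    have "((\<lambda>q :: real. ln (1 - q) / q) \<longlongrightarrow> - 1) (at_right 0)" by real_asymp
    moreover have "filterlim p (at_right 0) sequentially"
      using p0 ppos by (simp add: filterlim_at eventually_mono)
    ultimately show ?thesis by (rule filterlim_compose)
  qed
  have "(\<lambda>n. real (n choose 2) / (real n)\<^sup>2) \<longlonglongrightarrow> 1 / 2"
  proof -
    have eq: "real (n choose 2) = real n * (real n - 1) / 2" for n
      by (simp add: binomial_gbinomial gbinomial_prod_rev numeral_2_eq_2 prod.atLeast0_lessThan_Suc)
    show ?thesis unfolding eq by real_asymp
  qed
  from tendsto_mult[OF tendsto_mult[OF this lnp] lim]
  have L2: "(\<lambda>n. real (n choose 2) / (real n)\<^sup>2 * (ln (1 - p n) / p n) * (p n * sqrt n)) \<longlonglongrightarrow> - (c / 2)"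
    by simp
  have "(\<lambda>n. real (n choose 2) / (real n)\<^sup>2 * (ln (1 - p n) / p n) * (p n * sqrt n) + log_gpart b n (x n))
      \<longlonglongrightarrow> - (c / 2) + free_energy b c"
    by (intro tendsto_add L1 L2)
  moreover have "\<forall>\<^sub>F n in sequentially.
      ln (measure_pmf.expectation (gnp n (p n)) (\<lambda>G. b ^ num_triangles n G)) / (n * sqrt n) =
      real (n choose 2) / (real n)\<^sup>2 * (ln (1 - p n) / p n) * (p n * sqrt n) + log_gpart b n (x n)"
    using psmall ppos eventually_gt_at_top[of 0]
  proof eventually_elim
    case (elim n)
    have card: "card (all_edges n) = n choose 2"
      unfolding all_edges_def by (subst n_subsets) auto
    have x: "x n / sqrt n = p n / (1 - p n)" using elim by (simp add: x_def)
    have Z: "1 \<le> gpart (p n / (1 - p n)) b n" using elim b by (intro gpart_ge_1) auto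
    have "ln (measure_pmf.expectation (gnp n (p n)) (\<lambda>G. b ^ num_triangles n G)) =
        real (n choose 2) * ln (1 - p n) + ln (gpart (p n / (1 - p n)) b n)"
      using elim Z by (simp add: expectation_power_triangles card ln_mult ln_realpow)
    moreover have "real (n choose 2) / (real n)\<^sup>2 * (ln (1 - p n) / p n) * (p n * sqrt n) =
        real (n choose 2) * ln (1 - p n) / (n * sqrt n)"
    proof -
      have sq: "(real n)\<^sup>2 = (n * sqrt n) * sqrt n" by (simp add: power2_eq_square)
      have cancel: "k / (m * s) * (l / q) * (q * s) = k * l / m" if "s \<noteq> 0" "q \<noteq> 0" for k m s l q :: real
        using that by simp
      show ?thesis unfolding sq by (rule cancel) (use elim in auto)
    qed
    ultimately show ?case by (simp add: log_gpart_def x add_divide_distrib)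
  qed
  ultimately show ?thesis by (simp add: tendsto_cong)
qed

lemma expected_triangles_limit:
  assumes p: "\<And>n. 0 \<le> p n \<and> p n \<le> 1" and lim: "(\<lambda>n. p n * sqrt n) \<longlonglongrightarrow> c"
  shows "(\<lambda>n. expected_triangles n (p n) / (n * sqrt n)) \<longlonglongrightarrow> c ^ 3 / 6"
proof -
  have "(\<lambda>n. real (n choose 3) / real n ^ 3) \<longlonglongrightarrow> 1 / 6"
  proof -
    have eq: "real (n choose 3) = real n * (real n - 1) * (real n - 2) / 6" for n
      by (simp add: binomial_gbinomial gbinomial_prod_rev numeral_3_eq_3 prod.atLeast0_lessThan_Suc fact_numeral)
    show ?thesis unfolding eq by real_asymp
  qed
  from tendsto_mult[OF this tendsto_power[OF lim, of 3]]
  have "(\<lambda>n. real (n choose 3) / real n ^ 3 * (p n * sqrt n) ^ 3) \<longlonglongrightarrow> c ^ 3 / 6" by simp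
  moreover have "\<forall>\<^sub>F n in sequentially. expected_triangles n (p n) / (n * sqrt n) =
      real (n choose 3) / real n ^ 3 * (p n * sqrt n) ^ 3"
    using eventually_gt_at_top[of 0]
  proof eventually_elim
    case (elim n)
    have "real n ^ 3 = (n * sqrt n) * sqrt n ^ 3" by (simp add: power3_eq_cube)
    then show ?case using elim p by (simp add: expected_triangles_eq power_mult_distrib)
  qed
  ultimately show ?thesis by (simp add: tendsto_cong)
qed

text \<open>The negative derivative is the typical triangle count of the tilted graph in units of n
  sqrt n: heuristically n^3 / 6 triples, each a triangle with probability b (a / sqrt n)^3. In the
  computation D (1 + w) = 2 exp (- \<beta>) c^2 exp (- w), and all remaining terms are multiples of
  D (1 + w).\<close>

lemma DERIV_free_energy_tilt:
  assumes \<beta>: "0 < \<beta>" and c: "0 < c"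
  shows "((\<lambda>\<beta>. free_energy (exp (- \<beta>)) c - c / 2) has_field_derivative
    - (exp (- \<beta>) * edge_density (exp (- \<beta>)) c ^ 3 / 6)) (at \<beta>)"
proof -
  let ?y = "\<lambda>\<beta>. 2 * (1 - exp (- \<beta>)) * c\<^sup>2"
  let ?w = "lambert_W (?y \<beta>)"
  have y: "0 < ?y \<beta>" using \<beta> c by simp
  have w: "0 \<le> ?w" using lambert_W_nonneg y by simp
  have "((\<lambda>\<beta>. lambert_W (?y \<beta>)) has_field_derivative
      inverse (exp ?w * (1 + ?w)) * (2 * exp (- \<beta>) * c\<^sup>2)) (at \<beta>)"
    by (rule DERIV_chain2[where f = lambert_W and g = ?y, OF DERIV_lambert_W[OF y]])
      (auto intro!: derivative_eq_intros)
  then obtain D where D: "((\<lambda>\<beta>. lambert_W (?y \<beta>)) has_field_derivative D) (at \<beta>)"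
    and D_eq: "D = inverse (exp ?w * (1 + ?w)) * (2 * exp (- \<beta>) * c\<^sup>2)" by blast
  have d1: "((\<lambda>\<beta>. c * exp (- lambert_W (?y \<beta>) / 2) * (1 + lambert_W (?y \<beta>) / 3) / 2 - c / 2) has_field_derivative
      (c * (exp (- ?w / 2) * (- D / 2)) * (1 + ?w / 3) + c * exp (- ?w / 2) * (D / 3)) / 2) (at \<beta>)"
    by (rule derivative_eq_intros D refl | simp)+
  have "D * (1 + ?w) = 2 * exp (- \<beta>) * c\<^sup>2 * exp (- ?w)"
  proof -
    have "inverse (E * (1 + v)) * Q * (1 + v) = Q * inverse E" if "0 < E" "0 \<le> v" for E v Q :: real
      using that by (simp add: divide_simps)
    then show ?thesis unfolding D_eq exp_minus[of ?w] using w by (simp only: exp_gt_zero)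
  qed
  moreover have "(c * (E * (- D / 2)) * (1 + v / 3) + c * E * (D / 3)) / 2 = - (c * E * (D * (1 + v)) / 12)"
    for E v :: real by (simp add: field_simps)
  moreover have "exp (- ?w) = exp (- ?w / 2) ^ 2" by (simp flip: exp_of_nat_mult)
  ultimately have d2: "(c * (exp (- ?w / 2) * (- D / 2)) * (1 + ?w / 3) + c * exp (- ?w / 2) * (D / 3)) / 2 =
      - (exp (- \<beta>) * (c * exp (- ?w / 2)) ^ 3 / 6)"
    by (simp add: power2_eq_square power3_eq_cube)
  show ?thesis
    using d1[unfolded d2] unfolding free_energy_def edge_density_def by simp
qed

text \<open>A stronger tilt raises the Lambert term, which lowers the edge density, and strictly
  lowers the prefactor. Hence a tilt slightly beyond \<beta> falls strictly below the
  threshold.\<close>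

lemma edge_density_tilt_mono:
  assumes "0 < \<beta>" "\<beta> < s" "0 < c"
  shows "exp (- s) * edge_density (exp (- s)) c ^ 3 / 6 < exp (- \<beta>) * edge_density (exp (- \<beta>)) c ^ 3 / 6"
proof -
  have "2 * (1 - exp (- \<beta>)) * c\<^sup>2 \<le> 2 * (1 - exp (- s)) * c\<^sup>2"
    using assms by (intro mult_right_mono) auto
  then have "lambert_W (2 * (1 - exp (- \<beta>)) * c\<^sup>2) \<le> lambert_W (2 * (1 - exp (- s)) * c\<^sup>2)"
    using assms by (intro lambert_W_mono) auto
  then have "edge_density (exp (- s)) c \<le> edge_density (exp (- \<beta>)) c"
    using assms by (simp add: edge_density_def)
  then have "edge_density (exp (- s)) c ^ 3 \<le> edge_density (exp (- \<beta>)) c ^ 3"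
    using assms edge_density_pos[of c "exp (- s)"] by (intro power_mono) auto
  moreover have "0 < edge_density (exp (- s)) c ^ 3" using edge_density_pos[of c "exp (- s)"] assms by simp
  ultimately have "exp (- s) * edge_density (exp (- s)) c ^ 3 < exp (- \<beta>) * edge_density (exp (- \<beta>)) c ^ 3"
    using assms by (intro mult_less_le_imp_less) auto
  then show ?thesis by simp
qed

lemma isCont_edge_density_tilt:
  assumes "0 < \<beta>" "0 < c"
  shows "isCont (\<lambda>s. exp (- s) * edge_density (exp (- s)) c ^ 3 / 6) \<beta>"
proof -
  have y: "0 < 2 * (1 - exp (- \<beta>)) * c\<^sup>2" using assms by simp
  have "isCont (\<lambda>s. lambert_W (2 * (1 - exp (- s)) * c\<^sup>2)) \<beta>"
    by (rule isCont_o2[where g = lambert_W and f = "\<lambda>s. 2 * (1 - exp (- s)) * c\<^sup>2", OF _ DERIV_isCont[OF DERIV_lambert_W[OF y]]])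
      (intro continuous_intros)
  then show ?thesis unfolding edge_density_def by (intro continuous_intros) auto
qed

text \<open>The equation between \<open>b\<close> and \<eta> says that the triangle count typical
  for the tilted graph, b a^3 / 6, is the limit \<eta> c^3 / 6 of the threshold.\<close>

lemma log_lower_tail_limit:
  assumes b: "0 < b" "b < 1" and c: "0 < c" and sub: "2 * (1 - b) * c\<^sup>2 < exp 1"
    and \<eta>: "b * (edge_density b c) ^ 3 = \<eta> * c ^ 3"
    and p: "\<And>n. 0 \<le> p n \<and> p n \<le> 1" and lim: "(\<lambda>n. p n * sqrt n) \<longlonglongrightarrow> c"
  shows "(\<lambda>n. ln (lower_tail_prob \<eta> n (p n)) / (n * sqrt n)) \<longlonglongrightarrow>
    free_energy b c - c / 2 - ln b * (\<eta> * c ^ 3 / 6)"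
proof -
  define \<beta> where "\<beta> = - ln b"
  have \<beta>: "0 < \<beta>" "exp (- \<beta>) = b" using b by (auto simp: \<beta>_def)
  \<comment> \<open>The tilts for which the limit of the Laplace transform is available; as an open
    set it contains tilts on both sides of each of its points.\<close>
  define S where "S = {s. 0 < s \<and> 2 * (1 - exp (- s)) * c\<^sup>2 < exp 1}"
  have x: "exp (- \<beta>) * edge_density (exp (- \<beta>)) c ^ 3 / 6 = \<eta> * c ^ 3 / 6"
    using \<eta> \<beta> by simp
  have *: "(\<lambda>n. ln (measure_pmf.prob (gnp n (p n)) {G. real (num_triangles n G) \<le> \<eta> * expected_triangles n (p n)}) /
      (n * sqrt n)) \<longlonglongrightarrow>
      (free_energy (exp (- \<beta>)) c - c / 2) + \<beta> * (exp (- \<beta>) * edge_density (exp (- \<beta>)) c ^ 3 / 6)"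
  proof (rule lower_tail_from_laplace_limit[where g = "\<lambda>\<beta>. free_energy (exp (- \<beta>)) c - c / 2" and
        x = "\<lambda>\<beta>. exp (- \<beta>) * edge_density (exp (- \<beta>)) c ^ 3 / 6" and S = S])
    show "filterlim (\<lambda>n. real n * sqrt (real n)) at_top sequentially" by real_asymp
    show "open S" unfolding S_def
      by (intro open_Collect_conj open_Collect_less continuous_intros)
    show "S \<subseteq> {0..}" "\<beta> \<in> S" using \<beta> sub by (auto simp: S_def)
    show "(\<lambda>n. ln (measure_pmf.expectation (gnp n (p n)) (\<lambda>G. exp (- s * real (num_triangles n G)))) / (n * sqrt n))
        \<longlonglongrightarrow> free_energy (exp (- s)) c - c / 2" if "s \<in> S" for s
    proof -
      have "exp (- s * real k) = exp (- s) ^ k" for k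
        by (simp add: mult.commute flip: exp_of_nat_mult)
      then show ?thesis
        using log_laplace_triangles_limit[of "exp (- s)" c p] that c p lim by (simp add: S_def)
    qed
    show "((\<lambda>\<beta>. free_energy (exp (- \<beta>)) c - c / 2) has_field_derivative
      - (exp (- s) * edge_density (exp (- s)) c ^ 3 / 6)) (at s)" if "s \<in> S" for s
      using DERIV_free_energy_tilt that c by (simp add: S_def)
    show "isCont (\<lambda>\<beta>. exp (- \<beta>) * edge_density (exp (- \<beta>)) c ^ 3 / 6) \<beta>"
      by (rule isCont_edge_density_tilt[OF \<beta>(1) c])
    show "exp (- s) * edge_density (exp (- s)) c ^ 3 / 6 < exp (- \<beta>) * edge_density (exp (- \<beta>)) c ^ 3 / 6"
      if "\<beta> < s" for s by (rule edge_density_tilt_mono[OF \<beta>(1) that c])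
    have "(\<lambda>n. \<eta> * (expected_triangles n (p n) / (n * sqrt n))) \<longlonglongrightarrow> \<eta> * (c ^ 3 / 6)"
      by (intro tendsto_intros expected_triangles_limit p lim)
    then show "(\<lambda>n. \<eta> * expected_triangles n (p n) / (n * sqrt n)) \<longlonglongrightarrow>
        exp (- \<beta>) * edge_density (exp (- \<beta>)) c ^ 3 / 6" unfolding x by simp
  qed auto
  show ?thesis
    using *[unfolded x, unfolded \<beta>(2)] by (simp add: lower_tail_prob_def \<beta>_def)
qed

text \<open>For \<eta> = 0 no finite tilt reaches the threshold. Since 0 ^ 0 = 1, the probability of
  having no triangle is the Laplace transform at \<open>b = 0\<close>, so no change of measure is
  needed.\<close>

lemma log_triangle_free_limit:
  assumes c: "0 < c" and sub: "2 * c\<^sup>2 < exp 1"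
    and p: "\<And>n. 0 \<le> p n \<and> p n \<le> 1" and lim: "(\<lambda>n. p n * sqrt n) \<longlonglongrightarrow> c"
  shows "(\<lambda>n. ln (lower_tail_prob 0 n (p n)) / (n * sqrt n)) \<longlonglongrightarrow> free_energy 0 c - c / 2"
proof -
  have "lower_tail_prob 0 n q = measure_pmf.expectation (gnp n q) (\<lambda>G. 0 ^ num_triangles n G)" for n q
  proof -
    have "lower_tail_prob 0 n q = measure_pmf.expectation (gnp n q) (indicator {G. num_triangles n G = 0})"
      by (simp add: lower_tail_prob_def)
    also have "indicator {G. num_triangles n G = 0} = (\<lambda>G. 0 ^ num_triangles n G :: real)"
      by (auto simp: indicator_def power_0_left)
    finally show ?thesis .
  qed
  then show ?thesis using log_laplace_triangles_limit[of 0 c p] c sub p lim by simp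
qed

section \<open>The equation for \<zeta> and the critical curve\<close>

lemma lambert_W_ratio_eq: "0 \<le> y \<Longrightarrow> lambert_W_ratio y = exp (- lambert_W y)"
  using lambert_W_eq[of y] by (auto simp: lambert_W_ratio_def lambert_W_0 exp_minus field_simps)

lemma lambert_W_ratio_powr: "0 \<le> y \<Longrightarrow> lambert_W_ratio y powr (3/2) = exp (- (3/2) * lambert_W y)"
  by (simp add: lambert_W_ratio_eq powr_def)

text \<open>With b = 1 - \<zeta> this is b a^3 / c^3, the factor by which the tilt reduces the
  limiting triangle count.\<close>

definition tilt_ratio :: "real \<Rightarrow> real \<Rightarrow> real" where
  "tilt_ratio c \<zeta> = (1 - \<zeta>) * exp (- (3/2) * lambert_W (2 * \<zeta> * c\<^sup>2))"

lemma zeta_solution_iff: "zeta_solution c \<eta> \<zeta> \<longleftrightarrow> \<zeta> \<in> {0..1} \<and> tilt_ratio c \<zeta> = \<eta>"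
  by (auto simp: zeta_solution_def tilt_ratio_def lambert_W_ratio_powr)

lemma tilt_ratio_strict_antimono:
  assumes "0 \<le> x" "x < y" "y \<le> 1"
  shows "tilt_ratio c y < tilt_ratio c x"
proof -
  have "lambert_W (2 * x * c\<^sup>2) \<le> lambert_W (2 * y * c\<^sup>2)"
    using assms by (intro lambert_W_mono mult_right_mono) auto
  then have "exp (- (3/2) * lambert_W (2 * y * c\<^sup>2)) \<le> exp (- (3/2) * lambert_W (2 * x * c\<^sup>2))" by simp
  then show ?thesis
    unfolding tilt_ratio_def using assms by (intro mult_less_le_imp_less) auto
qed

text \<open>\<open>tilt_ratio\<close> is continuous and strictly decreasing, from 1 at \<zeta> = 0
  to 0 at \<zeta> = 1.\<close>

lemma ex1_zeta_solution:
  assumes \<eta>: "0 \<le> \<eta>" "\<eta> < 1"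
  shows "\<exists>!\<zeta>. zeta_solution c \<eta> \<zeta>"
proof -
  have "continuous_on {0..1} (\<lambda>\<zeta>. lambert_W (2 * \<zeta> * c\<^sup>2))"
    by (rule continuous_on_compose2[OF continuous_on_lambert_W]) (auto intro!: continuous_intros)
  then have cont: "continuous_on {0..1} (tilt_ratio c)"
    unfolding tilt_ratio_def[abs_def] by (intro continuous_intros)
  have "\<exists>\<zeta>\<ge>0. \<zeta> \<le> 1 \<and> tilt_ratio c \<zeta> = \<eta>"
    by (rule IVT2'[OF _ _ _ cont]) (use \<eta> in \<open>auto simp: tilt_ratio_def lambert_W_0\<close>)
  then obtain \<zeta> where \<zeta>: "\<zeta> \<in> {0..1}" "tilt_ratio c \<zeta> = \<eta>" by auto
  show ?thesis
    unfolding zeta_solution_iff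
  proof (rule ex1I[of _ \<zeta>])
    fix z assume z: "z \<in> {0..1} \<and> tilt_ratio c z = \<eta>"
    show "z = \<zeta>"
      using tilt_ratio_strict_antimono[of z \<zeta> c] tilt_ratio_strict_antimono[of \<zeta> z c] z \<zeta>
      by (cases z \<zeta> rule: linorder_cases) auto
  qed (use \<zeta> in auto)
qed

text \<open>\<open>eta_star\<close> is the Lambert factor at \<open>\<zeta> c\<^sup>2 = 1 / e\<close>, so \<open>c < c_bar \<eta>\<close> amounts to
  \<open>\<zeta> c\<^sup>2 < 1 / e\<close>.\<close>

lemma zeta_solution_subcritical:
  assumes sol: "zeta_solution c \<eta> \<zeta>" and \<eta>: "0 \<le> \<eta>" "\<eta> < 1" and c: "0 < c" "ereal c < c_bar \<eta>"
  shows "2 * \<zeta> * c\<^sup>2 < exp 1"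
proof (rule ccontr)
  assume "\<not> 2 * \<zeta> * c\<^sup>2 < exp 1"
  then have large: "exp 1 \<le> 2 * \<zeta> * c\<^sup>2" by simp
  have e1: "1 < exp (1 :: real)" by simp
  have e2: "2 / exp 1 < exp (1 :: real)"
  proof -
    have "2 \<le> exp (1 :: real)" using exp_ge_add_one_self[of 1] by simp
    then have "2 / exp 1 \<le> (1 :: real)" by simp
    then show ?thesis using e1 by linarith
  qed
  have \<zeta>: "0 \<le> \<zeta>" "\<zeta> \<le> 1" "tilt_ratio c \<zeta> = \<eta>" using sol by (auto simp: zeta_solution_iff)
  have \<zeta>0: "0 < \<zeta>"
  proof (rule ccontr)
    assume "\<not> 0 < \<zeta>"
    then have "\<zeta> = 0" using \<zeta> by simp
    then show False using large e1 by simp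
  qed
  have star: "eta_star = exp (- (3/2) * lambert_W (2 / exp 1))"
    by (simp add: eta_star_def lambert_W_ratio_powr)
  have star0: "0 < eta_star" unfolding star by (rule exp_gt_zero)
  \<comment> \<open>The assumption to be refuted puts the argument above e, hence above 2 / e, so
    the Lambert factor of \<zeta> is at most \<open>eta_star\<close>.\<close>
  have "lambert_W (2 / exp 1) \<le> lambert_W (2 * \<zeta> * c\<^sup>2)"
    using large e2 by (intro lambert_W_mono) auto
  then have "exp (- (3/2) * lambert_W (2 * \<zeta> * c\<^sup>2)) \<le> eta_star" by (simp add: star)
  then have le: "\<eta> \<le> (1 - \<zeta>) * eta_star"
    using \<zeta> unfolding tilt_ratio_def by (metis diff_ge_0_iff_ge mult_left_mono)
  also have "\<dots> < eta_star" using \<zeta>0 star0 by simp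
  finally have lt: "\<eta> < eta_star" .
  define r where "r = exp 1 * (1 - \<eta> / eta_star)"
  have r0: "0 < r" using lt star0 by (simp add: r_def)
  have "c < 1 / sqrt r" using c(2) lt by (simp add: c_bar_def r_def)
  then have "c\<^sup>2 < (1 / sqrt r)\<^sup>2" using c by (intro power_strict_mono) auto
  then have "c\<^sup>2 * r < 1" using r0 by (simp add: power_divide pos_less_divide_eq)
  moreover have "\<eta> / eta_star \<le> 1 - \<zeta>" using le star0 by (simp add: pos_divide_le_eq)
  then have "exp 1 * \<zeta> \<le> r" unfolding r_def by (intro mult_left_mono) auto
  then have "c\<^sup>2 * (exp 1 * \<zeta>) \<le> c\<^sup>2 * r" by (intro mult_left_mono) auto
  \<comment> \<open>Together with 2 \<zeta> c^2 >= e this would give e^2 < 2.\<close>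
  ultimately have "exp 1 * (2 * \<zeta> * c\<^sup>2) < 2" by (simp add: mult_ac)
  moreover have "exp 1 * exp 1 \<le> exp 1 * (2 * \<zeta> * c\<^sup>2)" using large by (intro mult_left_mono) auto
  moreover have "2 * 1 \<le> exp 1 * exp (1 :: real)"
    using exp_ge_add_one_self[of 1] e1 by (intro mult_mono) auto
  ultimately show False by linarith
qed

text \<open>By \<open>edge_density_square\<close>, W = 2 \<zeta> a^2, so the square root of W is
  sqrt (2 \<zeta>) times a and the denominator sqrt (2 \<zeta>) cancels.\<close>

lemma rate_eq:
  assumes \<zeta>: "0 < \<zeta>" and c: "0 < c"
  shows "rate c \<eta> \<zeta> = free_energy (1 - \<zeta>) c - c / 2 - ln (1 - \<zeta>) * (\<eta> * c ^ 3 / 6)"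
proof -
  define a where "a = edge_density (1 - \<zeta>) c"
  define W where "W = lambert_W (2 * \<zeta> * c\<^sup>2)"
  have a: "0 < a" using edge_density_pos[OF c] by (simp add: a_def)
  have W: "W = 2 * \<zeta> * a\<^sup>2"
    using edge_density_square[of "1 - \<zeta>" c] \<zeta> by (simp add: a_def W_def)
  have W0: "0 < W" using W \<zeta> a by simp
  define s where "s = sqrt (2 * \<zeta>)"
  have s: "0 < s" using \<zeta> by (simp add: s_def)
  have half: "W powr (1/2) = s * a"
    using W W0 a \<zeta> by (simp add: powr_half_sqrt real_sqrt_mult s_def)
  have "W powr (3/2) = W powr (1 + 1/2)" by simp
  also have "\<dots> = W * (s * a)" using W0 half by (subst powr_add) simp
  finally have "(W powr (3/2) + 3 * W powr (1/2)) / (3 * s) = a * (W + 3) / 3"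
    unfolding half using s by (simp add: field_simps)
  moreover have "rate c \<eta> \<zeta> = (1/2) * ((W powr (3/2) + 3 * W powr (1/2)) / (3 * s) - ln (1 - \<zeta>) * \<eta> * c ^ 3 / 3 - c)"
    by (simp only: rate_def W_def s_def)
  moreover have "free_energy (1 - \<zeta>) c = a * (1 + W / 3) / 2"
    by (simp add: free_energy_def a_def W_def)
  ultimately show ?thesis by (simp add: field_simps)
qed

theorem theorem1p1:
  fixes c \<eta> :: real and p :: "nat \<Rightarrow> real"
  assumes "c > 0" and "0 \<le> \<eta>" and "\<eta> < 1" and "ereal c < c_bar \<eta>"
    and "\<And>n. 0 \<le> p n \<and> p n \<le> 1"
    and "p \<sim>[sequentially] (\<lambda>n. c / sqrt (real n))"
  shows "(\<exists>!\<zeta>. zeta_solution c \<eta> \<zeta>) \<and>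
    (\<forall>\<zeta>. zeta_solution c \<eta> \<zeta> \<longrightarrow>
      (\<lambda>n. 1 / real n powr (3/2) * ln (lower_tail_prob \<eta> n (p n))) \<longlonglongrightarrow> rate c \<eta> \<zeta>)"
proof (intro conjI allI impI)
  show "\<exists>!\<zeta>. zeta_solution c \<eta> \<zeta>" using assms by (intro ex1_zeta_solution)
next
  fix \<zeta> assume sol: "zeta_solution c \<eta> \<zeta>"
  have sub: "2 * \<zeta> * c\<^sup>2 < exp 1" by (rule zeta_solution_subcritical[OF sol assms(2,3,1,4)])
  have \<zeta>: "0 \<le> \<zeta>" "\<zeta> \<le> 1" "tilt_ratio c \<zeta> = \<eta>" using sol by (auto simp: zeta_solution_iff)
  \<comment> \<open>At \<zeta> = 0 the ratio is 1, which \<eta> < 1 excludes. So b = 1 - \<zeta> <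
    1, as the free energy limit requires.\<close>
  have "\<zeta> \<noteq> 0" using \<zeta>(3) assms(3) by (auto simp: tilt_ratio_def lambert_W_0)
  then have \<zeta>0: "0 < \<zeta>" using \<zeta> by simp
  have "(\<lambda>n. p n / (c / sqrt (real n))) \<longlonglongrightarrow> 1"
    using assms(6) by (rule asymp_equivD_strong) (use assms(1) in \<open>auto intro!: eventually_mono[OF eventually_gt_at_top[of 0]]\<close>)
  then have "(\<lambda>n. p n / (c / sqrt (real n)) * c) \<longlonglongrightarrow> 1 * c" by (intro tendsto_intros)
  then have lim: "(\<lambda>n. p n * sqrt n) \<longlonglongrightarrow> c" using assms(1) by simp
  have main: "(\<lambda>n. ln (lower_tail_prob \<eta> n (p n)) / (n * sqrt n)) \<longlonglongrightarrow> rate c \<eta> \<zeta>"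
  \<comment> \<open>For \<zeta> = 1 the tilt - ln b would be infinite; this is exactly the
    triangle-free case \<eta> = 0.\<close>
  proof (cases "\<zeta> = 1")
    case True
    then have "\<eta> = 0" using \<zeta>(3) by (simp add: tilt_ratio_def)
    then show ?thesis
      using log_triangle_free_limit[OF assms(1) _ assms(5) lim] sub rate_eq[OF \<zeta>0 assms(1), of \<eta>] True by simp
  next
    case False
    have "(1 - \<zeta>) * edge_density (1 - \<zeta>) c ^ 3 = \<eta> * c ^ 3"
    proof -
      have "exp (- lambert_W (2 * \<zeta> * c\<^sup>2) / 2) ^ 3 = exp (- (3/2) * lambert_W (2 * \<zeta> * c\<^sup>2))"
        by (simp flip: exp_of_nat_mult)
      then show ?thesis using \<zeta>(3) by (simp add: edge_density_def tilt_ratio_def power_mult_distrib)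
    qed
    then show ?thesis
      unfolding rate_eq[OF \<zeta>0 assms(1)]
      using False \<zeta> \<zeta>0 sub by (intro log_lower_tail_limit assms(1,5) lim) auto
  qed
  have "real n powr (3/2) = n * sqrt n" for n :: nat
  proof (cases "n = 0")
    case False
    have "real n powr (3/2) = real n powr (1 + 1/2)" by simp
    also have "\<dots> = n * sqrt n" using False by (subst powr_add) (simp add: powr_half_sqrt)
    finally show ?thesis .
  qed simp
  then show "(\<lambda>n. 1 / real n powr (3/2) * ln (lower_tail_prob \<eta> n (p n))) \<longlonglongrightarrow> rate c \<eta> \<zeta>"
    using main by simp
qed

end
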